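(* Let $\mathcal C$ be a concrete monoidal $W^*$-category with a semi-regular braiding $c$, and let $L\in\mathcal C$ be an object with underlying Hilbert space $\mathscr L$. Let $F\in\mathcal U_{\mathcal C}(L\otimes L)$ be a multiplicative unitary in $\mathcal C$ and put $$C(F):=[(\mathrm{id}\otimes\omega)(c_{L,L}^{-1}\circ F)\mid\omega\in\mathcal B(\mathscr L)_*],\qquad \hat A(F):=[(\mathrm{id}\otimes\omega)(F)\mid\omega\in\mathcal B(\mathscr L)_*].$$ If $C(F)=C(F)^*$ (in particular, if $F$ is semi-regular, i.e. $\mathcal K(\mathscr L)\subseteq C(F)$), then $\hat A(F)$ is a $C^*$-algebra.
   Context: A $W^*$-category is a $C^*$-category whose Hom-spaces are dual Banach spaces; a functor between $W^*$-categories is normal if it is ultraweakly continuous on Hom-spaces. A concrete monoidal $W^*$-category is a monoidal $W^*$-category $(\mathcal C,\otimes,\mathbb 1)$ (with normal bifunctor $\otimes$) together with a normal strong monoidal ($*$-preserving) functor to the category of Hilbert spaces and bounded maps with the Hilbert space tensor product. The Hilbert space underlying $H,K,L\in\mathcal C$ is denoted $\mathscr H,\mathscr K,\mathscr L$; coherence isomorphisms are suppressed and morphisms are identified with the bounded operators they induce. $\mathcal U_{\mathcal C}(X)$ is the set of unitary endomorphisms of $X$ in $\mathcal C$. A braiding $c$ on $\mathcal C$ is a family of natural isomorphisms $c_{X,Y}:X\otimes Y\to Y\otimes X$ with $c_{U,V\otimes W}=(\mathrm{id}_V\otimes c_{U,W})(c_{U,V}\otimes \mathrm{id}_W)$ and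 $c_{U\otimes V,W}=(c_{U,W}\otimes\mathrm{id}_V)(\mathrm{id}_U\otimes c_{V,W})$. $[X]$ denotes the norm-closed linear span; $\mathcal K(\mathscr H,\mathscr K)$ the compact operators, $\mathcal K(\mathscr L)=\mathcal K(\mathscr L,\mathscr L)$; $\mathcal B(\mathscr H,\mathscr K)_*$ the predual (normal functionals). For $X\in\mathcal B(\mathscr H\otimes\mathscr K,\mathscr H'\otimes\mathscr K')$ and $\omega\in\mathcal B(\mathscr K,\mathscr K')_*$, $(\mathrm{id}\otimes\omega)(X)\in\mathcal B(\mathscr H,\mathscr H')$ is the slice. The braiding $c$ is semi-regular if it is unitary and $\mathcal K(\mathscr H,\mathscr K)\subseteq[(\mathrm{id}\otimes\omega)(c_{H,K})\mid\omega\in\mathcal B(\mathscr K,\mathscr H)_*]$ for all $H,K\in\mathcal C$. $F\in\mathcal U_{\mathcal C}(L\otimes L)$ is a multiplicative unitary in $\mathcal C$ if on $L\otimes L\otimes L$ $$F_{23}F_{12}=F_{12}\,(c_{L,L}^{-1})_{12}\,F_{23}\,(c_{L,L})_{12}\,F_{23},$$ where $F_{12}=F\otimes\mathrm{id}_L$, $F_{23}=\mathrm{id}_L\otimes F$, $(c_{L,L})_{12}=c_{L,L}\otimes\mathrm{id}_L$. *)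

theory Defs
  imports "HOL-Analysis.Analysis"
begin

section \<open>Complex Hilbert spaces and bounded operators\<close>

class complex_hilbert_space = real_inner + complete_space +
  fixes scaleC :: "complex \<Rightarrow> 'a \<Rightarrow> 'a" (infixr "*\<^sub>C" 75)
    and cinner :: "'a \<Rightarrow> 'a \<Rightarrow> complex"
  assumes scaleC_add_right: "a *\<^sub>C (x + y) = a *\<^sub>C x + a *\<^sub>C y"
    and scaleC_add_left: "(a + b) *\<^sub>C x = a *\<^sub>C x + b *\<^sub>C x"
    and scaleC_scaleC: "a *\<^sub>C (b *\<^sub>C x) = (a * b) *\<^sub>C x"
    and scaleR_scaleC: "r *\<^sub>R x = complex_of_real r *\<^sub>C x"
    and cinner_commute: "cinner x y = cnj (cinner y x)"
    and cinner_add_right: "cinner x (y + z) = cinner x y + cinner x z"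
    and cinner_scaleC_right: "cinner x (a *\<^sub>C y) = a * cinner x y"
    and inner_eq_Re_cinner: "inner x y = Re (cinner x y)"

text \<open>All Hilbert spaces of a given family are realised as closed complex subspaces of one
  ambient Hilbert space, the type \<open>'v\<close> (for an arbitrary family one can take its Hilbert direct
  sum).  The ambient space plays no other role; in particular tensor products are not
  formed from it.\<close>

definition hilbert_subspace :: "'v::complex_hilbert_space set \<Rightarrow> bool" where
  "hilbert_subspace H \<longleftrightarrow> module.subspace scaleC H \<and> closed H"

text \<open>A bounded operator from \<open>H\<close> to \<open>K\<close> is represented by its extension by zero on the
  orthogonal complement of \<open>H\<close>.  This makes equality, sums, the operator norm, composition and
  adjoints agree with those of the ambient type of bounded linear maps.\<close>

definition bop :: "'v::complex_hilbert_space set \<Rightarrow> 'v set \<Rightarrow> ('v \<Rightarrow>\<^sub>L 'v) set" where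
  "bop H K = {T. (\<forall>a x. blinfun_apply T (a *\<^sub>C x) = a *\<^sub>C blinfun_apply T x) \<and>
                 (\<forall>x. blinfun_apply T x \<in> K) \<and>
                 (\<forall>x. (\<forall>h\<in>H. cinner h x = 0) \<longrightarrow> blinfun_apply T x = 0)}"

definition op_scaleC ::
    "complex \<Rightarrow> ('v::complex_hilbert_space \<Rightarrow>\<^sub>L 'v) \<Rightarrow> ('v \<Rightarrow>\<^sub>L 'v)" where
  "op_scaleC a T = Blinfun (\<lambda>x. a *\<^sub>C blinfun_apply T x)"

definition closed_span :: "('v::complex_hilbert_space \<Rightarrow>\<^sub>L 'v) set \<Rightarrow> ('v \<Rightarrow>\<^sub>L 'v) set" where
  "closed_span S = closure (module.span op_scaleC S)"

definition adj :: "('v::complex_hilbert_space \<Rightarrow>\<^sub>L 'v) \<Rightarrow> ('v \<Rightarrow>\<^sub>L 'v)" where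
  "adj T = (THE S. \<forall>x y. cinner (blinfun_apply S y) x = cinner y (blinfun_apply T x))"

definition compact_ops :: "'v::complex_hilbert_space set \<Rightarrow> 'v set \<Rightarrow> ('v \<Rightarrow>\<^sub>L 'v) set" where
  "compact_ops H K = {T \<in> bop H K. compact (closure (blinfun_apply T ` (H \<inter> cball 0 1)))}"

text \<open>The predual \<open>B(H,K)\<^sub>*\<close>: the functionals
  \<open>T \<mapsto> \<Sum>n. \<langle>\<eta>\<^sub>n, T \<xi>\<^sub>n\<rangle>\<close> with square-summable
  families of vectors.\<close>

definition normal_functionals ::
    "'v::complex_hilbert_space set \<Rightarrow> 'v set \<Rightarrow> (('v \<Rightarrow>\<^sub>L 'v) \<Rightarrow> complex) set" where
  "normal_functionals H K =
    {\<lambda>T\<in>bop H K. \<Sum>n. cinner (\<eta> n) (blinfun_apply T (\<xi> n)) |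
      (\<xi> :: nat \<Rightarrow> 'v) (\<eta> :: nat \<Rightarrow> 'v).
      (\<forall>n. \<xi> n \<in> H \<and> \<eta> n \<in> K) \<and>
      summable (\<lambda>n. (norm (\<xi> n))\<^sup>2) \<and> summable (\<lambda>n. (norm (\<eta> n))\<^sup>2)}"

definition cstar_subalgebra ::
    "'v::complex_hilbert_space set \<Rightarrow> ('v \<Rightarrow>\<^sub>L 'v) set \<Rightarrow> bool" where
  "cstar_subalgebra H A \<longleftrightarrow>
     A \<subseteq> bop H H \<and> module.subspace op_scaleC A \<and> closed A \<and>
     (\<forall>S\<in>A. \<forall>T\<in>A. S o\<^sub>L T \<in> A) \<and> (\<forall>T\<in>A. adj T \<in> A)"

section \<open>Tensor products and slice maps\<close>

text \<open>\<open>T\<close>, together with the map \<open>t x y = x \<otimes> y\<close>, is a Hilbert space tensor product of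
  \<open>H\<close> and \<open>K\<close>; this determines \<open>(T, t)\<close> up to a unique compatible unitary.\<close>

definition is_hilbert_tensor ::
    "'v::complex_hilbert_space set \<Rightarrow> 'v set \<Rightarrow> 'v set \<Rightarrow> ('v \<Rightarrow> 'v \<Rightarrow> 'v) \<Rightarrow> bool" where
  "is_hilbert_tensor H K T t \<longleftrightarrow>
     (\<forall>x\<in>H. \<forall>x'\<in>H. \<forall>y\<in>K. t (x + x') y = t x y + t x' y) \<and>
     (\<forall>x\<in>H. \<forall>y\<in>K. \<forall>y'\<in>K. t x (y + y') = t x y + t x y') \<and>
     (\<forall>a. \<forall>x\<in>H. \<forall>y\<in>K. t (a *\<^sub>C x) y = a *\<^sub>C t x y \<and> t x (a *\<^sub>C y) = a *\<^sub>C t x y) \<and>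
     (\<forall>x\<in>H. \<forall>x'\<in>H. \<forall>y\<in>K. \<forall>y'\<in>K.
        cinner (t x y) (t x' y') = cinner x x' * cinner y y') \<and>
     T = closure (module.span scaleC {t x y | x y. x \<in> H \<and> y \<in> K})"

text \<open>The operator from \<open>H\<close> to \<open>K\<close> with matrix coefficients
  \<open>\<langle>y, T x\<rangle> = B x y\<close>, where \<open>B\<close> is a bounded sesquilinear form.\<close>

definition form_op ::
    "'v::complex_hilbert_space set \<Rightarrow> 'v set \<Rightarrow> ('v \<Rightarrow> 'v \<Rightarrow> complex) \<Rightarrow> ('v \<Rightarrow>\<^sub>L 'v)" where
  "form_op H K B =
     (THE T. T \<in> bop H K \<and> (\<forall>x\<in>H. \<forall>y\<in>K. cinner y (blinfun_apply T x) = B x y))"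

text \<open>The slice \<open>(id \<otimes> \<omega>)(X)\<close> of an operator \<open>X\<close> from \<open>H \<otimes> K\<close> to \<open>H' \<otimes> K'\<close>, for a
  functional \<open>\<omega>\<close> on \<open>B(K,K')\<close>: it is determined by
  \<open>\<langle>\<eta>, (id \<otimes> \<omega>)(X) \<xi>\<rangle> = \<omega>(\<theta>\<^sub>\<eta>\<^sup>* X \<theta>\<^sub>\<xi>)\<close>
  with \<open>\<theta>\<^sub>\<xi> x = \<xi> \<otimes> x\<close>; the inner \<open>form_op\<close> is the operator
  \<open>\<theta>\<^sub>\<eta>\<^sup>* X \<theta>\<^sub>\<xi>\<close> from \<open>K\<close> to \<open>K'\<close>.\<close>

definition slice ::
    "'v::complex_hilbert_space set \<Rightarrow> 'v set \<Rightarrow> ('v \<Rightarrow> 'v \<Rightarrow> 'v) \<Rightarrow>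
     'v set \<Rightarrow> 'v set \<Rightarrow> ('v \<Rightarrow> 'v \<Rightarrow> 'v) \<Rightarrow>
     (('v \<Rightarrow>\<^sub>L 'v) \<Rightarrow> complex) \<Rightarrow> ('v \<Rightarrow>\<^sub>L 'v) \<Rightarrow> ('v \<Rightarrow>\<^sub>L 'v)" where
  "slice H K t H' K' t' \<omega> X =
     form_op H H' (\<lambda>\<xi> \<eta>. \<omega> (form_op K K' (\<lambda>x y. cinner (t' \<eta> y) (blinfun_apply X (t \<xi> x)))))"

section \<open>Dual Banach spaces\<close>

record 'a cspace =
  carr :: "'a set"
  vadd :: "'a \<Rightarrow> 'a \<Rightarrow> 'a"
  vzero :: "'a"
  vscale :: "complex \<Rightarrow> 'a \<Rightarrow> 'a"
  vnorm :: "'a \<Rightarrow> real"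

definition vdist :: "'a cspace \<Rightarrow> 'a \<Rightarrow> 'a \<Rightarrow> real" where
  "vdist V x y = vnorm V (vadd V x (vscale V (-1) y))"

definition complex_banach :: "'a cspace \<Rightarrow> bool" where
  "complex_banach V \<longleftrightarrow>
     vzero V \<in> carr V \<and>
     (\<forall>x\<in>carr V. \<forall>y\<in>carr V. vadd V x y \<in> carr V \<and> vadd V x y = vadd V y x) \<and>
     (\<forall>x\<in>carr V. \<forall>y\<in>carr V. \<forall>z\<in>carr V. vadd V (vadd V x y) z = vadd V x (vadd V y z)) \<and>
     (\<forall>x\<in>carr V. vadd V (vzero V) x = x \<and> vadd V x (vscale V (-1) x) = vzero V) \<and>
     (\<forall>a. \<forall>x\<in>carr V. vscale V a x \<in> carr V) \<and>
     (\<forall>x\<in>carr V. vscale V 1 x = x) \<and>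
     (\<forall>a b. \<forall>x\<in>carr V. vscale V a (vscale V b x) = vscale V (a * b) x \<and>
                          vscale V (a + b) x = vadd V (vscale V a x) (vscale V b x)) \<and>
     (\<forall>a. \<forall>x\<in>carr V. \<forall>y\<in>carr V. vscale V a (vadd V x y) = vadd V (vscale V a x) (vscale V a y)) \<and>
     (\<forall>x\<in>carr V. vnorm V x = 0 \<longleftrightarrow> x = vzero V) \<and>
     (\<forall>a. \<forall>x\<in>carr V. vnorm V (vscale V a x) = cmod a * vnorm V x) \<and>
     (\<forall>x\<in>carr V. \<forall>y\<in>carr V. vnorm V (vadd V x y) \<le> vnorm V x + vnorm V y) \<and>
     (\<forall>s::nat \<Rightarrow> 'a. (\<forall>n. s n \<in> carr V) \<and>
          (\<forall>e>0. \<exists>N. \<forall>m\<ge>N. \<forall>n\<ge>N. vdist V (s m) (s n) < e) \<longrightarrow>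
          (\<exists>l\<in>carr V. (\<lambda>n. vdist V (s n) l) \<longlonglongrightarrow> 0))"

definition cdual :: "'a cspace \<Rightarrow> ('a \<Rightarrow> complex) cspace" where
  "cdual V = \<lparr>
     carr = {\<phi> \<in> extensional (carr V).
        (\<forall>x\<in>carr V. \<forall>y\<in>carr V. \<phi> (vadd V x y) = \<phi> x + \<phi> y) \<and>
        (\<forall>a. \<forall>x\<in>carr V. \<phi> (vscale V a x) = a * \<phi> x) \<and>
        (\<exists>B. \<forall>x\<in>carr V. cmod (\<phi> x) \<le> B * vnorm V x)},
     vadd = (\<lambda>\<phi> \<psi>. \<lambda>x\<in>carr V. \<phi> x + \<psi> x),
     vzero = (\<lambda>x\<in>carr V. 0),
     vscale = (\<lambda>a \<phi>. \<lambda>x\<in>carr V. a * \<phi> x),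
     vnorm = (\<lambda>\<phi>. Sup {cmod (\<phi> x) | x. x \<in> carr V \<and> vnorm V x \<le> 1}) \<rparr>"

text \<open>A predual of \<open>V\<close>, viewed inside the dual of \<open>V\<close> via the canonical embedding of a Banach
  space into its bidual: a closed subspace \<open>P\<close> of the dual such that evaluation identifies \<open>V\<close>
  isometrically with the dual of \<open>P\<close>.\<close>

definition is_predual :: "'a cspace \<Rightarrow> ('a \<Rightarrow> complex) set \<Rightarrow> bool" where
  "is_predual V P \<longleftrightarrow>
     P \<subseteq> carr (cdual V) \<and> complex_banach ((cdual V)\<lparr>carr := P\<rparr>) \<and>
     bij_betw (\<lambda>v. \<lambda>\<phi>\<in>P. \<phi> v) (carr V) (carr (cdual ((cdual V)\<lparr>carr := P\<rparr>))) \<and>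
     (\<forall>v\<in>carr V. vnorm (cdual ((cdual V)\<lparr>carr := P\<rparr>)) (\<lambda>\<phi>\<in>P. \<phi> v) = vnorm V v)"

text \<open>The topology on \<open>V\<close> induced by a set of functionals; for a predual this is the
  ultraweak topology.\<close>

definition weak_topology_on :: "'a set \<Rightarrow> ('a \<Rightarrow> complex) set \<Rightarrow> 'a topology" where
  "weak_topology_on V P =
     topology_generated_by (insert V {{v \<in> V. \<phi> v \<in> U} | \<phi> U. \<phi> \<in> P \<and> open U})"

section \<open>Monoidal W*-categories\<close>

text \<open>The objects are the elements of the type \<open>'o\<close>.  \<open>Predual X Y\<close> is the predual of
  \<open>Hom X Y\<close>, which is unique for W*-categories.\<close>

record ('o, 'm) wstar_cat =
  Hom :: "'o \<Rightarrow> 'o \<Rightarrow> 'm cspace"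
  Predual :: "'o \<Rightarrow> 'o \<Rightarrow> ('m \<Rightarrow> complex) set"
  Idt :: "'o \<Rightarrow> 'm"
  Comp :: "'m \<Rightarrow> 'm \<Rightarrow> 'm" (infixl "\<cdot>\<index>" 70)
  Star :: "'m \<Rightarrow> 'm" ("_\<dagger>\<index>" [1000] 999)

definition Mor :: "('o, 'm, 'x) wstar_cat_scheme \<Rightarrow> 'o \<Rightarrow> 'o \<Rightarrow> 'm set" where
  "Mor C X Y = carr (Hom C X Y)"

definition ultraweak :: "('o, 'm, 'x) wstar_cat_scheme \<Rightarrow> 'o \<Rightarrow> 'o \<Rightarrow> 'm topology" where
  "ultraweak C X Y = weak_topology_on (Mor C X Y) (Predual C X Y)"

definition iso_mor :: "('o, 'm, 'x) wstar_cat_scheme \<Rightarrow> 'o \<Rightarrow> 'o \<Rightarrow> 'm set" where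
  "iso_mor C X Y = {f \<in> Mor C X Y. \<exists>g\<in>Mor C Y X.
     g \<cdot>\<^bsub>C\<^esub> f = Idt C X \<and> f \<cdot>\<^bsub>C\<^esub> g = Idt C Y}"

definition inverse_mor :: "('o, 'm, 'x) wstar_cat_scheme \<Rightarrow> 'o \<Rightarrow> 'o \<Rightarrow> 'm \<Rightarrow> 'm" where
  "inverse_mor C X Y f =
     (THE g. g \<in> Mor C Y X \<and> g \<cdot>\<^bsub>C\<^esub> f = Idt C X \<and> f \<cdot>\<^bsub>C\<^esub> g = Idt C Y)"

definition unitary_mor :: "('o, 'm, 'x) wstar_cat_scheme \<Rightarrow> 'o \<Rightarrow> 'o \<Rightarrow> 'm set" where
  "unitary_mor C X Y = {f \<in> Mor C X Y.
     f\<dagger>\<^bsub>C\<^esub> \<cdot>\<^bsub>C\<^esub> f = Idt C X \<and> f \<cdot>\<^bsub>C\<^esub> f\<dagger>\<^bsub>C\<^esub> = Idt C Y}"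

locale cstar_category =
  fixes C :: "('o, 'm, 'x) wstar_cat_scheme" (structure)
  assumes hom_banach: "complex_banach (Hom C X Y)"
    and idt_in: "Idt C X \<in> Mor C X X"
    and comp_in: "f \<in> Mor C X Y \<Longrightarrow> g \<in> Mor C Y Z \<Longrightarrow> g \<cdot> f \<in> Mor C X Z"
    and comp_idt: "f \<in> Mor C X Y \<Longrightarrow> f \<cdot> Idt C X = f"
    and idt_comp: "f \<in> Mor C X Y \<Longrightarrow> Idt C Y \<cdot> f = f"
    and comp_assoc: "f \<in> Mor C W X \<Longrightarrow> g \<in> Mor C X Y \<Longrightarrow> h \<in> Mor C Y Z \<Longrightarrow>
          (h \<cdot> g) \<cdot> f = h \<cdot> (g \<cdot> f)"
    and comp_add_left: "f \<in> Mor C X Y \<Longrightarrow> g \<in> Mor C Y Z \<Longrightarrow> g' \<in> Mor C Y Z \<Longrightarrow>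
          vadd (Hom C Y Z) g g' \<cdot> f = vadd (Hom C X Z) (g \<cdot> f) (g' \<cdot> f)"
    and comp_add_right: "f \<in> Mor C X Y \<Longrightarrow> f' \<in> Mor C X Y \<Longrightarrow> g \<in> Mor C Y Z \<Longrightarrow>
          g \<cdot> vadd (Hom C X Y) f f' = vadd (Hom C X Z) (g \<cdot> f) (g \<cdot> f')"
    and comp_scale_left: "f \<in> Mor C X Y \<Longrightarrow> g \<in> Mor C Y Z \<Longrightarrow>
          vscale (Hom C Y Z) a g \<cdot> f = vscale (Hom C X Z) a (g \<cdot> f)"
    and comp_scale_right: "f \<in> Mor C X Y \<Longrightarrow> g \<in> Mor C Y Z \<Longrightarrow>
          g \<cdot> vscale (Hom C X Y) a f = vscale (Hom C X Z) a (g \<cdot> f)"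
    and comp_norm: "f \<in> Mor C X Y \<Longrightarrow> g \<in> Mor C Y Z \<Longrightarrow>
          vnorm (Hom C X Z) (g \<cdot> f) \<le> vnorm (Hom C Y Z) g * vnorm (Hom C X Y) f"
    and star_in: "f \<in> Mor C X Y \<Longrightarrow> f\<dagger> \<in> Mor C Y X"
    and star_star: "f \<in> Mor C X Y \<Longrightarrow> (f\<dagger>)\<dagger> = f"
    and star_comp: "f \<in> Mor C X Y \<Longrightarrow> g \<in> Mor C Y Z \<Longrightarrow> (g \<cdot> f)\<dagger> = f\<dagger> \<cdot> g\<dagger>"
    and star_add: "f \<in> Mor C X Y \<Longrightarrow> g \<in> Mor C X Y \<Longrightarrow>
          (vadd (Hom C X Y) f g)\<dagger> = vadd (Hom C Y X) (f\<dagger>) (g\<dagger>)"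
    and star_scale: "f \<in> Mor C X Y \<Longrightarrow>
          (vscale (Hom C X Y) a f)\<dagger> = vscale (Hom C Y X) (cnj a) (f\<dagger>)"
    and cstar_identity: "f \<in> Mor C X Y \<Longrightarrow>
          vnorm (Hom C X X) (f\<dagger> \<cdot> f) = (vnorm (Hom C X Y) f)\<^sup>2"
    and star_comp_positive: "f \<in> Mor C X Y \<Longrightarrow> \<exists>g\<in>Mor C X X. f\<dagger> \<cdot> f = g\<dagger> \<cdot> g"

locale wstar_category = cstar_category +
  assumes hom_predual: "is_predual (Hom C X Y) (Predual C X Y)"

record ('o, 'm) monoidal_wstar_cat = "('o, 'm) wstar_cat" +
  TensO :: "'o \<Rightarrow> 'o \<Rightarrow> 'o" (infixr "\<odot>\<index>" 75)
  TensM :: "'m \<Rightarrow> 'm \<Rightarrow> 'm" (infixr "\<otimes>\<index>" 75)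
  UnitO :: "'o"
  Assoc :: "'o \<Rightarrow> 'o \<Rightarrow> 'o \<Rightarrow> 'm"
  LUnit :: "'o \<Rightarrow> 'm"
  RUnit :: "'o \<Rightarrow> 'm"

locale monoidal_wstar_category = wstar_category C
  for C :: "('o, 'm, 'x) monoidal_wstar_cat_scheme" (structure) +
  assumes tens_in: "f \<in> Mor C X Y \<Longrightarrow> g \<in> Mor C X' Y' \<Longrightarrow> f \<otimes> g \<in> Mor C (X \<odot> X') (Y \<odot> Y')"
    and tens_idt: "Idt C X \<otimes> Idt C Y = Idt C (X \<odot> Y)"
    and tens_comp: "f \<in> Mor C X Y \<Longrightarrow> g \<in> Mor C Y Z \<Longrightarrow> f' \<in> Mor C X' Y' \<Longrightarrow> g' \<in> Mor C Y' Z' \<Longrightarrow>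
          (g \<cdot> f) \<otimes> (g' \<cdot> f') = (g \<otimes> g') \<cdot> (f \<otimes> f')"
    and tens_add_left: "f \<in> Mor C X Y \<Longrightarrow> f' \<in> Mor C X Y \<Longrightarrow> g \<in> Mor C X' Y' \<Longrightarrow>
          vadd (Hom C X Y) f f' \<otimes> g = vadd (Hom C (X \<odot> X') (Y \<odot> Y')) (f \<otimes> g) (f' \<otimes> g)"
    and tens_add_right: "f \<in> Mor C X Y \<Longrightarrow> g \<in> Mor C X' Y' \<Longrightarrow> g' \<in> Mor C X' Y' \<Longrightarrow>
          f \<otimes> vadd (Hom C X' Y') g g' = vadd (Hom C (X \<odot> X') (Y \<odot> Y')) (f \<otimes> g) (f \<otimes> g')"
    and tens_scale_left: "f \<in> Mor C X Y \<Longrightarrow> g \<in> Mor C X' Y' \<Longrightarrow>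
          vscale (Hom C X Y) a f \<otimes> g = vscale (Hom C (X \<odot> X') (Y \<odot> Y')) a (f \<otimes> g)"
    and tens_scale_right: "f \<in> Mor C X Y \<Longrightarrow> g \<in> Mor C X' Y' \<Longrightarrow>
          f \<otimes> vscale (Hom C X' Y') a g = vscale (Hom C (X \<odot> X') (Y \<odot> Y')) a (f \<otimes> g)"
    and tens_star: "f \<in> Mor C X Y \<Longrightarrow> g \<in> Mor C X' Y' \<Longrightarrow> (f \<otimes> g)\<dagger> = f\<dagger> \<otimes> g\<dagger>"
    and tens_normal_left: "g \<in> Mor C X' Y' \<Longrightarrow>
          continuous_map (ultraweak C X Y) (ultraweak C (X \<odot> X') (Y \<odot> Y')) (\<lambda>f. f \<otimes> g)"
    and tens_normal_right: "f \<in> Mor C X Y \<Longrightarrow>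
          continuous_map (ultraweak C X' Y') (ultraweak C (X \<odot> X') (Y \<odot> Y')) (\<lambda>g. f \<otimes> g)"
    and assoc_unitary: "Assoc C X Y Z \<in> unitary_mor C ((X \<odot> Y) \<odot> Z) (X \<odot> (Y \<odot> Z))"
    and assoc_natural: "f \<in> Mor C X X' \<Longrightarrow> g \<in> Mor C Y Y' \<Longrightarrow> h \<in> Mor C Z Z' \<Longrightarrow>
          Assoc C X' Y' Z' \<cdot> ((f \<otimes> g) \<otimes> h) = (f \<otimes> (g \<otimes> h)) \<cdot> Assoc C X Y Z"
    and lunit_unitary: "LUnit C X \<in> unitary_mor C (UnitO C \<odot> X) X"
    and lunit_natural: "f \<in> Mor C X Y \<Longrightarrow> LUnit C Y \<cdot> (Idt C (UnitO C) \<otimes> f) = f \<cdot> LUnit C X"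
    and runit_unitary: "RUnit C X \<in> unitary_mor C (X \<odot> UnitO C) X"
    and runit_natural: "f \<in> Mor C X Y \<Longrightarrow> RUnit C Y \<cdot> (f \<otimes> Idt C (UnitO C)) = f \<cdot> RUnit C X"
    and pentagon: "Assoc C W X (Y \<odot> Z) \<cdot> Assoc C (W \<odot> X) Y Z =
          (Idt C W \<otimes> Assoc C X Y Z) \<cdot> Assoc C W (X \<odot> Y) Z \<cdot> (Assoc C W X Y \<otimes> Idt C Z)"
    and triangle: "(Idt C X \<otimes> LUnit C Y) \<cdot> Assoc C X (UnitO C) Y = RUnit C X \<otimes> Idt C Y"

section \<open>Concrete monoidal W*-categories\<close>

text \<open>The functor to Hilbert spaces sends \<open>X\<close> to \<open>Spc X\<close> and \<open>f\<close> to \<open>Op f\<close>.  Its monoidal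
  structure, a unitary from the tensor product of \<open>Spc X\<close> and \<open>Spc Y\<close> to \<open>Spc (X \<odot> Y)\<close>, is
  encoded by the bilinear map \<open>Tv X Y\<close> sending \<open>(x, y)\<close> to the image of the elementary tensor
  \<open>x \<otimes> y\<close>; the unitary from the complex numbers to \<open>Spc UnitO\<close> is encoded by the image
  \<open>Uv\<close> of \<open>1\<close>.\<close>

record (overloaded) ('o, 'm, 'v::complex_hilbert_space) concrete_wstar_cat = "('o, 'm) monoidal_wstar_cat" +
  Spc :: "'o \<Rightarrow> 'v set"
  Op :: "'m \<Rightarrow> ('v \<Rightarrow>\<^sub>L 'v)"
  Tv :: "'o \<Rightarrow> 'o \<Rightarrow> 'v \<Rightarrow> 'v \<Rightarrow> 'v"
  Uv :: "'v"

locale concrete_monoidal_wstar_category = monoidal_wstar_category C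
  for C :: "('o, 'm, 'v::complex_hilbert_space, 'x) concrete_wstar_cat_scheme" (structure) +
  assumes spc_hilbert: "hilbert_subspace (Spc C X)"
    and op_in: "f \<in> Mor C X Y \<Longrightarrow> Op C f \<in> bop (Spc C X) (Spc C Y)"
    and op_idt: "x \<in> Spc C X \<Longrightarrow> blinfun_apply (Op C (Idt C X)) x = x"
    and op_comp: "f \<in> Mor C X Y \<Longrightarrow> g \<in> Mor C Y Z \<Longrightarrow> Op C (g \<cdot> f) = Op C g o\<^sub>L Op C f"
    and op_add: "f \<in> Mor C X Y \<Longrightarrow> g \<in> Mor C X Y \<Longrightarrow>
          Op C (vadd (Hom C X Y) f g) = Op C f + Op C g"
    and op_scale: "f \<in> Mor C X Y \<Longrightarrow> Op C (vscale (Hom C X Y) a f) = op_scaleC a (Op C f)"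
    and op_star: "f \<in> Mor C X Y \<Longrightarrow> Op C (f\<dagger>) = adj (Op C f)"
    and op_normal: "continuous_map (ultraweak C X Y)
          (weak_topology_on (bop (Spc C X) (Spc C Y)) (normal_functionals (Spc C X) (Spc C Y)))
          (Op C)"
    and tv_tensor: "is_hilbert_tensor (Spc C X) (Spc C Y) (Spc C (X \<odot> Y)) (Tv C X Y)"
    and tv_natural: "f \<in> Mor C X X' \<Longrightarrow> g \<in> Mor C Y Y' \<Longrightarrow> x \<in> Spc C X \<Longrightarrow> y \<in> Spc C Y \<Longrightarrow>
          blinfun_apply (Op C (f \<otimes> g)) (Tv C X Y x y) =
          Tv C X' Y' (blinfun_apply (Op C f) x) (blinfun_apply (Op C g) y)"
    and tv_assoc: "x \<in> Spc C X \<Longrightarrow> y \<in> Spc C Y \<Longrightarrow> z \<in> Spc C Z \<Longrightarrow>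
          blinfun_apply (Op C (Assoc C X Y Z)) (Tv C (X \<odot> Y) Z (Tv C X Y x y) z) =
          Tv C X (Y \<odot> Z) x (Tv C Y Z y z)"
    and uv_unit: "norm (Uv C) = 1" "Spc C (UnitO C) = range (\<lambda>a. a *\<^sub>C Uv C)"
    and tv_lunit: "x \<in> Spc C X \<Longrightarrow>
          blinfun_apply (Op C (LUnit C X)) (Tv C (UnitO C) X (Uv C) x) = x"
    and tv_runit: "x \<in> Spc C X \<Longrightarrow>
          blinfun_apply (Op C (RUnit C X)) (Tv C X (UnitO C) x (Uv C)) = x"

text \<open>\<open>slice_space C X Y X' Y' f\<close> is \<open>[(id \<otimes> \<omega>)(f)]\<close>, where \<open>f\<close> is a morphism from
  \<open>X \<odot> Y\<close> to \<open>X' \<odot> Y'\<close>.\<close>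

definition slice_space ::
    "('o, 'm, 'v::complex_hilbert_space, 'x) concrete_wstar_cat_scheme \<Rightarrow>
     'o \<Rightarrow> 'o \<Rightarrow> 'o \<Rightarrow> 'o \<Rightarrow> 'm \<Rightarrow> ('v \<Rightarrow>\<^sub>L 'v) set" where
  "slice_space C X Y X' Y' f = closed_span
     {slice (Spc C X) (Spc C Y) (Tv C X Y) (Spc C X') (Spc C Y') (Tv C X' Y') \<omega> (Op C f) | \<omega>.
        \<omega> \<in> normal_functionals (Spc C Y) (Spc C Y')}"

section \<open>Braidings and multiplicative unitaries\<close>

definition braiding ::
    "('o, 'm, 'x) monoidal_wstar_cat_scheme \<Rightarrow> ('o \<Rightarrow> 'o \<Rightarrow> 'm) \<Rightarrow> bool" where
  "braiding C c \<longleftrightarrow>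
     (\<forall>X Y. c X Y \<in> iso_mor C (X \<odot>\<^bsub>C\<^esub> Y) (Y \<odot>\<^bsub>C\<^esub> X)) \<and>
     (\<forall>X X' Y Y'. \<forall>f\<in>Mor C X X'. \<forall>g\<in>Mor C Y Y'.
        c X' Y' \<cdot>\<^bsub>C\<^esub> (f \<otimes>\<^bsub>C\<^esub> g) = (g \<otimes>\<^bsub>C\<^esub> f) \<cdot>\<^bsub>C\<^esub> c X Y) \<and>
     (\<forall>U V W. c U (V \<odot>\<^bsub>C\<^esub> W) =
        (Assoc C V W U)\<dagger>\<^bsub>C\<^esub> \<cdot>\<^bsub>C\<^esub> (Idt C V \<otimes>\<^bsub>C\<^esub> c U W) \<cdot>\<^bsub>C\<^esub> Assoc C V U W \<cdot>\<^bsub>C\<^esub>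
        (c U V \<otimes>\<^bsub>C\<^esub> Idt C W) \<cdot>\<^bsub>C\<^esub> (Assoc C U V W)\<dagger>\<^bsub>C\<^esub>) \<and>
     (\<forall>U V W. c (U \<odot>\<^bsub>C\<^esub> V) W =
        Assoc C W U V \<cdot>\<^bsub>C\<^esub> (c U W \<otimes>\<^bsub>C\<^esub> Idt C V) \<cdot>\<^bsub>C\<^esub> (Assoc C U W V)\<dagger>\<^bsub>C\<^esub> \<cdot>\<^bsub>C\<^esub>
        (Idt C U \<otimes>\<^bsub>C\<^esub> c V W) \<cdot>\<^bsub>C\<^esub> Assoc C U V W)"

definition semi_regular_braiding ::
    "('o, 'm, 'v::complex_hilbert_space, 'x) concrete_wstar_cat_scheme \<Rightarrow>
     ('o \<Rightarrow> 'o \<Rightarrow> 'm) \<Rightarrow> bool" where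
  "semi_regular_braiding C c \<longleftrightarrow>
     braiding C c \<and>
     (\<forall>X Y. c X Y \<in> unitary_mor C (X \<odot>\<^bsub>C\<^esub> Y) (Y \<odot>\<^bsub>C\<^esub> X)) \<and>
     (\<forall>H K. compact_ops (Spc C H) (Spc C K) \<subseteq> slice_space C H K K H (c H K))"

text \<open>The legs \<open>F\<^sub>1\<^sub>2\<close> and \<open>F\<^sub>2\<^sub>3\<close> are taken on \<open>(L \<odot> L) \<odot> L\<close>.\<close>

definition leg12 :: "('o, 'm, 'x) monoidal_wstar_cat_scheme \<Rightarrow> 'o \<Rightarrow> 'm \<Rightarrow> 'm" where
  "leg12 C L f = f \<otimes>\<^bsub>C\<^esub> Idt C L"

definition leg23 :: "('o, 'm, 'x) monoidal_wstar_cat_scheme \<Rightarrow> 'o \<Rightarrow> 'm \<Rightarrow> 'm" where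
  "leg23 C L f =
     (Assoc C L L L)\<dagger>\<^bsub>C\<^esub> \<cdot>\<^bsub>C\<^esub> (Idt C L \<otimes>\<^bsub>C\<^esub> f) \<cdot>\<^bsub>C\<^esub> Assoc C L L L"

definition inverse_braid ::
    "('o, 'm, 'x) monoidal_wstar_cat_scheme \<Rightarrow> ('o \<Rightarrow> 'o \<Rightarrow> 'm) \<Rightarrow> 'o \<Rightarrow> 'm" where
  "inverse_braid C c L = inverse_mor C (L \<odot>\<^bsub>C\<^esub> L) (L \<odot>\<^bsub>C\<^esub> L) (c L L)"

definition multiplicative_unitary ::
    "('o, 'm, 'x) monoidal_wstar_cat_scheme \<Rightarrow> ('o \<Rightarrow> 'o \<Rightarrow> 'm) \<Rightarrow> 'o \<Rightarrow> 'm \<Rightarrow> bool" where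
  "multiplicative_unitary C c L F \<longleftrightarrow>
     F \<in> unitary_mor C (L \<odot>\<^bsub>C\<^esub> L) (L \<odot>\<^bsub>C\<^esub> L) \<and>
     leg23 C L F \<cdot>\<^bsub>C\<^esub> leg12 C L F =
       leg12 C L F \<cdot>\<^bsub>C\<^esub> leg12 C L (inverse_braid C c L) \<cdot>\<^bsub>C\<^esub> leg23 C L F \<cdot>\<^bsub>C\<^esub>
       leg12 C L (c L L) \<cdot>\<^bsub>C\<^esub> leg23 C L F"

definition C_space ::
    "('o, 'm, 'v::complex_hilbert_space, 'x) concrete_wstar_cat_scheme \<Rightarrow>
     ('o \<Rightarrow> 'o \<Rightarrow> 'm) \<Rightarrow> 'o \<Rightarrow> 'm \<Rightarrow> ('v \<Rightarrow>\<^sub>L 'v) set" where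
  "C_space C c L F = slice_space C L L L L (inverse_braid C c L \<cdot>\<^bsub>C\<^esub> F)"

definition A_hat ::
    "('o, 'm, 'v::complex_hilbert_space, 'x) concrete_wstar_cat_scheme \<Rightarrow>
     'o \<Rightarrow> 'm \<Rightarrow> ('v \<Rightarrow>\<^sub>L 'v) set" where
  "A_hat C L F = slice_space C L L L L F"

definition semi_regular ::
    "('o, 'm, 'v::complex_hilbert_space, 'x) concrete_wstar_cat_scheme \<Rightarrow>
     ('o \<Rightarrow> 'o \<Rightarrow> 'm) \<Rightarrow> 'o \<Rightarrow> 'm \<Rightarrow> bool" where
  "semi_regular C c L F \<longleftrightarrow> compact_ops (Spc C L) (Spc C L) \<subseteq> C_space C c L F"

end

theory Submission
  imports Defs
begin

text \<open>Write \<open>S(X)\<close> for the norm-closed linear span of the slices of \<open>X\<close>, and \<open>G = c\<^sup>*F\<close>.  By naturality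
  of the braiding the pentagon equation yields three identities of the shape
  \<open>A\<^sub>1\<^sub>2 G'\<^sub>2\<^sub>3 B\<^sub>1\<^sub>2 = U\<^sub>2\<^sub>3 R\<^sub>1\<^sub>2 V\<^sub>2\<^sub>3\<close> with unitary \<open>U\<close> and \<open>V\<close>.  When both sides are sliced over the last
  two legs, \<open>U\<close> and \<open>V\<close> only change the functional, so the slices of \<open>A(1 \<otimes> k)B\<close> with \<open>k \<in> S(G')\<close>
  span \<open>S(R)\<close>.  In particular \<open>S(A)S(B) \<subseteq> S(R)\<close> if \<open>S(G')\<close> contains the rank-one operators.

  From \<open>F\<^sub>1\<^sub>2 c\<^sub>2\<^sub>3 F\<^sub>1\<^sub>2 = F\<^sub>2\<^sub>3 F\<^sub>1\<^sub>2 (F\<^sup>*c)\<^sub>2\<^sub>3\<close> and semi-regularity of \<open>c\<close> it follows that \<open>S(F)\<close> is an algebra.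
  From \<open>F\<^sub>1\<^sub>2 G\<^sub>2\<^sub>3 F\<^sup>*\<^sub>1\<^sub>2 = c\<^sup>*\<^sub>2\<^sub>3 F\<^sup>*\<^sub>1\<^sub>2 F\<^sub>2\<^sub>3\<close> it follows that \<open>S(F)\<^sup>*\<close> is spanned by the slices of the
  \<open>F(1 \<otimes> k)F\<^sup>*\<close> with \<open>k \<in> S(G)\<close>, a selfadjoint family if \<open>S(G) = S(G)\<^sup>*\<close>.
  From \<open>G\<^sub>1\<^sub>2 c\<^sup>*\<^sub>2\<^sub>3 G\<^sub>1\<^sub>2 = G\<^sub>2\<^sub>3 G\<^sub>1\<^sub>2 G\<^sub>2\<^sub>3\<close> it follows that \<open>S(G)\<^sup>*S(G)\<close> and \<open>S(G)S(G)\<^sup>*\<close> lie in \<open>S(G)\<close> if \<open>S(G)\<close> contains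
  the compact operators; as \<open>x\<^sup>*\<close> is a norm limit of linear combinations of the \<open>x\<^sup>*(x x\<^sup>*)\<^sup>n\<close> with
  \<open>n \<ge> 1\<close>, then \<open>S(G)\<close> is selfadjoint.\<close>

section \<open>Complex Hilbert spaces\<close>

instance complex_hilbert_space \<subseteq> banach ..

lemma norm_sq_cinner: "(norm x)\<^sup>2 = Re (cinner x x)" for x :: "'v::complex_hilbert_space"
  by (simp add: power2_norm_eq_inner inner_eq_Re_cinner)

lemma cinner_self: "cinner x x = complex_of_real ((norm x)\<^sup>2)" for x :: "'v::complex_hilbert_space"
proof -
  have "cinner x x = cnj (cinner x x)" by (rule cinner_commute)
  then have "Im (cinner x x) = 0" by (metis cnj.simps(2) equal_neg_zero)
  then show ?thesis by (simp add: complex_eq_iff norm_sq_cinner)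
qed

lemma cinner_add_left: "cinner (x + y) z = cinner x z + cinner y z"
  for x :: "'v::complex_hilbert_space"
  by (metis cinner_commute cinner_add_right complex_cnj_add)

lemma cinner_scaleC_left: "cinner (a *\<^sub>C x) y = cnj a * cinner x y"
  for x :: "'v::complex_hilbert_space"
  by (metis cinner_commute cinner_scaleC_right complex_cnj_mult)

lemma scaleC_one [simp]: "1 *\<^sub>C x = x" for x :: "'v::complex_hilbert_space"
  using scaleR_scaleC[of 1 x] by simp

interpretation cvs: module "scaleC :: complex \<Rightarrow> 'v::complex_hilbert_space \<Rightarrow> 'v"
  by unfold_locales (simp_all add: scaleC_add_right scaleC_add_left scaleC_scaleC)

lemma cinner_zero_right [simp]: "cinner x 0 = 0" for x :: "'v::complex_hilbert_space"
  using cinner_scaleC_right[of x 0 x] by simp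

lemma cinner_zero_left [simp]: "cinner 0 x = 0" for x :: "'v::complex_hilbert_space"
  using cinner_scaleC_left[of 0 x x] by simp

lemma cinner_minus_right: "cinner x (- y) = - cinner x y" for x :: "'v::complex_hilbert_space"
  using cinner_scaleC_right[of x "-1" y] by simp

lemma cinner_minus_left: "cinner (- x) y = - cinner x y" for x :: "'v::complex_hilbert_space"
  using cinner_scaleC_left[of "-1" x y] by simp

lemma cinner_diff_right: "cinner x (y - z) = cinner x y - cinner x z"
  for x :: "'v::complex_hilbert_space"
  using cinner_add_right[of x y "- z"] by (simp add: cinner_minus_right)

lemma cinner_diff_left: "cinner (x - y) z = cinner x z - cinner y z"
  for x :: "'v::complex_hilbert_space"
  using cinner_add_left[of x "- y" z] by (simp add: cinner_minus_left)

lemmas cinner_simps = cinner_add_right cinner_add_left cinner_diff_right cinner_diff_left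
  cinner_scaleC_right cinner_scaleC_left cinner_minus_right cinner_minus_left

lemma norm_scaleC: "norm (a *\<^sub>C x) = cmod a * norm x" for x :: "'v::complex_hilbert_space"
proof -
  have 1: "cnj a * a = complex_of_real ((cmod a)\<^sup>2)"
    by (simp add: complex_norm_square mult.commute del: of_real_power)
  have "cinner (a *\<^sub>C x) (a *\<^sub>C x) = cnj a * a * cinner x x" by (simp add: cinner_simps)
  also have "\<dots> = complex_of_real ((cmod a * norm x)\<^sup>2)"
    unfolding 1 cinner_self by (simp only: of_real_mult[symmetric] power_mult_distrib)
  finally have "(norm (a *\<^sub>C x))\<^sup>2 = (cmod a * norm x)\<^sup>2" by (simp only: norm_sq_cinner Re_complex_of_real)
  then show ?thesis by (simp add: power2_eq_iff_nonneg)
qed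

lemma cinner_ext:
  fixes x y :: "'v::complex_hilbert_space"
  assumes "\<And>z. cinner z x = cinner z y"
  shows "x = y"
proof -
  have "cinner (x - y) (x - y) = 0" using assms by (simp add: cinner_simps)
  then show ?thesis by (simp add: cinner_self)
qed

lemma cinner_ext_left:
  fixes x y :: "'v::complex_hilbert_space"
  assumes "\<And>z. cinner x z = cinner y z"
  shows "x = y"
  by (rule cinner_ext) (metis assms cinner_commute)

text \<open>Multiplying \<open>y\<close> by a phase makes the complex inner product real and
  nonnegative, so the real Cauchy-Schwarz inequality applies.\<close>

lemma cmod_cinner_le: "cmod (cinner x y) \<le> norm x * norm y" for x y :: "'v::complex_hilbert_space"
proof -
  define a where "a = cnj (sgn (cinner x y))"
  have "a * cinner x y = complex_of_real (cmod (cinner x y))"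
  proof (cases "cinner x y = 0")
    case False
    then show ?thesis
      unfolding a_def sgn_eq
      by (simp add: complex_norm_square[symmetric] power2_eq_square mult.commute)
  qed (simp add: a_def)
  then have "cmod (cinner x y) = inner x (a *\<^sub>C y)"
    by (simp add: inner_eq_Re_cinner cinner_simps)
  also have "\<dots> \<le> norm x * norm (a *\<^sub>C y)" by (rule norm_cauchy_schwarz)
  also have "\<dots> \<le> norm x * norm y"
    by (simp add: norm_scaleC a_def norm_sgn)
  finally show ?thesis .
qed

lemma bounded_bilinear_cinner:
  "bounded_bilinear (cinner :: 'v::complex_hilbert_space \<Rightarrow> 'v \<Rightarrow> complex)"
proof
  show "\<exists>K. \<forall>a b::'v. norm (cinner a b) \<le> norm a * norm b * K"
    by (rule exI[of _ 1]) (simp add: cmod_cinner_le)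
qed (simp_all add: cinner_simps scaleR_scaleC scaleR_conv_of_real)

lemmas continuous_on_cinner [continuous_intros] =
  bounded_bilinear.continuous_on[OF bounded_bilinear_cinner]

lemma bounded_bilinear_scaleC:
  "bounded_bilinear (scaleC :: complex \<Rightarrow> 'v::complex_hilbert_space \<Rightarrow> 'v)"
proof
  show "\<exists>K. \<forall>a. \<forall>b::'v. norm (a *\<^sub>C b) \<le> norm a * norm b * K"
    by (rule exI[of _ 1]) (simp add: norm_scaleC)
qed (simp_all add: scaleC_add_right scaleC_add_left scaleR_scaleC scaleC_scaleC
      scaleR_conv_of_real mult.commute)

lemma norm_le_if_cinner_le:
  fixes x :: "'v::complex_hilbert_space"
  assumes "\<And>y. cmod (cinner y x) \<le> B * norm y" and "B \<ge> 0"
  shows "norm x \<le> B"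
proof (cases "x = 0")
  case False
  have "cmod (cinner x x) = norm x * norm x"
    by (simp add: cinner_self power2_eq_square norm_mult)
  with assms(1)[of x] False show ?thesis by simp
qed (use assms in simp)

subsection \<open>Orthogonal projections and the Riesz representation\<close>

lemma hilbert_subspace_module:
  assumes "hilbert_subspace H"
  shows "cvs.subspace H" "closed H"
  using assms by (auto simp: hilbert_subspace_def)

lemma parallelogram:
  fixes x y :: "'v::real_inner"
  shows "(norm (x + y))\<^sup>2 + (norm (x - y))\<^sup>2 = 2 * (norm x)\<^sup>2 + 2 * (norm y)\<^sup>2"
  by (simp add: power2_norm_eq_inner inner_simps inner_commute)

text \<open>A minimising sequence for the distance is Cauchy by the parallelogram law, and its limit
  stays in the closed set \<open>H\<close>.\<close>

lemma closest_point_exists_hilbert: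
  fixes H :: "'v::complex_hilbert_space set"
  assumes "hilbert_subspace H"
  shows "\<exists>p\<in>H. \<forall>h\<in>H. norm (x - p) \<le> norm (x - h)"
proof -
  note sub = hilbert_subspace_module(1)[OF assms]
  define d where "d = infdist x H"
  have ne: "H \<noteq> {}" using cvs.subspace_0[OF sub] by blast
  have d0: "d \<ge> 0" unfolding d_def by (rule infdist_nonneg)
  have d_le: "d \<le> norm (x - h)" if "h \<in> H" for h
    unfolding d_def using infdist_le[OF that, of x] by (simp add: dist_norm)
  have "\<exists>h\<in>H. norm (x - h) < d + inverse (real (Suc n))" for n
  proof -
    have "\<exists>h\<in>H. dist x h < d + inverse (real (Suc n))"
      proof (rule ccontr)
      assume "\<not> ?thesis"
      then have "d + inverse (real (Suc n)) \<le> d"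
        unfolding d_def infdist_notempty[OF ne] using ne
        by (intro cINF_greatest) (auto simp: not_less)
      then show False by (simp add: field_simps)
    qed
    then show ?thesis by (simp add: dist_norm)
  qed
  then obtain s where s: "\<And>n. s n \<in> H" "\<And>n. norm (x - s n) < d + inverse (real (Suc n))"
    by metis
  \<comment> \<open>The midpoint \<open>w\<close> of \<open>s m\<close> and \<open>s n\<close> lies
    in \<open>H\<close>, so its distance to \<open>x\<close> is at least \<open>d\<close>; the
    parallelogram law turns this into a bound on the gap.\<close>
  have key: "(norm (s m - s n))\<^sup>2 \<le> 2 * (norm (x - s m))\<^sup>2 + 2 * (norm (x - s n))\<^sup>2 - 4 * d\<^sup>2" for m n
  proof -
    define w where "w = (1/2::complex) *\<^sub>C (s m + s n)"
    have "w \<in> H" unfolding w_def using s(1) sub by (intro cvs.subspace_scale cvs.subspace_add)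
    then have "d\<^sup>2 \<le> (norm (x - w))\<^sup>2" using d_le d0 by (intro power_mono)
    moreover have "w = (1/2) *\<^sub>R (s m + s n)" unfolding w_def scaleR_scaleC by simp
    then have "(x - s m) + (x - s n) = 2 *\<^sub>R (x - w)"
      by (simp add: algebra_simps scaleR_2)
    then have "(norm ((x - s m) + (x - s n)))\<^sup>2 = 4 * (norm (x - w))\<^sup>2"
      by (simp add: power_mult_distrib)
    moreover have "(x - s m) - (x - s n) = s n - s m" by simp
    ultimately show ?thesis
      using parallelogram[of "x - s m" "x - s n"] by (simp add: norm_minus_commute)
  qed
  have lim: "(\<lambda>n. norm (x - s n)) \<longlonglongrightarrow> d"
  proof (rule tendsto_sandwich)
    show "\<forall>\<^sub>F n in sequentially. d \<le> norm (x - s n)" using d_le s(1) by simp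
    show "\<forall>\<^sub>F n in sequentially. norm (x - s n) \<le> d + inverse (real (Suc n))"
      using s(2) by (simp add: less_imp_le)
    show "(\<lambda>n. d + inverse (real (Suc n))) \<longlonglongrightarrow> d"
      using tendsto_add[OF tendsto_const[of d] LIMSEQ_inverse_real_of_nat] by simp
  qed simp
  have "Cauchy s"
  proof (rule CauchyI)
    fix e :: real assume "e > 0"
    have "(\<lambda>n. 2 * (norm (x - s n))\<^sup>2 - 2 * d\<^sup>2) \<longlonglongrightarrow> 2 * d\<^sup>2 - 2 * d\<^sup>2"
      by (intro tendsto_intros lim)
    then have "\<forall>\<^sub>F n in sequentially. 2 * (norm (x - s n))\<^sup>2 - 2 * d\<^sup>2 < e\<^sup>2 / 2"
      using \<open>e > 0\<close> by (intro order_tendstoD) auto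
    then obtain N where N: "\<And>n. n \<ge> N \<Longrightarrow> 2 * (norm (x - s n))\<^sup>2 - 2 * d\<^sup>2 < e\<^sup>2 / 2"
      by (auto simp: eventually_sequentially)
    have "norm (s m - s n) < e" if "m \<ge> N" "n \<ge> N" for m n
    proof -
      have "(norm (s m - s n))\<^sup>2 < e\<^sup>2" using key[of m n] N[OF that(1)] N[OF that(2)] by linarith
      then show ?thesis using \<open>e > 0\<close> by (simp add: power_less_imp_less_base)
    qed
    then show "\<exists>M. \<forall>m\<ge>M. \<forall>n\<ge>M. norm (s m - s n) < e" by blast
  qed
  then obtain p where p: "s \<longlonglongrightarrow> p" by (auto simp: Cauchy_convergent_iff convergent_def)
  have "p \<in> H"
    using closed_sequentially[OF hilbert_subspace_module(2)[OF assms] _ p] s(1) by blast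
  moreover have "norm (x - p) = d"
    by (rule LIMSEQ_unique[OF tendsto_norm[OF tendsto_diff[OF tendsto_const p]] lim])
  ultimately show ?thesis using d_le by auto
qed

text \<open>Put \<open>a = cinner h (x - p)\<close> for the closest point \<open>p\<close>. Moving
  \<open>p\<close> along \<open>h\<close> with coefficient \<open>a / (norm h)^2\<close> would lower
  the squared distance by \<open>(cmod a)^2 / (norm h)^2\<close>, so minimality forces
  \<open>a = 0\<close>.\<close>

lemma orth_decomposition:
  fixes H :: "'v::complex_hilbert_space set"
  assumes "hilbert_subspace H"
  shows "\<exists>p\<in>H. \<forall>h\<in>H. cinner h (x - p) = 0"
proof -
  note sub = hilbert_subspace_module(1)[OF assms]
  obtain p where p: "p \<in> H" "\<And>h. h \<in> H \<Longrightarrow> norm (x - p) \<le> norm (x - h)"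
    using closest_point_exists_hilbert[OF assms] by blast
  have "cinner h (x - p) = 0" if h: "h \<in> H" for h
  proof (cases "h = 0")
    case False
    define a where "a = cinner h (x - p)"
    define r where "r = inverse ((norm h)\<^sup>2)"
    have "p + (complex_of_real r * a) *\<^sub>C h \<in> H"
      using p(1) h sub by (intro cvs.subspace_add cvs.subspace_scale)
    then have "(norm (x - p))\<^sup>2 \<le> (norm ((x - p) - (complex_of_real r * a) *\<^sub>C h))\<^sup>2"
      using p(2) by (intro power_mono) (simp_all add: diff_diff_eq)
    also have "\<dots> = (norm (x - p))\<^sup>2 - (cmod a)\<^sup>2 * r"
    proof -
      have 1: "cinner (x - p) h = cnj a" unfolding a_def by (rule cinner_commute)
      have 2: "cinner h h = complex_of_real (inverse r)" by (simp add: cinner_self r_def)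
      have "r \<noteq> 0" using False by (simp add: r_def)
      have "cinner ((x - p) - (complex_of_real r * a) *\<^sub>C h) ((x - p) - (complex_of_real r * a) *\<^sub>C h)
         = cinner (x - p) (x - p) - complex_of_real r * (a * cnj a)"
        using \<open>r \<noteq> 0\<close>
        by (simp add: cinner_diff_left[of "x - p"] cinner_diff_right[of _ "x - p"]
            cinner_scaleC_left cinner_scaleC_right 1 2 a_def[symmetric])
      then have "cinner ((x - p) - (complex_of_real r * a) *\<^sub>C h) ((x - p) - (complex_of_real r * a) *\<^sub>C h)
         = complex_of_real ((norm (x - p))\<^sup>2 - (cmod a)\<^sup>2 * r)"
        using complex_norm_square[of a] by (simp add: cinner_self)
      then show ?thesis by (simp add: norm_sq_cinner)
    qed
    finally have "(cmod a)\<^sup>2 * r \<le> 0" by simp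
    then have "a = 0" using False by (simp add: r_def mult_le_0_iff)
    then show ?thesis by (simp add: a_def)
  qed simp
  with p(1) show ?thesis by blast
qed

definition proj :: "'v::complex_hilbert_space set \<Rightarrow> 'v \<Rightarrow> 'v" where
  "proj H x = (SOME p. p \<in> H \<and> (\<forall>h\<in>H. cinner h (x - p) = 0))"

context
  fixes H :: "'v::complex_hilbert_space set"
  assumes H: "hilbert_subspace H"
begin

lemma proj_in: "proj H x \<in> H" and proj_orth: "h \<in> H \<Longrightarrow> cinner h (x - proj H x) = 0"
  using someI_ex[OF orth_decomposition[OF H, of x, unfolded Bex_def]]
  unfolding proj_def by auto

lemma proj_cinner_right: "h \<in> H \<Longrightarrow> cinner h (proj H x) = cinner h x"
  using proj_orth[of h x] by (simp add: cinner_simps)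

lemma proj_cinner_left: "h \<in> H \<Longrightarrow> cinner (proj H x) h = cinner x h"
  by (metis proj_cinner_right cinner_commute)

lemma proj_unique:
  assumes "p \<in> H" "\<And>h. h \<in> H \<Longrightarrow> cinner h p = cinner h x"
  shows "proj H x = p"
proof -
  have "proj H x - p \<in> H"
    using proj_in assms(1) hilbert_subspace_module(1)[OF H] by (simp add: cvs.subspace_diff)
  then have "cinner (proj H x - p) (proj H x - p) = 0"
    using assms(2) proj_cinner_right by (simp add: cinner_diff_right)
  then show ?thesis by (simp add: cinner_self)
qed

lemma proj_of_mem: "x \<in> H \<Longrightarrow> proj H x = x"
  by (rule proj_unique) auto

lemma proj_eq_0: "(\<And>h. h \<in> H \<Longrightarrow> cinner h x = 0) \<Longrightarrow> proj H x = 0"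
  by (rule proj_unique) (simp_all add: cvs.subspace_0[OF hilbert_subspace_module(1)[OF H]])

lemma proj_add: "proj H (x + y) = proj H x + proj H y"
  by (rule proj_unique)
     (simp_all add: cvs.subspace_add[OF hilbert_subspace_module(1)[OF H]] proj_in
       cinner_add_right proj_cinner_right)

lemma proj_scaleC: "proj H (a *\<^sub>C x) = a *\<^sub>C proj H x"
  by (rule proj_unique)
     (simp_all add: cvs.subspace_scale[OF hilbert_subspace_module(1)[OF H]] proj_in
       cinner_scaleC_right proj_cinner_right)

lemma proj_selfadjoint: "cinner (proj H x) y = cinner x (proj H y)"
  by (metis proj_cinner_left proj_cinner_right proj_in)

lemma norm_proj_le: "norm (proj H x) \<le> norm x"
proof (cases "proj H x = 0")
  case False
  have "complex_of_real ((norm (proj H x))\<^sup>2) = cinner (proj H x) x"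
    by (metis proj_cinner_right proj_in cinner_self)
  then have "(norm (proj H x))\<^sup>2 = cmod (cinner (proj H x) x)"
    by (metis abs_of_nonneg norm_of_real zero_le_power2)
  also have "\<dots> \<le> norm (proj H x) * norm x" by (rule cmod_cinner_le)
  finally show ?thesis using False by (simp add: power2_eq_square)
qed simp

text \<open>The double orthogonal complement of \<open>H\<close> lies in \<open>H\<close>: the
  hypothesis is tested on \<open>y = x - proj H x\<close>.\<close>

lemma mem_if_biorth:
  assumes "\<And>y. proj H y = 0 \<Longrightarrow> cinner y x = 0"
  shows "x \<in> H"
proof -
  have "proj H (x - proj H x) = 0" by (rule proj_eq_0) (rule proj_orth)
  then have "cinner (x - proj H x) x = 0" by (rule assms)
  moreover have "cinner (x - proj H x) (proj H x) = 0"
    using proj_orth[OF proj_in, of x x] by (metis cinner_commute complex_cnj_zero)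
  ultimately have "cinner (x - proj H x) (x - proj H x) = 0" by (simp add: cinner_diff_right)
  then have "x = proj H x" by (simp add: cinner_self)
  then show ?thesis using proj_in by metis
qed

end

lemma riesz_representation:
  fixes f :: "'v::complex_hilbert_space \<Rightarrow> complex"
  assumes bl: "bounded_linear f" and sc: "\<And>a x. f (a *\<^sub>C x) = a * f x"
  shows "\<exists>z. \<forall>x. f x = cinner z x"
proof (cases "\<forall>x. f x = 0")
  case True
  then show ?thesis by (intro exI[of _ 0]) simp
next
  case False
  then obtain x where x: "f x \<noteq> 0" by blast
  interpret f: bounded_linear f by fact
  define N where "N = {x. f x = 0}"
  have N: "hilbert_subspace N"
    unfolding hilbert_subspace_def
  proof
    show "cvs.subspace N"
      by (rule cvs.subspaceI) (simp_all add: N_def f.zero f.add sc)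
    show "closed N" unfolding N_def
      by (intro closed_Collect_eq continuous_intros linear_continuous_on bl)
  qed
  define y where "y = x - proj N x"
  have fy: "f y \<noteq> 0" using x proj_in[OF N, of x] by (simp add: y_def f.diff N_def)
  then have y0: "y \<noteq> 0" using f.zero by auto
  have orth: "cinner y h = 0" if "h \<in> N" for h
    using proj_orth[OF N that, of x] unfolding y_def by (metis cinner_commute complex_cnj_zero)
  \<comment> \<open>The coefficient makes \<open>cinner z y\<close> equal to \<open>f y\<close>; it
    is conjugated because \<open>cinner\<close> is conjugate-linear in its first argument.\<close>
  define z where "z = cnj (f y / cinner y y) *\<^sub>C y"
  have "f w = cinner z w" for w
  proof -
    have "w - (f w / f y) *\<^sub>C y \<in> N" using fy by (simp add: N_def f.diff sc)
    from orth[OF this] have "cinner y w = (f w / f y) * cinner y y" by (simp add: cinner_simps)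
    then show ?thesis using fy y0 by (simp add: z_def cinner_simps cinner_self)
  qed
  then show ?thesis by blast
qed

section \<open>Bounded operators and adjoints\<close>

text \<open>The ambient operator type is only real-linear, so complex linearity is carried as a
  predicate.\<close>

definition clin :: "('v::complex_hilbert_space \<Rightarrow>\<^sub>L 'v) \<Rightarrow> bool" where
  "clin T \<longleftrightarrow> (\<forall>a x. blinfun_apply T (a *\<^sub>C x) = a *\<^sub>C blinfun_apply T x)"

lemma clinD: "clin T \<Longrightarrow> blinfun_apply T (a *\<^sub>C x) = a *\<^sub>C blinfun_apply T x"
  by (simp add: clin_def)

lemma op_scaleC_apply [simp]: "blinfun_apply (op_scaleC a T) x = a *\<^sub>C blinfun_apply T x"
proof -
  have "bounded_linear (\<lambda>x. a *\<^sub>C blinfun_apply T x)"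
    by (intro bounded_linear_compose[OF bounded_bilinear.bounded_linear_right[OF bounded_bilinear_scaleC]]
        blinfun.bounded_linear_right)
  then show ?thesis unfolding op_scaleC_def by (simp add: bounded_linear_Blinfun_apply)
qed

interpretation ops: module "op_scaleC :: complex \<Rightarrow> ('v::complex_hilbert_space \<Rightarrow>\<^sub>L 'v) \<Rightarrow> _"
  by unfold_locales
     (auto intro!: blinfun_eqI simp: blinfun.add_left scaleC_add_right scaleC_add_left scaleC_scaleC)

lemma clin_simps [simp]:
  "clin 0" "clin S \<Longrightarrow> clin T \<Longrightarrow> clin (S + T)" "clin T \<Longrightarrow> clin (op_scaleC a T)"
  "clin S \<Longrightarrow> clin T \<Longrightarrow> clin (S - T)" "clin S \<Longrightarrow> clin T \<Longrightarrow> clin (S o\<^sub>L T)"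
  by (simp_all add: clin_def blinfun.add_left blinfun.diff_left scaleC_add_right scaleC_scaleC mult.commute
      cvs.scale_right_diff_distrib)

text \<open>The Riesz representation gives the value at each \<open>y\<close>; linearity follows
  from uniqueness of the representing vector and boundedness from Cauchy-Schwarz.\<close>

lemma adjoint_exists:
  assumes "clin T"
  shows "\<exists>S. \<forall>x y. cinner (blinfun_apply S y) x = cinner y (blinfun_apply T x)"
proof -
  have "\<exists>z. \<forall>x. cinner y (blinfun_apply T x) = cinner z x" for y
  proof (rule riesz_representation)
    show "bounded_linear (\<lambda>x. cinner y (blinfun_apply T x))"
      by (intro bounded_linear_compose[OF bounded_bilinear.bounded_linear_right[OF bounded_bilinear_cinner]]
          blinfun.bounded_linear_right)
    show "cinner y (blinfun_apply T (a *\<^sub>C x)) = a * cinner y (blinfun_apply T x)" for a x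
      using assms by (simp add: clin_def cinner_scaleC_right)
  qed
  then obtain f where f: "\<And>x y. cinner y (blinfun_apply T x) = cinner (f y) x" by metis
  have "bounded_linear f"
  proof (rule bounded_linear_intro[of _ "norm T"])
    show "f (x + y) = f x + f y" for x y
      by (rule cinner_ext_left) (simp add: f[symmetric] cinner_add_left)
    show "f (r *\<^sub>R x) = r *\<^sub>R f x" for r x
      by (rule cinner_ext_left) (simp add: f[symmetric] cinner_scaleC_left scaleR_scaleC)
    show "norm (f y) \<le> norm y * norm T" for y
    proof (rule norm_le_if_cinner_le)
      fix x
      have "cmod (cinner x (f y)) = cmod (cinner (f y) x)" by (metis cinner_commute complex_mod_cnj)
      also have "\<dots> \<le> norm y * norm (blinfun_apply T x)" unfolding f[symmetric] by (rule cmod_cinner_le)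
      also have "\<dots> \<le> norm y * (norm T * norm x)" by (intro mult_left_mono norm_blinfun) simp
      finally show "cmod (cinner x (f y)) \<le> norm y * norm T * norm x" by (simp add: mult.assoc)
    qed simp
  qed
  then show ?thesis
    by (intro exI[of _ "Blinfun f"]) (simp add: bounded_linear_Blinfun_apply f)
qed

lemma cinner_adj_left:
  assumes "clin T"
  shows "cinner (blinfun_apply (adj T) y) x = cinner y (blinfun_apply T x)"
proof -
  obtain S where S: "\<forall>x y. cinner (blinfun_apply S y) x = cinner y (blinfun_apply T x)"
    using adjoint_exists[OF assms] by blast
  have "adj T = S" unfolding adj_def
  proof (rule the_equality[where P = "\<lambda>S. \<forall>x y. cinner (blinfun_apply S y) x = cinner y (blinfun_apply T x)"])
    fix S' assume "\<forall>x y. cinner (blinfun_apply S' y) x = cinner y (blinfun_apply T x)"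
    with S show "S' = S" by (intro blinfun_eqI cinner_ext_left) simp
  qed (rule S)
  with S show ?thesis by blast
qed

lemma cinner_adj_right:
  "clin T \<Longrightarrow> cinner x (blinfun_apply (adj T) y) = cinner (blinfun_apply T x) y"
  by (metis cinner_adj_left cinner_commute)

lemma adj_eqI:
  assumes "clin T" "\<And>x y. cinner y (blinfun_apply S x) = cinner (blinfun_apply T y) x"
  shows "adj T = S"
  by (intro blinfun_eqI cinner_ext) (simp add: assms cinner_adj_right)

lemma clin_adj [simp]:
  assumes "clin T"
  shows "clin (adj T)"
  unfolding clin_def
  by (intro allI cinner_ext) (simp add: cinner_adj_right[OF assms] cinner_scaleC_right)

lemma adj_adj [simp]: "clin T \<Longrightarrow> adj (adj T) = T"
  by (rule adj_eqI) (simp_all add: cinner_adj_left)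

lemma adj_compose: "clin S \<Longrightarrow> clin T \<Longrightarrow> adj (S o\<^sub>L T) = adj T o\<^sub>L adj S"
  by (rule adj_eqI) (simp_all add: cinner_adj_right)

lemma adj_add: "clin S \<Longrightarrow> clin T \<Longrightarrow> adj (S + T) = adj S + adj T"
  by (rule adj_eqI)
     (simp_all add: cinner_adj_right blinfun.add_left cinner_add_left cinner_add_right)

lemma adj_diff: "clin S \<Longrightarrow> clin T \<Longrightarrow> adj (S - T) = adj S - adj T"
  by (rule adj_eqI)
     (simp_all add: cinner_adj_right blinfun.diff_left cinner_diff_left cinner_diff_right)

lemma adj_zero [simp]: "adj 0 = 0"
  by (rule adj_eqI) simp_all

lemma adj_scaleC: "clin T \<Longrightarrow> adj (op_scaleC a T) = op_scaleC (cnj a) (adj T)"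
  by (rule adj_eqI) (simp_all add: cinner_adj_right cinner_simps)

lemma norm_adj_le:
  assumes "clin T"
  shows "norm (adj T) \<le> norm T"
proof (rule norm_blinfun_bound)
  fix y
  show "norm (blinfun_apply (adj T) y) \<le> norm T * norm y"
  proof (rule norm_le_if_cinner_le)
    fix x
    have "cmod (cinner x (blinfun_apply (adj T) y)) \<le> norm (blinfun_apply T x) * norm y"
      by (simp add: cinner_adj_right[OF assms] cmod_cinner_le)
    also have "\<dots> \<le> (norm T * norm x) * norm y" by (intro mult_right_mono norm_blinfun) simp
    finally show "cmod (cinner x (blinfun_apply (adj T) y)) \<le> norm T * norm y * norm x"
      by (simp add: mult_ac)
  qed simp
qed simp

lemma norm_adj: "clin T \<Longrightarrow> norm (adj T) = norm T"
  by (metis norm_adj_le adj_adj clin_adj antisym)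

lemma norm_op_scaleC_le: "norm (op_scaleC a T) \<le> cmod a * norm T"
proof (rule norm_blinfun_bound)
  show "norm (blinfun_apply (op_scaleC a T) x) \<le> cmod a * norm T * norm x" for x
    by (simp add: norm_scaleC mult.assoc mult_left_mono norm_blinfun)
qed simp

lemma op_scaleC_compose_left: "op_scaleC a S o\<^sub>L T = op_scaleC a (S o\<^sub>L T)"
  by (rule blinfun_eqI) simp

lemma op_scaleC_compose_right: "clin S \<Longrightarrow> S o\<^sub>L op_scaleC a T = op_scaleC a (S o\<^sub>L T)"
  by (rule blinfun_eqI) (simp add: clin_def)

lemma adj_compose_self_norm:
  assumes "clin T"
  shows "(norm (blinfun_apply T x))\<^sup>2 = Re (cinner x (blinfun_apply (adj T o\<^sub>L T) x))"
  by (simp add: cinner_adj_right[OF assms] norm_sq_cinner)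

subsection \<open>Closed subspaces of operators\<close>

definition closed_subsp :: "('v::complex_hilbert_space \<Rightarrow>\<^sub>L 'v) set \<Rightarrow> bool" where
  "closed_subsp Q \<longleftrightarrow> ops.subspace Q \<and> closed Q"

lemma closed_subspI:
  assumes "0 \<in> Q" "\<And>S T. S \<in> Q \<Longrightarrow> T \<in> Q \<Longrightarrow> S + T \<in> Q"
    "\<And>a T. T \<in> Q \<Longrightarrow> op_scaleC a T \<in> Q"
    "\<And>s T. (\<And>n::nat. s n \<in> Q) \<Longrightarrow> s \<longlonglongrightarrow> T \<Longrightarrow> T \<in> Q"
  shows "closed_subsp Q"
proof -
  have "ops.subspace Q" by (rule ops.subspaceI) (fact assms)+
  moreover have "closed Q" unfolding closed_sequential_limits
    by (intro allI impI, elim conjE) (erule assms(4)[rotated], simp)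
  ultimately show ?thesis by (simp add: closed_subsp_def)
qed

lemma closed_subspD:
  assumes "closed_subsp Q"
  shows "0 \<in> Q" "S \<in> Q \<Longrightarrow> T \<in> Q \<Longrightarrow> S + T \<in> Q" "T \<in> Q \<Longrightarrow> op_scaleC a T \<in> Q"
    "(\<And>n::nat. s n \<in> Q) \<Longrightarrow> s \<longlonglongrightarrow> T \<Longrightarrow> T \<in> Q"
    "S \<in> Q \<Longrightarrow> T \<in> Q \<Longrightarrow> S - T \<in> Q"
proof -
  have Q: "ops.subspace Q" "closed Q" using assms by (auto simp: closed_subsp_def)
  show "0 \<in> Q" by (rule ops.subspace_0[OF Q(1)])
  show "S \<in> Q \<Longrightarrow> T \<in> Q \<Longrightarrow> S + T \<in> Q" by (rule ops.subspace_add[OF Q(1)])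
  show "T \<in> Q \<Longrightarrow> op_scaleC a T \<in> Q" by (rule ops.subspace_scale[OF Q(1)])
  show "S \<in> Q \<Longrightarrow> T \<in> Q \<Longrightarrow> S - T \<in> Q" by (rule ops.subspace_diff[OF Q(1)])
  show "(\<And>n::nat. s n \<in> Q) \<Longrightarrow> s \<longlonglongrightarrow> T \<Longrightarrow> T \<in> Q"
    using closed_sequentially[OF Q(2), of s T] by blast
qed

lemma closed_span_superset: "S \<subseteq> closed_span S"
  unfolding closed_span_def using closure_subset ops.span_superset by blast

lemma closed_subsp_closed_span: "closed_subsp (closed_span S)"
proof (rule closed_subspI)
  show "0 \<in> closed_span S"
    unfolding closed_span_def using closure_subset ops.span_zero by blast
  show "T + T' \<in> closed_span S" if mem: "T \<in> closed_span S" "T' \<in> closed_span S" for T T'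
  proof -
    obtain s where "\<forall>n. s n \<in> ops.span S" "s \<longlonglongrightarrow> T"
      using mem(1) unfolding closed_span_def closure_sequential by blast
    moreover obtain s' where "\<forall>n. s' n \<in> ops.span S" "s' \<longlonglongrightarrow> T'"
      using mem(2) unfolding closed_span_def closure_sequential by blast
    ultimately show ?thesis unfolding closed_span_def closure_sequential
      by (intro exI[of _ "\<lambda>n. s n + s' n"] conjI allI tendsto_add ops.span_add) simp_all
  qed
  show "op_scaleC a T \<in> closed_span S" if mem: "T \<in> closed_span S" for a T
  proof -
    obtain s where s: "\<And>n. s n \<in> ops.span S" "s \<longlonglongrightarrow> T"
      using mem unfolding closed_span_def closure_sequential by blast
    have "(\<lambda>n. op_scaleC a (s n)) \<longlonglongrightarrow> op_scaleC a T"
    proof (rule LIM_zero_cancel, rule Lim_null_comparison)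
      show "\<forall>\<^sub>F n in sequentially. norm (op_scaleC a (s n) - op_scaleC a T) \<le> cmod a * norm (s n - T)"
        by (rule always_eventually, rule allI)
           (metis norm_op_scaleC_le ops.scale_right_diff_distrib)
      show "(\<lambda>n. cmod a * norm (s n - T)) \<longlonglongrightarrow> 0"
        using tendsto_mult[OF tendsto_const tendsto_norm_zero[OF LIM_zero[OF s(2)]], of "cmod a"] by simp
    qed
    with s(1) show ?thesis unfolding closed_span_def closure_sequential
      by (intro exI[of _ "\<lambda>n. op_scaleC a (s n)"]) (simp add: ops.span_scale)
  qed
  show "T \<in> closed_span S" if "\<And>n::nat. s n \<in> closed_span S" "s \<longlonglongrightarrow> T" for s T
    using closed_sequentially[of "closed_span S" s T] that unfolding closed_span_def by simp
qed

text \<open>This is the induction principle for closed spans: a property passes from the generators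
  to the whole span once it defines a closed subspace. The \<open>closed_subsp\<close> lemmas below
  supply such subspaces.\<close>

lemma closed_span_minimal: "S \<subseteq> Q \<Longrightarrow> closed_subsp Q \<Longrightarrow> closed_span S \<subseteq> Q"
  unfolding closed_span_def closed_subsp_def
  by (intro closure_minimal ops.span_minimal) auto

lemmas blinfun_compose_lin =
  bounded_bilinear.add_left[OF bounded_bilinear_blinfun_compose]
  bounded_bilinear.add_right[OF bounded_bilinear_blinfun_compose]
  bounded_bilinear.diff_left[OF bounded_bilinear_blinfun_compose]
  bounded_bilinear.diff_right[OF bounded_bilinear_blinfun_compose]
  bounded_bilinear.zero_left[OF bounded_bilinear_blinfun_compose]
  bounded_bilinear.zero_right[OF bounded_bilinear_blinfun_compose]

lemma tendsto_compose_left: "s \<longlonglongrightarrow> T \<Longrightarrow> (\<lambda>n. S o\<^sub>L s n) \<longlonglongrightarrow> (S o\<^sub>L T)"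
  by (intro bounded_bilinear.tendsto[OF bounded_bilinear_blinfun_compose] tendsto_const)

lemma tendsto_compose_right: "s \<longlonglongrightarrow> T \<Longrightarrow> (\<lambda>n. s n o\<^sub>L S) \<longlonglongrightarrow> (T o\<^sub>L S)"
  by (intro bounded_bilinear.tendsto[OF bounded_bilinear_blinfun_compose] tendsto_const)

lemma tendsto_apply: "s \<longlonglongrightarrow> T \<Longrightarrow> (\<lambda>n. blinfun_apply (s n) x) \<longlonglongrightarrow> blinfun_apply T x"
  by (intro bounded_bilinear.tendsto[OF bounded_bilinear_blinfun_apply] tendsto_const)

lemma tendsto_scaleC_right: "s \<longlonglongrightarrow> x \<Longrightarrow> (\<lambda>n. a *\<^sub>C s n) \<longlonglongrightarrow> a *\<^sub>C x"
  by (intro bounded_bilinear.tendsto[OF bounded_bilinear_scaleC] tendsto_const)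

lemma clin_lim:
  assumes "\<And>n::nat. clin (s n)" "s \<longlonglongrightarrow> T"
  shows "clin T"
  unfolding clin_def
proof (intro allI)
  fix a x
  have "(\<lambda>n. a *\<^sub>C blinfun_apply (s n) x) \<longlonglongrightarrow> blinfun_apply T (a *\<^sub>C x)"
    using tendsto_apply[OF assms(2), of "a *\<^sub>C x"] by (simp add: clinD[OF assms(1)])
  then show "blinfun_apply T (a *\<^sub>C x) = a *\<^sub>C blinfun_apply T x"
    by (rule LIMSEQ_unique) (intro tendsto_scaleC_right tendsto_apply assms(2))
qed

lemma adj_lim:
  assumes "\<And>n::nat. clin (s n)" "s \<longlonglongrightarrow> T"
  shows "(\<lambda>n. adj (s n)) \<longlonglongrightarrow> adj T"
proof (rule LIM_zero_cancel, rule Lim_null_comparison)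
  have cT: "clin T" by (rule clin_lim[OF assms])
  show "\<forall>\<^sub>F n in sequentially. norm (adj (s n) - adj T) \<le> norm (s n - T)"
    by (simp add: adj_diff[symmetric] assms(1) cT norm_adj)
  show "(\<lambda>n. norm (s n - T)) \<longlonglongrightarrow> 0"
    by (rule tendsto_norm_zero[OF LIM_zero[OF assms(2)]])
qed

lemma closed_subsp_adj:
  assumes "closed_subsp Q"
  shows "closed_subsp {T. clin T \<and> adj T \<in> Q}"
proof (rule closed_subspI)
  fix s :: "nat \<Rightarrow> _" and T
  assume s: "\<And>n. s n \<in> {T. clin T \<and> adj T \<in> Q}" "s \<longlonglongrightarrow> T"
  have "adj T \<in> Q" by (rule closed_subspD(4)[OF assms _ adj_lim]) (use s in auto)
  moreover have "clin T" by (rule clin_lim) (use s in auto)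
  ultimately show "T \<in> {T. clin T \<and> adj T \<in> Q}" by simp
qed (auto simp: closed_subspD[OF assms] adj_add adj_scaleC)

lemma closed_subsp_compose:
  assumes "closed_subsp Q" "clin S"
  shows "closed_subsp {T. S o\<^sub>L (T o\<^sub>L R) \<in> Q}"
proof (rule closed_subspI)
  show "T \<in> {T. S o\<^sub>L (T o\<^sub>L R) \<in> Q}" if "\<And>n::nat. s n \<in> {T. S o\<^sub>L (T o\<^sub>L R) \<in> Q}" "s \<longlonglongrightarrow> T" for s T
    using closed_subspD(4)[OF assms(1) _ tendsto_compose_left[OF tendsto_compose_right[OF that(2)]], of S R]
      that(1) by auto
qed (auto simp: closed_subspD[OF assms(1)] blinfun_compose_lin
    op_scaleC_compose_left op_scaleC_compose_right[OF assms(2)] blinfun_compose_lin)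

lemma closed_subsp_compose_left:
  assumes "closed_subsp Q" "clin S"
  shows "closed_subsp {T. S o\<^sub>L T \<in> Q}"
proof (rule closed_subspI)
  show "T \<in> {T. S o\<^sub>L T \<in> Q}" if "\<And>n::nat. s n \<in> {T. S o\<^sub>L T \<in> Q}" "s \<longlonglongrightarrow> T" for s T
    using closed_subspD(4)[OF assms(1) _ tendsto_compose_left[OF that(2)], of S] that(1) by auto
qed (auto simp: closed_subspD[OF assms(1)] blinfun_compose_lin
    op_scaleC_compose_right[OF assms(2)] blinfun_compose_lin)

lemma closed_subsp_compose_right:
  assumes "closed_subsp Q"
  shows "closed_subsp {T. T o\<^sub>L R \<in> Q}"
proof (rule closed_subspI)
  show "T \<in> {T. T o\<^sub>L R \<in> Q}" if "\<And>n::nat. s n \<in> {T. T o\<^sub>L R \<in> Q}" "s \<longlonglongrightarrow> T" for s T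
    using closed_subspD(4)[OF assms(1) _ tendsto_compose_right[OF that(2)], of R] that(1) by auto
qed (auto simp: closed_subspD[OF assms(1)] blinfun_compose_lin
    op_scaleC_compose_left blinfun_compose_lin)

lemma closed_subsp_Inter:
  assumes "\<And>i. i \<in> I \<Longrightarrow> closed_subsp (Q i)"
  shows "closed_subsp {T. \<forall>i\<in>I. T \<in> Q i}"
  by (rule closed_subspI) (auto intro: closed_subspD[OF assms])

text \<open>Composition is handled one variable at a time: first \<open>T\<close> runs through its
  span for a generator \<open>S\<close>, then \<open>S\<close> through its span for fixed
  \<open>T\<close>.\<close>

lemma closed_span_compose:
  assumes gen: "\<And>S T. S \<in> A \<Longrightarrow> T \<in> B \<Longrightarrow> S o\<^sub>L T \<in> Q"
    and "closed_subsp Q" "S \<in> closed_span A" "T \<in> closed_span B" "\<And>S. S \<in> A \<Longrightarrow> clin S"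
  shows "S o\<^sub>L T \<in> Q"
proof -
  have "closed_span B \<subseteq> {T. \<forall>S\<in>A. T \<in> {T. S o\<^sub>L T \<in> Q}}"
    by (intro closed_span_minimal closed_subsp_Inter closed_subsp_compose_left) (use assms in auto)
  then have "closed_span A \<subseteq> {S. S o\<^sub>L T \<in> Q}"
    by (intro closed_span_minimal closed_subsp_compose_right) (use assms in auto)
  then show ?thesis using assms by blast
qed

section \<open>Operators between closed subspaces\<close>

lemma bop_iff:
  assumes "hilbert_subspace H"
  shows "T \<in> bop H K \<longleftrightarrow> clin T \<and> (\<forall>x. blinfun_apply T x \<in> K) \<and>
    (\<forall>x. blinfun_apply T (proj H x) = blinfun_apply T x)"
proof
  assume T: "T \<in> bop H K"
  have "blinfun_apply T (proj H x) = blinfun_apply T x" for x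
  proof -
    have "\<forall>h\<in>H. cinner h (x - proj H x) = 0" by (simp add: proj_orth[OF assms])
    then have "blinfun_apply T (x - proj H x) = 0" using T by (simp add: bop_def)
    then show ?thesis by (simp add: blinfun.diff_right)
  qed
  with T show "clin T \<and> (\<forall>x. blinfun_apply T x \<in> K) \<and>
    (\<forall>x. blinfun_apply T (proj H x) = blinfun_apply T x)"
    by (simp add: bop_def clin_def)
next
  assume T: "clin T \<and> (\<forall>x. blinfun_apply T x \<in> K) \<and>
    (\<forall>x. blinfun_apply T (proj H x) = blinfun_apply T x)"
  have "blinfun_apply T x = 0" if "\<forall>h\<in>H. cinner h x = 0" for x
    using T that proj_eq_0[OF assms, of x] by (metis blinfun.zero_right)
  with T show "T \<in> bop H K" by (simp add: bop_def clin_def)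
qed

lemma bop_clin: "T \<in> bop H K \<Longrightarrow> clin T"
  by (simp add: bop_def clin_def)

lemma closed_subsp_bop:
  assumes "hilbert_subspace K"
  shows "closed_subsp (bop H K)"
proof (rule closed_subspI)
  note K = hilbert_subspace_module[OF assms]
  show "S + T \<in> bop H K" if "S \<in> bop H K" "T \<in> bop H K" for S T
    using that K(1) by (auto simp: bop_def blinfun.add_left scaleC_add_right intro: cvs.subspace_add)
  show "op_scaleC a T \<in> bop H K" if "T \<in> bop H K" for a T
    using that K(1) by (auto simp: bop_def scaleC_scaleC mult.commute intro: cvs.subspace_scale)
  show "T \<in> bop H K" if s: "\<And>n::nat. s n \<in> bop H K" "s \<longlonglongrightarrow> T" for s T
  proof -
    have "clin T" by (rule clin_lim[OF _ s(2)]) (use s(1) in \<open>auto intro: bop_clin\<close>)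
    moreover have "blinfun_apply T x \<in> K" for x
      by (rule closed_sequentially[OF K(2) _ tendsto_apply[OF s(2)]]) (use s(1) in \<open>auto simp: bop_def\<close>)
    moreover have "blinfun_apply T x = 0" if "\<forall>h\<in>H. cinner h x = 0" for x
    proof -
      have "blinfun_apply (s n) x = 0" for n using s(1)[of n] that by (auto simp: bop_def)
      then show ?thesis using tendsto_apply[OF s(2), of x] by (simp add: LIMSEQ_const_iff)
    qed
    ultimately show ?thesis by (auto simp: bop_def clin_def)
  qed
qed (simp add: bop_def cvs.subspace_0[OF hilbert_subspace_module(1)[OF assms]])

text \<open>A vector orthogonal to \<open>H\<close> is killed by \<open>T\<close>, hence orthogonal
  to the range of \<open>adj T\<close>; so this range lies in the double complement of
  \<open>H\<close>.\<close>

lemma adj_bop: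
  assumes "T \<in> bop H K" "hilbert_subspace H" "hilbert_subspace K"
  shows "adj T \<in> bop K H"
proof -
  note T = assms(1)[unfolded bop_iff[OF assms(2)]]
  have "blinfun_apply (adj T) x \<in> H" for x
  proof (rule mem_if_biorth[OF assms(2)])
    fix y assume "proj H y = 0"
    then have "blinfun_apply T y = 0" using T by (metis blinfun.zero_right)
    then show "cinner y (blinfun_apply (adj T) x) = 0" using T by (simp add: cinner_adj_right)
  qed
  moreover have "blinfun_apply (adj T) x = 0" if "\<forall>h\<in>K. cinner h x = 0" for x
    using T that by (intro cinner_ext) (simp add: cinner_adj_right)
  ultimately show ?thesis using T clin_adj[of T] by (auto simp: bop_def clin_def)
qed

text \<open>The vectors \<open>u\<^sub>k = (1 - x\<^sup>*x)\<^sup>k h\<close> satisfy \<open>\<parallel>x u\<^sub>k\<parallel>\<^sup>2 \<le> \<parallel>u\<^sub>k\<parallel>\<^sup>2 - \<parallel>u\<^bsub>k+1\<^esub>\<parallel>\<^sup>2\<close>, and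
  \<open>\<parallel>x u\<^sub>k\<parallel>\<close> decreases because \<open>x u\<^bsub>k+1\<^esub> = (1 - x x\<^sup>*) x u\<^sub>k\<close>.\<close>

lemma norm_compose_one_minus_power_le:
  assumes "clin x" "norm x \<le> 1"
  shows "norm (x o\<^sub>L (((o\<^sub>L) (id_blinfun - (adj x o\<^sub>L x))) ^^ n) id_blinfun) \<le> 1 / sqrt (real (Suc n))"
proof (rule norm_blinfun_bound)
  fix h
  define y where "y = id_blinfun - (adj x o\<^sub>L x)"
  define u where "u k = blinfun_apply ((((o\<^sub>L) y) ^^ k) id_blinfun) h" for k
  have u_Suc: "u (Suc k) = u k - blinfun_apply (adj x) (blinfun_apply x (u k))" for k
    unfolding u_def by (simp add: y_def blinfun.diff_left)
  have contr: "norm (blinfun_apply x v) \<le> norm v" for v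
    using norm_blinfun[of x v] mult_right_mono[OF assms(2) norm_ge_zero[of v]] by linarith
  have contr': "norm (blinfun_apply (adj x) v) \<le> norm v" for v
    using norm_blinfun[of "adj x" v] mult_right_mono[OF assms(2) norm_ge_zero[of v]]
    by (simp add: norm_adj[OF assms(1)])
  \<comment> \<open>Stated for any \<open>T\<close> because it is used twice: \<open>T = x\<close>
    gives \<open>step\<close>, and \<open>T = adj x\<close> gives \<open>dec\<close>.\<close>
  have sq: "(norm (v - blinfun_apply (adj T) (blinfun_apply T v)))\<^sup>2 =
      (norm v)\<^sup>2 - 2 * (norm (blinfun_apply T v))\<^sup>2 + (norm (blinfun_apply (adj T) (blinfun_apply T v)))\<^sup>2"
    if "clin T" for v T
  proof -
    have "cinner v (blinfun_apply (adj T) (blinfun_apply T v)) = complex_of_real ((norm (blinfun_apply T v))\<^sup>2)"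
      "cinner (blinfun_apply (adj T) (blinfun_apply T v)) v = complex_of_real ((norm (blinfun_apply T v))\<^sup>2)"
      by (simp_all only: cinner_adj_right[OF that] cinner_adj_left[OF that] cinner_self)
    then show ?thesis
      by (simp add: norm_sq_cinner[of "v - _"] cinner_diff_left cinner_diff_right
          norm_sq_cinner[symmetric])
  qed
  have step: "(norm (blinfun_apply x (u k)))\<^sup>2 \<le> (norm (u k))\<^sup>2 - (norm (u (Suc k)))\<^sup>2" for k
    using sq[OF assms(1), of "u k"] power_mono[OF contr'[of "blinfun_apply x (u k)"], of 2]
    by (simp add: u_Suc)
  have dec: "norm (blinfun_apply x (u (Suc k))) \<le> norm (blinfun_apply x (u k))" for k
  proof -
    define w where "w = blinfun_apply x (u k)"
    have "blinfun_apply x (u (Suc k)) = w - blinfun_apply (adj (adj x)) (blinfun_apply (adj x) w)"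
      by (simp add: u_Suc w_def blinfun.diff_right assms(1))
    moreover have "(norm (blinfun_apply (adj (adj x)) (blinfun_apply (adj x) w)))\<^sup>2 \<le> (norm (blinfun_apply (adj x) w))\<^sup>2"
      using contr by (simp add: assms(1) power_mono)
    then have "(norm (w - blinfun_apply (adj (adj x)) (blinfun_apply (adj x) w)))\<^sup>2 \<le> (norm w)\<^sup>2"
      using sq[OF clin_adj[OF assms(1)], of w] zero_le_power2[of "norm (blinfun_apply (adj x) w)"] by linarith
    ultimately show ?thesis unfolding w_def[symmetric] by (metis power2_le_imp_le norm_ge_zero)
  qed
  have dec': "norm (blinfun_apply x (u n)) \<le> norm (blinfun_apply x (u k))" if "k \<le> n" for k
    using that by (rule lift_Suc_antimono_le[of "\<lambda>k. norm (blinfun_apply x (u k))", OF dec])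
  \<comment> \<open>The last of the decreasing norms is at most each earlier one, so
    \<open>Suc n\<close> copies of its square are bounded by a telescoping sum.\<close>
  have "real (Suc n) * (norm (blinfun_apply x (u n)))\<^sup>2 = (\<Sum>k\<le>n. (norm (blinfun_apply x (u n)))\<^sup>2)"
    by simp
  also have "\<dots> \<le> (\<Sum>k\<le>n. (norm (u k))\<^sup>2 - (norm (u (Suc k)))\<^sup>2)"
    by (intro sum_mono order_trans[OF _ step] power_mono dec') auto
  also have "\<dots> = (norm (u 0))\<^sup>2 - (norm (u (Suc n)))\<^sup>2"
    by (rule sum_telescope)
  also have "\<dots> \<le> (norm h)\<^sup>2" by (simp add: u_def)
  finally have "(sqrt (real (Suc n)) * norm (blinfun_apply x (u n)))\<^sup>2 \<le> (norm h)\<^sup>2"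
    by (simp add: power_mult_distrib)
  then have "sqrt (real (Suc n)) * norm (blinfun_apply x (u n)) \<le> norm h"
    by (rule power2_le_imp_le) simp
  then show "norm (blinfun_apply (x o\<^sub>L (((o\<^sub>L) (id_blinfun - (adj x o\<^sub>L x))) ^^ n) id_blinfun) h) \<le> 1 / sqrt (real (Suc n)) * norm h"
    by (simp add: u_def y_def field_simps)
qed simp

text \<open>Rescale \<open>x\<close> to a contraction \<open>z\<close> and put
  \<open>w = adj z o z\<close>. The operator \<open>z - z (1 - w)^n\<close> is a linear combination
  of \<open>z w^k\<close> with \<open>k \<ge> 1\<close>, hence lies in \<open>Q\<close>, and it
  tends to \<open>z\<close> because \<open>z (1 - w)^n\<close> tends to 0.\<close>

lemma mem_of_compose_adj_power_mem:
  assumes "closed_subsp Q" "clin x"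
    and pow: "\<And>n. x o\<^sub>L (((o\<^sub>L) (adj x o\<^sub>L x)) ^^ (Suc n)) id_blinfun \<in> Q"
  shows "x \<in> Q"
proof (cases "x = 0")
  case True
  then show ?thesis by (simp add: closed_subspD[OF assms(1)])
next
  case False
  define r where "r = inverse (norm x)"
  have r: "r > 0" using False by (simp add: r_def)
  define z where "z = op_scaleC (complex_of_real r) x"
  have z: "clin z" unfolding z_def using assms(2) by simp
  have zr: "z = r *\<^sub>R x" by (rule blinfun_eqI) (simp add: z_def blinfun.scaleR_left scaleR_scaleC)
  have nz: "norm z \<le> 1" using False r by (simp add: zr r_def)
  define w where "w = adj z o\<^sub>L z"
  have w: "w = op_scaleC (complex_of_real (r * r)) (adj x o\<^sub>L x)"
    unfolding w_def z_def by (rule blinfun_eqI) (simp add: assms(2) adj_scaleC clinD scaleC_scaleC)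
  have cw: "clin w" unfolding w_def using z by simp
  have wpow: "(((o\<^sub>L) w) ^^ n) T = op_scaleC (complex_of_real ((r * r) ^ n)) ((((o\<^sub>L) (adj x o\<^sub>L x)) ^^ n) T)" for n T
    by (induction n arbitrary: T)
       (simp_all add: w op_scaleC_compose_left op_scaleC_compose_right assms(2) mult.commute)
  have zw: "z o\<^sub>L (((o\<^sub>L) w) ^^ (Suc n)) id_blinfun \<in> Q" for n
    unfolding wpow z_def op_scaleC_compose_left op_scaleC_compose_right[OF assms(2)]
    by (intro closed_subspD(3)[OF assms(1)] pow)
  define p where "p n = (((o\<^sub>L) (id_blinfun - w)) ^^ n) id_blinfun" for n
  have p_Suc: "p (Suc n) = p n - (w o\<^sub>L p n)" for n
    unfolding p_def by (rule blinfun_eqI) (simp add: blinfun.diff_left)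
  \<comment> \<open>The exponent \<open>k\<close> is generalised because
    \<open>p (Suc n) = p n - w o p n\<close> raises it by one in the second term.\<close>
  have gen: "z o\<^sub>L ((((o\<^sub>L) w) ^^ Suc k) (p n)) \<in> Q" for k n
  proof (induction n arbitrary: k)
    case 0
    then show ?case using zw[of k] by (simp add: p_def)
  next
    case (Suc n)
    have lin: "(((o\<^sub>L) w) ^^ m) (S - T) = (((o\<^sub>L) w) ^^ m) S - (((o\<^sub>L) w) ^^ m) T" for m S T
      by (induction m) (simp_all add: blinfun_compose_lin)
    have "z o\<^sub>L ((((o\<^sub>L) w) ^^ Suc k) (p (Suc n))) =
      (z o\<^sub>L ((((o\<^sub>L) w) ^^ Suc k) (p n))) - (z o\<^sub>L ((((o\<^sub>L) w) ^^ Suc (Suc k)) (p n)))"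
      unfolding p_Suc lin by (simp add: funpow_swap1 blinfun_compose_lin)
    then show ?case using closed_subspD(5)[OF assms(1) Suc.IH[of k] Suc.IH[of "Suc k"]] by simp
  qed
  have diff: "z - (z o\<^sub>L p n) \<in> Q" for n
  proof (induction n)
    case 0
    have "z - (z o\<^sub>L p 0) = 0" by (rule blinfun_eqI) (simp add: p_def blinfun.diff_left)
    then show ?case by (simp add: closed_subspD[OF assms(1)])
  next
    case (Suc n)
    have eq: "z - (z o\<^sub>L p (Suc n)) = (z - (z o\<^sub>L p n)) + (z o\<^sub>L (w o\<^sub>L p n))"
      by (simp add: p_Suc blinfun_compose_lin)
    have "z o\<^sub>L (w o\<^sub>L p n) \<in> Q" using gen[of 0 n] by simp
    with Suc.IH show ?case unfolding eq by (rule closed_subspD(2)[OF assms(1)])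
  qed
  have "(\<lambda>n. z o\<^sub>L p n) \<longlonglongrightarrow> 0"
  proof (rule Lim_null_comparison)
    show "\<forall>\<^sub>F n in sequentially. norm (z o\<^sub>L p n) \<le> 1 / sqrt (real (Suc n))"
      unfolding p_def w_def by (intro always_eventually allI norm_compose_one_minus_power_le z nz)
    have "(\<lambda>n. sqrt (inverse (real (Suc n)))) \<longlonglongrightarrow> sqrt 0"
      by (intro tendsto_real_sqrt LIMSEQ_inverse_real_of_nat)
    then show "(\<lambda>n. 1 / sqrt (real (Suc n))) \<longlonglongrightarrow> 0"
      by (simp add: real_sqrt_inverse divide_inverse)
  qed
  from closed_subspD(4)[OF assms(1) diff tendsto_diff[OF tendsto_const this]]
  have "z \<in> Q" by simp
  from closed_subspD(3)[OF assms(1) this, of "complex_of_real (norm x)"]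
  show ?thesis using False by (simp add: z_def r_def)
qed

lemma blinfun_compose_assoc: "(S o\<^sub>L T) o\<^sub>L R = S o\<^sub>L (T o\<^sub>L R)"
  by (rule blinfun_eqI) simp

section \<open>Tensor products and slices\<close>

text \<open>The tensor maps are extended to the ambient space by orthogonal projection, so that no
  identity below needs a membership hypothesis.\<close>

locale tensor_map =
  fixes H K :: "'v::complex_hilbert_space set" and t :: "'v \<Rightarrow> 'v \<Rightarrow> 'v"
  assumes H: "hilbert_subspace H" and K: "hilbert_subspace K"
    and add_left: "t (x + x') y = t x y + t x' y"
    and add_right: "t x (y + y') = t x y + t x y'"
    and scale_left: "t (a *\<^sub>C x) y = a *\<^sub>C t x y"
    and scale_right: "t x (a *\<^sub>C y) = a *\<^sub>C t x y"
    and cinner_t: "cinner (t x y) (t x' y') = cinner (proj H x) x' * cinner (proj K y) y'"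
begin

lemma norm_t: "norm (t x y) = norm (proj H x) * norm (proj K y)"
proof -
  have sq: "cinner (proj M z) z = complex_of_real ((norm (proj M z))\<^sup>2)"
    if "hilbert_subspace M" for M :: "'v set" and z
    using that by (metis cinner_self proj_cinner_right proj_in)
  have "complex_of_real ((norm (t x y))\<^sup>2) = complex_of_real ((norm (proj H x) * norm (proj K y))\<^sup>2)"
    unfolding cinner_self[symmetric] cinner_t
    by (simp add: power_mult_distrib cinner_self sq[OF H] sq[OF K])
  then have "(norm (t x y))\<^sup>2 = (norm (proj H x) * norm (proj K y))\<^sup>2"
    by (simp only: of_real_eq_iff)
  then show ?thesis by (simp add: power2_eq_iff_nonneg)
qed

lemma norm_t_le: "norm (t x y) \<le> norm x * norm y"
  unfolding norm_t by (intro mult_mono norm_proj_le H K) auto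

lemma proj_left [simp]: "t (proj H x) y = t x y"
proof -
  have "norm (t (x - proj H x) y) = 0"
    using proj_eq_0[OF H, of "x - proj H x"] proj_orth[OF H] by (simp add: norm_t)
  then show ?thesis
    using add_left[of "x - proj H x" "proj H x" y] by simp
qed

lemma proj_right [simp]: "t x (proj K y) = t x y"
proof -
  have "norm (t x (y - proj K y)) = 0"
    using proj_eq_0[OF K, of "y - proj K y"] proj_orth[OF K] by (simp add: norm_t)
  then show ?thesis
    using add_right[of x "y - proj K y" "proj K y"] by simp
qed

text \<open>The creation operator that adjoins \<open>\<xi>\<close> as second leg; its adjoint
  contracts the second leg against \<open>\<xi>\<close>.\<close>

definition cr :: "'v \<Rightarrow> ('v \<Rightarrow>\<^sub>L 'v)" where
  "cr \<xi> = Blinfun (\<lambda>x. t x \<xi>)"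

lemma cr_apply [simp]: "blinfun_apply (cr \<xi>) x = t x \<xi>"
proof -
  have "bounded_linear (\<lambda>x. t x \<xi>)"
    by (rule bounded_linear_intro[of _ "norm \<xi>"])
       (simp_all add: add_left scaleR_scaleC scale_left norm_t_le)
  then show ?thesis by (simp add: cr_def bounded_linear_Blinfun_apply)
qed

lemma clin_cr [simp]: "clin (cr \<xi>)"
  by (simp add: clin_def scale_left)

lemma cr_add: "cr (\<xi> + \<eta>) = cr \<xi> + cr \<eta>"
  by (rule blinfun_eqI) (simp add: add_right blinfun.add_left)

lemma cr_scale: "cr (a *\<^sub>C \<xi>) = op_scaleC a (cr \<xi>)"
  by (rule blinfun_eqI) (simp add: scale_right)

lemma norm_cr_le: "norm (cr \<xi>) \<le> norm \<xi>"
  by (rule norm_blinfun_bound) (simp_all add: norm_t_le mult.commute)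

lemma cr_zero: "cr 0 = 0"
  using norm_cr_le[of 0] by simp

lemma cr_tendsto:
  assumes "s \<longlonglongrightarrow> \<xi>"
  shows "(\<lambda>n::nat. cr (s n)) \<longlonglongrightarrow> cr \<xi>"
proof (rule LIM_zero_cancel, rule Lim_null_comparison)
  have "cr (s n) - cr \<xi> = cr (s n - \<xi>)" for n
    using cr_add[of "s n - \<xi>" \<xi>] by simp
  then show "\<forall>\<^sub>F n in sequentially. norm (cr (s n) - cr \<xi>) \<le> norm (s n - \<xi>)"
    using norm_cr_le by simp
  show "(\<lambda>n. norm (s n - \<xi>)) \<longlonglongrightarrow> 0" by (rule tendsto_norm_zero[OF LIM_zero[OF assms]])
qed

lemma adj_cr_t [simp]:
  "blinfun_apply (adj (cr \<eta>)) (t x y) = cinner (proj K \<eta>) y *\<^sub>C proj H x"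
  by (rule cinner_ext)
     (simp add: cinner_adj_right cinner_t cinner_scaleC_right proj_selfadjoint[OF H] mult.commute)

lemma adj_cr_in: "blinfun_apply (adj (cr \<eta>)) x \<in> H"
proof (rule mem_if_biorth[OF H])
  fix y assume "proj H y = 0"
  then have "t y \<eta> = 0" using norm_t[of y \<eta>] by simp
  then show "cinner y (blinfun_apply (adj (cr \<eta>)) x) = 0" by (simp add: cinner_adj_right)
qed

text \<open>With this lemma and its adjoint version, membership of slices in \<open>Q\<close> need
  only be checked for a total set of vectors.\<close>

lemma cr_closed_subspace:
  assumes "closed_subsp Q" "clin R"
  shows "hilbert_subspace {\<xi>. R o\<^sub>L cr \<xi> \<in> Q}"
  unfolding hilbert_subspace_def
proof
  show "cvs.subspace {\<xi>. R o\<^sub>L cr \<xi> \<in> Q}"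
    by (rule cvs.subspaceI)
       (simp_all add: cr_zero cr_add cr_scale blinfun_compose_lin closed_subspD[OF assms(1)]
         op_scaleC_compose_right[OF assms(2)])
  show "closed {\<xi>. R o\<^sub>L cr \<xi> \<in> Q}"
    unfolding closed_sequential_limits
  proof (intro allI impI, elim conjE)
    fix s \<xi> assume s: "\<forall>n. s n \<in> {\<xi>. R o\<^sub>L cr \<xi> \<in> Q}" "s \<longlonglongrightarrow> \<xi>"
    show "\<xi> \<in> {\<xi>. R o\<^sub>L cr \<xi> \<in> Q}"
      using closed_subspD(4)[OF assms(1) _ tendsto_compose_left[OF cr_tendsto[OF s(2)]], of R] s(1)
      by simp
  qed
qed

lemma adj_cr_closed_subspace:
  assumes "closed_subsp Q"
  shows "hilbert_subspace {\<eta>. adj (cr \<eta>) o\<^sub>L R \<in> Q}"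
  unfolding hilbert_subspace_def
proof
  show "cvs.subspace {\<eta>. adj (cr \<eta>) o\<^sub>L R \<in> Q}"
    by (rule cvs.subspaceI)
       (simp_all add: cr_zero cr_add adj_add cr_scale adj_scaleC blinfun_compose_lin
         closed_subspD[OF assms(1)] op_scaleC_compose_left)
  show "closed {\<eta>. adj (cr \<eta>) o\<^sub>L R \<in> Q}"
    unfolding closed_sequential_limits
  proof (intro allI impI, elim conjE)
    fix s \<eta> assume s: "\<forall>n. s n \<in> {\<eta>. adj (cr \<eta>) o\<^sub>L R \<in> Q}" "s \<longlonglongrightarrow> \<eta>"
    show "\<eta> \<in> {\<eta>. adj (cr \<eta>) o\<^sub>L R \<in> Q}"
      using closed_subspD(4)[OF assms(1) _ tendsto_compose_right[OF adj_lim[OF _ cr_tendsto[OF s(2)]]], of R] s(1)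
      by simp
  qed
qed

text \<open>The slice of \<open>X\<close> over its second leg by the vector functional
  \<open>T \<mapsto> cinner \<eta> (T \<xi>)\<close>.\<close>

definition vslice :: "('v \<Rightarrow>\<^sub>L 'v) \<Rightarrow> 'v \<Rightarrow> 'v \<Rightarrow> ('v \<Rightarrow>\<^sub>L 'v)" where
  "vslice X \<eta> \<xi> = adj (cr \<eta>) o\<^sub>L (X o\<^sub>L cr \<xi>)"

lemma cinner_vslice:
  "cinner y (blinfun_apply (vslice X \<eta> \<xi>) x) = cinner (t y \<eta>) (blinfun_apply X (t x \<xi>))"
  by (simp add: vslice_def cinner_adj_right)

lemma clin_vslice: "clin X \<Longrightarrow> clin (vslice X \<eta> \<xi>)"
  by (simp add: vslice_def)

lemma adj_vslice: "clin X \<Longrightarrow> adj (vslice X \<eta> \<xi>) = vslice (adj X) \<xi> \<eta>"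
  by (simp add: vslice_def adj_compose blinfun_compose_assoc)

lemma vslice_bop: "clin X \<Longrightarrow> vslice X \<eta> \<xi> \<in> bop H H"
  unfolding bop_iff[OF H] by (simp add: vslice_def adj_cr_in)

text \<open>Only vector functionals are used here; \<open>closed_span_slice\<close> shows that, for
  complex-linear \<open>X\<close>, all normal functionals yield the same closed span.\<close>

definition slices :: "('v \<Rightarrow>\<^sub>L 'v) \<Rightarrow> ('v \<Rightarrow>\<^sub>L 'v) set" where
  "slices X = closed_span {vslice X \<eta> \<xi> | \<eta> \<xi>. True}"

lemma vslice_in_slices: "vslice X \<eta> \<xi> \<in> slices X"
  unfolding slices_def by (rule subsetD[OF closed_span_superset]) blast

lemma closed_subsp_slices: "closed_subsp (slices X)"
  unfolding slices_def by (rule closed_subsp_closed_span)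

lemma slices_subset:
  "closed_subsp Q \<Longrightarrow> (\<And>\<eta> \<xi>. vslice X \<eta> \<xi> \<in> Q) \<Longrightarrow> slices X \<subseteq> Q"
  unfolding slices_def by (rule closed_span_minimal) auto

lemma slices_bop: "clin X \<Longrightarrow> slices X \<subseteq> bop H H"
  by (intro slices_subset closed_subsp_bop H vslice_bop)

lemma slices_adj:
  assumes "clin X" "T \<in> slices X"
  shows "adj T \<in> slices (adj X)"
proof -
  have "slices X \<subseteq> {T. clin T \<and> adj T \<in> slices (adj X)}"
    by (intro slices_subset closed_subsp_adj closed_subsp_slices)
       (simp add: clin_vslice assms adj_vslice vslice_in_slices)
  with assms(2) show ?thesis by blast
qed

end

text \<open>Log-convexity makes the ratios of successive terms increase. If the first ratio
  \<open>s\<close> exceeded \<open>r\<close>, then \<open>a n \<ge> s^n * a 0\<close> would outgrow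
  \<open>M * r^n\<close>.\<close>

lemma convex_sequence_bound:
  fixes a :: "nat \<Rightarrow> real"
  assumes nn: "\<And>n. a n \<ge> 0" and lc: "\<And>n. (a (Suc n))\<^sup>2 \<le> a n * a (Suc (Suc n))"
    and bd: "\<And>n. a n \<le> M * r ^ n" and r: "r \<ge> 0"
  shows "a 1 \<le> r * a 0"
proof (rule ccontr)
  assume "\<not> a 1 \<le> r * a 0"
  then have gt: "r * a 0 < a 1" by simp
  have a0: "a 0 > 0"
  proof (rule ccontr)
    assume "\<not> a 0 > 0"
    then have "a 0 = 0" using nn[of 0] by simp
    then show False using lc[of 0] gt by simp
  qed
  define s where "s = a 1 / a 0"
  have s: "s > r" "s > 0" using gt a0 r order_le_less_trans[OF mult_nonneg_nonneg[OF r nn[of 0]] gt]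
    by (simp_all add: s_def field_simps)
  have step: "a (Suc n) \<ge> s * a n \<and> a n > 0" for n
  proof (induction n)
    case 0
    then show ?case using a0 by (simp add: s_def)
  next
    case (Suc n)
    then have pos: "a (Suc n) > 0" using s(2) by (metis mult_pos_pos order_less_le_trans)
    have "s * a n * a (Suc n) \<le> (a (Suc n))\<^sup>2"
      using Suc pos by (simp add: power2_eq_square)
    also have "\<dots> \<le> a n * a (Suc (Suc n))" by (rule lc)
    finally have "s * a (Suc n) \<le> a (Suc (Suc n))" using Suc by (simp add: mult_ac)
    with pos show ?case by simp
  qed
  have ge: "s ^ n * a 0 \<le> a n" for n
  proof (induction n)
    case (Suc n)
    have "s ^ Suc n * a 0 = s * (s ^ n * a 0)" by simp
    also have "\<dots> \<le> s * a n" using Suc s(2) by simp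
    also have "\<dots> \<le> a (Suc n)" using step[of n] by simp
    finally show ?case .
  qed simp
  show False
  proof (cases "r = 0")
    case True
    then show False using bd[of 1] step[of 1] by simp
  next
    case False
    then have "r > 0" using r by simp
    obtain n where n: "M / a 0 < (s / r) ^ n"
      using real_arch_pow[of "s / r" "M / a 0"] s \<open>r > 0\<close> by auto
    have "s ^ n * a 0 \<le> M * r ^ n" using ge[of n] bd[of n] by linarith
    with n a0 \<open>r > 0\<close> show False by (simp add: power_divide field_simps)
  qed
qed

text \<open>Both bracketings of the triple tensor product of \<open>H\<close>: \<open>T2\<close> is
  the product of two copies, \<open>t3\<close> adds a leg on the right and \<open>u\<close> one on
  the left. By \<open>assoc\<close> the two agree on elementary tensors.\<close>

locale tensor_triple =
  t: tensor_map H H t + t3: tensor_map T2 H t3 + u: tensor_map H T2 u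
  for H T2 :: "'v::complex_hilbert_space set" and t t3 u +
  assumes assoc: "u x (t y z) = t3 (t x y) z"
    and dense: "T2 = closure (cvs.span {t x y | x y. True})"
begin

lemma t_in: "t x y \<in> T2"
  unfolding dense by (rule subsetD[OF closure_subset]) (auto intro: cvs.span_base)

lemma T2_subset:
  assumes "hilbert_subspace S" "\<And>x y. t x y \<in> S"
  shows "T2 \<subseteq> S"
  unfolding dense using hilbert_subspace_module[OF assms(1)] assms(2)
  by (intro closure_minimal cvs.span_minimal) auto

lemma T2_ext:
  assumes "v \<in> T2" "w \<in> T2" "\<And>x y. cinner (t x y) v = cinner (t x y) w"
  shows "v = w"
proof -
  have "hilbert_subspace {q. cinner q v = cinner q w}"
    unfolding hilbert_subspace_def
    by (intro conjI cvs.subspaceI closed_Collect_eq continuous_intros)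
       (auto simp: cinner_simps)
  then have "T2 \<subseteq> {q. cinner q v = cinner q w}" by (rule T2_subset) (simp add: assms)
  then have "cinner (v - w) v = cinner (v - w) w"
    using assms cvs.subspace_diff[OF hilbert_subspace_module(1)[OF t3.H]] by blast
  then have "cinner (v - w) (v - w) = 0" by (simp add: cinner_diff_right)
  then show ?thesis by (simp add: cinner_self)
qed

lemma proj_t [simp]: "proj T2 (t x y) = t x y"
  by (rule proj_of_mem[OF t3.H t_in])

subsection \<open>Operators on two of three legs\<close>

text \<open>\<open>Y\<close> is \<open>X\<close> tensor the identity. It need not vanish off the
  triple product, so the action of its adjoint is recorded separately; that clause is what yields
  \<open>leg12_adj_cr\<close>.\<close>

definition is_leg12 :: "('v \<Rightarrow>\<^sub>L 'v) \<Rightarrow> ('v \<Rightarrow>\<^sub>L 'v) \<Rightarrow> bool" where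
  "is_leg12 X Y \<longleftrightarrow> X \<in> bop T2 T2 \<and> clin Y \<and>
     (\<forall>q z. blinfun_apply Y (t3 q z) = t3 (blinfun_apply X q) z) \<and>
     (\<forall>q z. blinfun_apply (adj Y) (t3 q z) = t3 (blinfun_apply (adj X) q) z)"

definition is_leg23 :: "('v \<Rightarrow>\<^sub>L 'v) \<Rightarrow> ('v \<Rightarrow>\<^sub>L 'v) \<Rightarrow> bool" where
  "is_leg23 X Y \<longleftrightarrow> X \<in> bop T2 T2 \<and> clin Y \<and>
     (\<forall>x \<zeta>. blinfun_apply Y (u x \<zeta>) = u x (blinfun_apply X \<zeta>)) \<and>
     (\<forall>x \<zeta>. blinfun_apply (adj Y) (u x \<zeta>) = u x (blinfun_apply (adj X) \<zeta>))"

lemma is_leg12_adj: "is_leg12 X Y \<Longrightarrow> is_leg12 (adj X) (adj Y)"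
  by (auto simp: is_leg12_def intro: adj_bop t3.H dest: bop_clin)

lemma is_leg23_adj: "is_leg23 X Y \<Longrightarrow> is_leg23 (adj X) (adj Y)"
  by (auto simp: is_leg23_def intro: adj_bop t3.H dest: bop_clin)

lemma leg12_cr: "is_leg12 X Y \<Longrightarrow> Y o\<^sub>L t3.cr \<xi> = t3.cr \<xi> o\<^sub>L X"
  by (rule blinfun_eqI) (simp add: is_leg12_def)

lemma leg12_adj_cr:
  assumes "is_leg12 X Y"
  shows "adj (t3.cr \<eta>) o\<^sub>L Y = X o\<^sub>L adj (t3.cr \<eta>)"
proof -
  have c: "clin X" "clin Y" using assms by (auto simp: is_leg12_def dest: bop_clin)
  have "adj (adj Y o\<^sub>L t3.cr \<eta>) = adj (t3.cr \<eta> o\<^sub>L adj X)"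
    using leg12_cr[OF is_leg12_adj[OF assms]] by simp
  then show ?thesis using c by (simp add: adj_compose)
qed

lemma leg23_cr: "is_leg23 X Y \<Longrightarrow> Y o\<^sub>L u.cr \<zeta> = u.cr (blinfun_apply X \<zeta>)"
  by (rule blinfun_eqI) (simp add: is_leg23_def)

lemma leg23_adj_cr:
  assumes "is_leg23 X Y"
  shows "adj (u.cr \<zeta>) o\<^sub>L Y = adj (u.cr (blinfun_apply (adj X) \<zeta>))"
proof -
  have c: "clin X" "clin Y" using assms by (auto simp: is_leg23_def dest: bop_clin)
  have "adj (adj Y o\<^sub>L u.cr \<zeta>) = adj (u.cr (blinfun_apply (adj X) \<zeta>))"
    using leg23_cr[OF is_leg23_adj[OF assms]] by simp
  then show ?thesis using c by (simp add: adj_compose)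
qed

text \<open>By \<open>assoc\<close>, two legs created at once are created one after the other, so
  the third leg can be sliced before the second.\<close>

lemma u_cr_t: "u.cr (t \<xi> \<xi>') = t3.cr \<xi>' o\<^sub>L t.cr \<xi>"
  by (rule blinfun_eqI) (simp add: assoc)

text \<open>With one vector fixed, the admissible values of the other form a closed subspace;
  elementary tensors are total in \<open>T2\<close>, so the two vectors are extended in
  turn.\<close>

lemma mem_if_elementary_mem:
  assumes Q: "closed_subsp Q" and Y: "clin Y"
    and el: "\<And>\<eta> \<eta>' \<xi> \<xi>'. adj (u.cr (t \<eta> \<eta>')) o\<^sub>L (Y o\<^sub>L u.cr (t \<xi> \<xi>')) \<in> Q"
    and \<zeta>: "\<zeta> \<in> T2" "\<zeta>' \<in> T2"
  shows "adj (u.cr \<zeta>) o\<^sub>L (Y o\<^sub>L u.cr \<zeta>') \<in> Q"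
proof -
  have 1: "adj (u.cr \<zeta>) o\<^sub>L (Y o\<^sub>L u.cr (t \<xi> \<xi>')) \<in> Q" for \<xi> \<xi>'
    using T2_subset[OF u.adj_cr_closed_subspace[OF Q, of "Y o\<^sub>L u.cr (t \<xi> \<xi>')"]] el \<zeta>(1) by blast
  have "T2 \<subseteq> {\<zeta>'. (adj (u.cr \<zeta>) o\<^sub>L Y) o\<^sub>L u.cr \<zeta>' \<in> Q}"
    by (rule T2_subset[OF u.cr_closed_subspace[OF Q]])
       (use 1 Y in \<open>simp_all add: blinfun_compose_assoc\<close>)
  then show ?thesis using \<zeta>(2) by (auto simp: blinfun_compose_assoc)
qed

subsection \<open>Amplifications\<close>

text \<open>\<open>k'\<close> is the identity tensor \<open>k\<close>. This is a relation because
  amplifications are only obtained from vector slices and rank-one operators by algebraic operations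
  and norm limits. The requirement \<open>k' \<in> bop T2 T2\<close> makes \<open>k'\<close>
  unique.\<close>

definition amp :: "('v \<Rightarrow>\<^sub>L 'v) \<Rightarrow> ('v \<Rightarrow>\<^sub>L 'v) \<Rightarrow> bool" where
  "amp k k' \<longleftrightarrow> k \<in> bop H H \<and> k' \<in> bop T2 T2 \<and>
     (\<forall>x y. blinfun_apply k' (t x y) = t x (blinfun_apply k y)) \<and>
     (\<forall>x y. blinfun_apply (adj k') (t x y) = t x (blinfun_apply (adj k) y))"

lemma amp_clin: "amp k k' \<Longrightarrow> clin k" "amp k k' \<Longrightarrow> clin k'"
  by (auto simp: amp_def dest: bop_clin)

lemma amp_adj: "amp k k' \<Longrightarrow> amp (adj k) (adj k')"
  using amp_clin[of k k'] by (auto simp: amp_def adj_bop[OF _ t.H t.H] adj_bop[OF _ t3.H t3.H])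

lemma t_zero_right: "t x 0 = 0"
  using t.scale_right[of x 0 0] by simp

lemma amp_zero: "amp 0 0"
  using closed_subspD(1)[OF closed_subsp_bop[OF t.H]] closed_subspD(1)[OF closed_subsp_bop[OF t3.H]]
  by (auto simp: amp_def t_zero_right)

lemma amp_add: "amp k k' \<Longrightarrow> amp l l' \<Longrightarrow> amp (k + l) (k' + l')"
  using closed_subspD(2)[OF closed_subsp_bop[OF t.H]] closed_subspD(2)[OF closed_subsp_bop[OF t3.H]]
  by (auto simp: amp_def adj_add bop_clin blinfun.add_left t.add_right)

lemma amp_scale: "amp k k' \<Longrightarrow> amp (op_scaleC a k) (op_scaleC a k')"
  using closed_subspD(3)[OF closed_subsp_bop[OF t.H]] closed_subspD(3)[OF closed_subsp_bop[OF t3.H]]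
  by (auto simp: amp_def adj_scaleC bop_clin t.scale_right)

lemma amp_diff: "amp k k' \<Longrightarrow> amp l l' \<Longrightarrow> amp (k - l) (k' - l')"
  using amp_add[OF _ amp_scale[of l l' "-1"], of k k']
  by simp

lemma bop_compose: "S \<in> bop M N \<Longrightarrow> R \<in> bop N' M \<Longrightarrow> S o\<^sub>L R \<in> bop N' N"
  by (auto simp: bop_def)

lemma amp_compose: "amp k k' \<Longrightarrow> amp l l' \<Longrightarrow> amp (k o\<^sub>L l) (k' o\<^sub>L l')"
  by (auto simp: amp_def adj_compose bop_clin intro: bop_compose)

text \<open>The adjoint of the difference kills elementary tensors, so the range of the difference
  is orthogonal to \<open>T2\<close> while being contained in it.\<close>

lemma amp_unique:
  assumes "amp k k'" "amp k k''"
  shows "k' = k''"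
proof (rule blinfun_eqI)
  fix q
  have b: "k' - k'' \<in> bop T2 T2"
    using closed_subspD(5)[OF closed_subsp_bop[OF t3.H]] assms by (auto simp: amp_def)
  have z: "blinfun_apply (adj (k' - k'')) (t x y) = 0" for x y
    using assms by (auto simp: amp_def bop_clin adj_diff blinfun.diff_left)
  have "blinfun_apply (k' - k'') q = 0"
  proof (rule T2_ext)
    show "cinner (t x y) (blinfun_apply (k' - k'') q) = cinner (t x y) 0" for x y
      unfolding cinner_adj_left[OF bop_clin[OF b], symmetric] z by simp
    show "blinfun_apply (k' - k'') q \<in> T2" using b by (simp add: bop_def)
    show "0 \<in> T2" by (rule cvs.subspace_0[OF hilbert_subspace_module(1)[OF t3.H]])
  qed
  then show "blinfun_apply k' q = blinfun_apply k'' q" by (simp add: blinfun.diff_left)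
qed

text \<open>The constant comes from writing \<open>q\<close> as a finite sum of elementary tensors
  and does not depend on \<open>k\<close>, so one constant serves all powers of an operator.\<close>

lemma amp_pointwise_bound:
  assumes "q \<in> cvs.span {t x y | x y. True}"
  shows "\<exists>M. \<forall>k k'. amp k k' \<longrightarrow> norm (blinfun_apply k' q) \<le> M * norm k"
  using assms
proof (induction rule: cvs.span_induct_alt)
  case base
  show ?case by (intro exI[of _ 0]) simp
next
  case (step c q0 q)
  obtain x y where q0: "q0 = t x y" using step(1) by blast
  obtain M where M: "\<And>k k'. amp k k' \<Longrightarrow> norm (blinfun_apply k' q) \<le> M * norm k"
    using step(2) by blast
  have "norm (blinfun_apply k' (c *\<^sub>C q0 + q)) \<le> (cmod c * norm x * norm y + M) * norm k"
    if a: "amp k k'" for k k'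
  proof -
    have "norm (blinfun_apply k' (c *\<^sub>C q0)) = cmod c * norm (t x (blinfun_apply k y))"
      using a by (simp add: q0 amp_clin clinD norm_scaleC) (simp add: amp_def)
    also have "\<dots> \<le> cmod c * (norm x * (norm k * norm y))"
      by (intro mult_left_mono order_trans[OF t.norm_t_le] norm_blinfun) auto
    finally have "norm (blinfun_apply k' (c *\<^sub>C q0)) \<le> cmod c * norm x * norm y * norm k"
      by (simp add: mult_ac)
    with M[OF a] show ?thesis
      using norm_triangle_ineq[of "blinfun_apply k' (c *\<^sub>C q0)" "blinfun_apply k' q"]
      by (simp add: blinfun.add_right distrib_right)
  qed
  then show ?case by blast
qed

text \<open>For \<open>h = k\<^sup>*k\<close> the sequence \<open>n \<mapsto> \<parallel>(1 \<otimes> h)\<^sup>n q\<parallel>\<close> is logarithmically convex by the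
  Cauchy-Schwarz inequality and, for \<open>q\<close> a finite sum of elementary tensors, of order
  \<open>\<parallel>h\<parallel>\<^sup>n\<close>; hence its first step is already contracted by the factor \<open>\<parallel>h\<parallel>\<close>.\<close>

lemma norm_amp_le:
  assumes a: "amp k k'"
  shows "norm k' \<le> norm k"
proof -
  define h where "h = adj k o\<^sub>L k"
  define h' where "h' = adj k' o\<^sub>L k'"
  have ah: "amp h h'" unfolding h_def h'_def by (rule amp_compose[OF amp_adj[OF a] a])
  note cl = amp_clin[OF a]
  have nh: "norm h \<le> (norm k)\<^sup>2"
    using norm_blinfun_compose[of "adj k" k] by (simp add: h_def norm_adj cl power2_eq_square)
  have apow: "amp ((((o\<^sub>L) h) ^^ n) h) ((((o\<^sub>L) h') ^^ n) h')" for n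
    by (induction n) (auto intro: ah amp_compose)
  have npow: "norm ((((o\<^sub>L) h) ^^ n) h) \<le> norm h ^ Suc n" for n
  proof (induction n)
    case (Suc n)
    have "norm ((((o\<^sub>L) h) ^^ Suc n) h) \<le> norm h * norm ((((o\<^sub>L) h) ^^ n) h)"
      by (simp add: norm_blinfun_compose)
    also have "\<dots> \<le> norm h * norm h ^ Suc n" using Suc by (intro mult_left_mono) auto
    finally show ?case by simp
  qed simp
  have selfadj: "cinner (blinfun_apply h' x) y = cinner x (blinfun_apply h' y)" for x y
    unfolding h'_def by (simp add: cinner_adj_left cinner_adj_right cl)
  have span: "norm (blinfun_apply k' q) \<le> norm k * norm q"
    if q: "q \<in> cvs.span {t x y | x y. True}" for q
  proof -
    obtain M0 where M0: "\<And>k k'. amp k k' \<Longrightarrow> norm (blinfun_apply k' q) \<le> M0 * norm k"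
      using amp_pointwise_bound[OF q] by blast
    \<comment> \<open>Powers of \<open>h\<close> are amplified only from exponent 1 on; including
      \<open>norm q\<close> in the maximum covers exponent 0.\<close>
    define M where "M = max M0 (norm q)"
    have M: "norm (blinfun_apply k' q) \<le> M * norm k" if "amp k k'" for k k'
      using M0[OF that] mult_right_mono[of M0 M "norm k"] by (simp add: M_def)
    have M_nn: "M \<ge> 0" by (simp add: M_def le_max_iff_disj)
    define a where "a n = norm ((blinfun_apply h' ^^ n) q)" for n
    have "a 1 \<le> norm h * a 0"
    proof (rule convex_sequence_bound[of a M])
      show "a n \<ge> 0" for n by (simp add: a_def)
      show "(a (Suc n))\<^sup>2 \<le> a n * a (Suc (Suc n))" for n
      proof -
        define v where "v = (blinfun_apply h' ^^ n) q"
        have "cinner (blinfun_apply h' v) (blinfun_apply h' v) = cinner v (blinfun_apply h' (blinfun_apply h' v))"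
          by (rule selfadj)
        then have "(norm (blinfun_apply h' v))\<^sup>2 = cmod (cinner v (blinfun_apply h' (blinfun_apply h' v)))"
          by (metis cinner_self norm_of_real abs_of_nonneg zero_le_power2)
        then show ?thesis using cmod_cinner_le[of v] by (simp add: a_def v_def)
      qed
      show "a n \<le> M * norm h ^ n" for n
      proof (cases n)
        case 0
        then show ?thesis by (simp add: a_def M_def)
      next
        case (Suc m)
        have "blinfun_apply ((((o\<^sub>L) h') ^^ m) h') q = (blinfun_apply h' ^^ Suc m) q"
          by (induction m) simp_all
        then have "a n \<le> M * norm ((((o\<^sub>L) h) ^^ m) h)"
          using M[OF apow[of m]] by (simp add: a_def Suc)
        also have "\<dots> \<le> M * norm h ^ n" unfolding Suc using M_nn npow by (rule mult_left_mono[rotated])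
        finally show ?thesis .
      qed
    qed simp
    then have 1: "norm (blinfun_apply h' q) \<le> norm h * norm q" by (simp add: a_def)
    have "(norm (blinfun_apply k' q))\<^sup>2 = Re (cinner q (blinfun_apply h' q))"
      unfolding h'_def by (rule adj_compose_self_norm[OF cl(2)])
    also have "\<dots> \<le> norm q * norm (blinfun_apply h' q)"
      by (rule order_trans[OF complex_Re_le_cmod cmod_cinner_le])
    also have "\<dots> \<le> norm q * (norm h * norm q)" using 1 by (intro mult_left_mono) auto
    also have "\<dots> \<le> norm q * ((norm k)\<^sup>2 * norm q)" using nh by (intro mult_left_mono mult_right_mono) auto
    also have "\<dots> = (norm k * norm q)\<^sup>2" by (simp add: power2_eq_square mult_ac)
    finally show ?thesis by (rule power2_le_imp_le) simp
  qed
  have "closed {q. norm (blinfun_apply k' q) \<le> norm k * norm q}"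
    by (intro closed_Collect_le continuous_intros)
  then have T2: "T2 \<subseteq> {q. norm (blinfun_apply k' q) \<le> norm k * norm q}"
    unfolding dense using span by (intro closure_minimal) auto
  show ?thesis
  proof (rule norm_blinfun_bound)
    fix q
    have "norm (blinfun_apply k' (proj T2 q)) \<le> norm k * norm (proj T2 q)"
      using T2 proj_in[OF t3.H] by blast
    also have "\<dots> \<le> norm k * norm q" by (intro mult_left_mono norm_proj_le t3.H) simp
    finally show "norm (blinfun_apply k' q) \<le> norm k * norm q"
      using a by (simp add: amp_def bop_iff[OF t3.H])
  qed simp
qed

text \<open>By \<open>norm_amp_le\<close> the amplifications of a convergent sequence are Cauchy,
  and the defining identities pass to the limit.\<close>

lemma amp_lim:
  assumes a: "\<And>n::nat. amp (k n) (k' n)" and k: "k \<longlonglongrightarrow> l"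
  shows "\<exists>l'. amp l l' \<and> k' \<longlonglongrightarrow> l'"
proof -
  have "Cauchy k" using k by (intro LIMSEQ_imp_Cauchy)
  have "Cauchy k'"
  proof (rule CauchyI)
    fix e :: real assume "e > 0"
    with \<open>Cauchy k\<close> obtain N where N: "\<And>m n. m \<ge> N \<Longrightarrow> n \<ge> N \<Longrightarrow> norm (k m - k n) < e"
      using CauchyD by blast
    have "norm (k' m - k' n) < e" if "m \<ge> N" "n \<ge> N" for m n
      using norm_amp_le[OF amp_diff[OF a a]] N[OF that] by (rule order_le_less_trans)
    then show "\<exists>M. \<forall>m\<ge>M. \<forall>n\<ge>M. norm (k' m - k' n) < e" by blast
  qed
  then obtain l' where l': "k' \<longlonglongrightarrow> l'" by (auto simp: Cauchy_convergent_iff convergent_def)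
  have tlim: "(\<lambda>n. t x (s n)) \<longlonglongrightarrow> t x w" if "s \<longlonglongrightarrow> w" for s :: "nat \<Rightarrow> 'v" and w x
    using tendsto_apply[OF t.cr_tendsto[OF that], of x] by simp
  have "amp l l'"
    unfolding amp_def
  proof (intro conjI allI)
    show "l \<in> bop H H"
      by (rule closed_subspD(4)[OF closed_subsp_bop[OF t.H] _ k]) (use a in \<open>auto simp: amp_def\<close>)
    show "l' \<in> bop T2 T2"
      by (rule closed_subspD(4)[OF closed_subsp_bop[OF t3.H] _ l']) (use a in \<open>auto simp: amp_def\<close>)
    fix x y
    have "(\<lambda>n. t x (blinfun_apply (k n) y)) \<longlonglongrightarrow> blinfun_apply l' (t x y)"
      using tendsto_apply[OF l', of "t x y"] a by (simp add: amp_def)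
    then show "blinfun_apply l' (t x y) = t x (blinfun_apply l y)"
      by (rule LIMSEQ_unique[OF _ tlim[OF tendsto_apply[OF k]]])
    have "(\<lambda>n. t x (blinfun_apply (adj (k n)) y)) \<longlonglongrightarrow> blinfun_apply (adj l') (t x y)"
      using tendsto_apply[OF adj_lim[OF amp_clin(2)[OF a] l'], of "t x y"] a by (simp add: amp_def)
    then show "blinfun_apply (adj l') (t x y) = t x (blinfun_apply (adj l) y)"
      by (rule LIMSEQ_unique[OF _ tlim[OF tendsto_apply[OF adj_lim[OF amp_clin(1)[OF a] k]]]])
  qed
  with l' show ?thesis by blast
qed

text \<open>Together with \<open>amp_vslice\<close> this gives every element of
  \<open>t.slices G\<close> an amplification in \<open>N\<close>, once the amplified vector slices
  are known to lie in \<open>N\<close>.\<close>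

lemma closed_subsp_amp:
  assumes "closed_subsp N"
  shows "closed_subsp {k. \<exists>k'\<in>N. amp k k'}"
proof (rule closed_subspI)
  fix s l assume s: "\<And>n::nat. s n \<in> {k. \<exists>k'\<in>N. amp k k'}" "s \<longlonglongrightarrow> l"
  then have "\<forall>n. \<exists>k'. k' \<in> N \<and> amp (s n) k'" by blast
  then obtain s' where s': "\<And>n. s' n \<in> N" "\<And>n. amp (s n) (s' n)" by metis
  obtain l' where l': "amp l l'" "s' \<longlonglongrightarrow> l'" using amp_lim[OF s'(2) s(2)] by blast
  have "l' \<in> N" by (rule closed_subspD(4)[OF assms s'(1) l'(2)])
  with l'(1) show "l \<in> {k. \<exists>k'\<in>N. amp k k'}" by blast
next
  fix S T assume "S \<in> {k. \<exists>k'\<in>N. amp k k'}" "T \<in> {k. \<exists>k'\<in>N. amp k k'}"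
  then show "S + T \<in> {k. \<exists>k'\<in>N. amp k k'}" using amp_add closed_subspD(2)[OF assms] by blast
next
  fix a T assume "T \<in> {k. \<exists>k'\<in>N. amp k k'}"
  then show "op_scaleC a T \<in> {k. \<exists>k'\<in>N. amp k k'}" using amp_scale closed_subspD(3)[OF assms] by blast
qed (use amp_zero closed_subspD(1)[OF assms] in blast)

text \<open>Against elementary tensors, a matrix coefficient of the third-leg slice factors by
  associativity into an inner product on the first leg and a coefficient of the slice of
  \<open>G\<close>.\<close>

lemma amp_vslice:
  assumes "is_leg23 G G23"
  shows "amp (t.vslice G \<eta> \<xi>) (t3.vslice G23 \<eta> \<xi>)"
proof -
  \<comment> \<open>Quantified over \<open>G\<close> so that the same computation also serves the
    adjoint.\<close>
  have half: "blinfun_apply (t3.vslice G23 \<eta> \<xi>) (t x y) = t x (blinfun_apply (t.vslice G \<eta> \<xi>) y)"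
    if G: "is_leg23 G G23" for G G23 \<eta> \<xi> x y
  proof (rule T2_ext)
    have G': "G \<in> bop T2 T2" "clin G" "clin G23" using G by (auto simp: is_leg23_def dest: bop_clin)
    have GT: "proj T2 (blinfun_apply G v) = blinfun_apply G v" for v
      using G' by (auto simp: bop_def intro: proj_of_mem[OF t3.H])
    fix x' y'
    have "cinner (t x' y') (blinfun_apply (t3.vslice G23 \<eta> \<xi>) (t x y))
      = cinner (u x' (t y' \<eta>)) (blinfun_apply G23 (u x (t y \<xi>)))"
      by (simp add: t3.cinner_vslice assoc)
    also have "\<dots> = cinner (proj H x') x * cinner (t y' \<eta>) (blinfun_apply G (t y \<xi>))"
      using G by (simp add: is_leg23_def u.cinner_t)
    also have "\<dots> = cinner (proj H x') x * cinner y' (blinfun_apply (t.vslice G \<eta> \<xi>) y)"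
      by (simp add: t.cinner_vslice)
    also have "\<dots> = cinner (t x' y') (t x (blinfun_apply (t.vslice G \<eta> \<xi>) y))"
      by (simp add: t.cinner_t proj_selfadjoint[OF t.H] proj_of_mem[OF t.H]
          t.vslice_bop[OF G'(2), unfolded bop_def, simplified])
    finally show "cinner (t x' y') (blinfun_apply (t3.vslice G23 \<eta> \<xi>) (t x y)) =
      cinner (t x' y') (t x (blinfun_apply (t.vslice G \<eta> \<xi>) y))" .
  next
    show "blinfun_apply (t3.vslice G23 \<eta> \<xi>) (t x y) \<in> T2"
      unfolding t3.vslice_def by (simp add: t3.adj_cr_in)
  qed (rule t_in)
  have G': "clin G" "clin G23" using assms by (auto simp: is_leg23_def dest: bop_clin)
  show ?thesis
    unfolding amp_def t.adj_vslice[OF G'(1)] t3.adj_vslice[OF G'(2)]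
    using half[OF assms] half[OF is_leg23_adj[OF assms]] t.vslice_bop[OF G'(1)] t3.vslice_bop[OF G'(2)]
    by simp
qed

section \<open>Rank-one operators\<close>

definition rank_one :: "'v \<Rightarrow> 'v \<Rightarrow> ('v \<Rightarrow>\<^sub>L 'v)" where
  "rank_one \<xi> \<eta> = Blinfun (\<lambda>x. cinner (proj H \<eta>) x *\<^sub>C proj H \<xi>)"

lemma rank_one_apply [simp]: "blinfun_apply (rank_one \<xi> \<eta>) x = cinner (proj H \<eta>) x *\<^sub>C proj H \<xi>"
proof -
  have "bounded_linear (\<lambda>x. cinner (proj H \<eta>) x *\<^sub>C proj H \<xi>)"
    by (intro bounded_linear_compose[OF bounded_bilinear.bounded_linear_left[OF bounded_bilinear_scaleC]]
        bounded_bilinear.bounded_linear_right[OF bounded_bilinear_cinner])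
  then show ?thesis by (simp add: rank_one_def bounded_linear_Blinfun_apply)
qed

lemma rank_one_bop: "rank_one \<xi> \<eta> \<in> bop H H"
  unfolding bop_iff[OF t.H]
  by (auto simp: clin_def cinner_scaleC_right scaleC_scaleC proj_in[OF t.H] proj_cinner_right[OF t.H]
      intro: cvs.subspace_scale[OF hilbert_subspace_module(1)[OF t.H]])

lemma adj_rank_one: "adj (rank_one \<xi> \<eta>) = rank_one \<eta> \<xi>"
proof (rule adj_eqI[OF bop_clin[OF rank_one_bop]])
  fix x y
  show "cinner y (blinfun_apply (rank_one \<eta> \<xi>) x) = cinner (blinfun_apply (rank_one \<xi> \<eta>) y) x"
    using cinner_commute[of y "proj H \<eta>"] by (simp add: cinner_simps mult.commute)
qed

text \<open>This factorisation is what splits a slice of \<open>A k' B\<close>, with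
  \<open>k'\<close> the amplified rank-one operator, into a slice of \<open>A\<close> times a slice
  of \<open>B\<close>.\<close>

lemma amp_rank_one: "amp (rank_one \<xi> \<eta>) (t.cr \<xi> o\<^sub>L adj (t.cr \<eta>))"
proof -
  have b: "t.cr \<xi> \<in> bop H T2" for \<xi>
    unfolding bop_iff[OF t.H] by (simp add: t_in)
  show ?thesis
    unfolding amp_def
    by (auto simp: rank_one_bop adj_rank_one adj_compose t.scale_left t.scale_right
        intro!: bop_compose b adj_bop t.H t3.H)
qed

lemma rank_one_compact: "rank_one \<xi> \<eta> \<in> compact_ops H H"
proof -
  have "blinfun_apply (rank_one \<xi> \<eta>) ` (H \<inter> cball 0 1) \<subseteq> (\<lambda>a. a *\<^sub>C proj H \<xi>) ` cball 0 (norm \<eta>)"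
  proof clarify
    fix x :: 'v assume x: "x \<in> cball 0 1"
    have "cmod (cinner (proj H \<eta>) x) \<le> norm (proj H \<eta>) * norm x" by (rule cmod_cinner_le)
    also have "\<dots> \<le> norm \<eta> * 1" using x by (intro mult_mono norm_proj_le t.H) auto
    finally show "blinfun_apply (rank_one \<xi> \<eta>) x \<in> (\<lambda>a. a *\<^sub>C proj H \<xi>) ` cball 0 (norm \<eta>)"
      by simp
  qed
  moreover have c: "compact ((\<lambda>a. a *\<^sub>C proj H \<xi>) ` cball 0 (norm \<eta>))"
    by (intro compact_continuous_image compact_cball linear_continuous_on
        bounded_bilinear.bounded_linear_left[OF bounded_bilinear_scaleC])
  ultimately have "closure (blinfun_apply (rank_one \<xi> \<eta>) ` (H \<inter> cball 0 1)) \<subseteq> (\<lambda>a. a *\<^sub>C proj H \<xi>) ` cball 0 (norm \<eta>)"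
    by (intro closure_minimal compact_imp_closed)
  then have "compact (closure (blinfun_apply (rank_one \<xi> \<eta>) ` (H \<inter> cball 0 1)))"
    using compact_Int_closed[OF c closed_closure] by (metis inf.absorb_iff2)
  then show ?thesis by (simp add: compact_ops_def rank_one_bop)
qed

end

section \<open>Slicing three-leg identities over the last two legs\<close>

context tensor_triple
begin

lemma legs_clin:
  "is_leg12 X Y \<Longrightarrow> clin X" "is_leg12 X Y \<Longrightarrow> clin Y"
  "is_leg23 X Y \<Longrightarrow> clin X" "is_leg23 X Y \<Longrightarrow> clin Y"
  by (auto simp: is_leg12_def is_leg23_def dest: bop_clin)

lemma is_leg12_compose:
  "is_leg12 X Y \<Longrightarrow> is_leg12 X' Y' \<Longrightarrow> is_leg12 (X o\<^sub>L X') (Y o\<^sub>L Y')"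
  using legs_clin(1,2)[of X Y] legs_clin(1,2)[of X' Y']
  by (auto simp: is_leg12_def adj_compose intro: bop_compose)

lemma is_leg23_compose:
  "is_leg23 X Y \<Longrightarrow> is_leg23 X' Y' \<Longrightarrow> is_leg23 (X o\<^sub>L X') (Y o\<^sub>L Y')"
  using legs_clin(3,4)[of X Y] legs_clin(3,4)[of X' Y']
  by (auto simp: is_leg23_def adj_compose intro: bop_compose)

lemma slice_leg12:
  assumes "is_leg12 R R12"
  shows "adj (u.cr (t \<eta> \<eta>')) o\<^sub>L (R12 o\<^sub>L u.cr (t \<xi> \<xi>')) = op_scaleC (cinner (proj H \<eta>') \<xi>') (t.vslice R \<eta> \<xi>)"
proof -
  note R = legs_clin(1)[OF assms]
  have "adj (u.cr (t \<eta> \<eta>')) o\<^sub>L (R12 o\<^sub>L u.cr (t \<xi> \<xi>')) =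
      adj (t.cr \<eta>) o\<^sub>L ((adj (t3.cr \<eta>') o\<^sub>L R12) o\<^sub>L (t3.cr \<xi>' o\<^sub>L t.cr \<xi>))"
    by (simp add: u_cr_t adj_compose blinfun_compose_assoc)
  also have "\<dots> = adj (t.cr \<eta>) o\<^sub>L (R o\<^sub>L (adj (t3.cr \<eta>') o\<^sub>L (t3.cr \<xi>' o\<^sub>L t.cr \<xi>)))"
    by (simp add: leg12_adj_cr[OF assms] blinfun_compose_assoc)
  also have "\<dots> = op_scaleC (cinner (proj H \<eta>') \<xi>') (t.vslice R \<eta> \<xi>)"
    by (rule blinfun_eqI) (simp add: t.vslice_def R clinD)
  finally show ?thesis .
qed

text \<open>\<open>A12\<close> and \<open>B12\<close> move past the operators that create or
  contract the third leg, so slicing that leg affects \<open>G23\<close> alone; the second leg is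
  sliced afterwards.\<close>

lemma slice_leg_product:
  assumes "is_leg12 A A12" "is_leg12 B B12"
  shows "adj (u.cr (t \<eta> \<eta>')) o\<^sub>L ((A12 o\<^sub>L (G23 o\<^sub>L B12)) o\<^sub>L u.cr (t \<xi> \<xi>')) =
    adj (t.cr \<eta>) o\<^sub>L (A o\<^sub>L (t3.vslice G23 \<eta>' \<xi>' o\<^sub>L (B o\<^sub>L t.cr \<xi>)))"
proof -
  have "adj (u.cr (t \<eta> \<eta>')) o\<^sub>L ((A12 o\<^sub>L (G23 o\<^sub>L B12)) o\<^sub>L u.cr (t \<xi> \<xi>')) =
      adj (t.cr \<eta>) o\<^sub>L ((adj (t3.cr \<eta>') o\<^sub>L A12) o\<^sub>L (G23 o\<^sub>L ((B12 o\<^sub>L t3.cr \<xi>') o\<^sub>L t.cr \<xi>)))"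
    by (simp add: u_cr_t adj_compose blinfun_compose_assoc)
  also have "\<dots> = adj (t.cr \<eta>) o\<^sub>L (A o\<^sub>L (t3.vslice G23 \<eta>' \<xi>' o\<^sub>L (B o\<^sub>L t.cr \<xi>)))"
    by (simp add: leg12_adj_cr[OF assms(1)] leg12_cr[OF assms(2)] blinfun_compose_assoc t3.vslice_def)
  finally show ?thesis .
qed

lemma slice_conjugate_leg23:
  assumes "is_leg23 U U23" "is_leg23 V V23"
  shows "adj (u.cr \<zeta>) o\<^sub>L ((U23 o\<^sub>L (Y o\<^sub>L V23)) o\<^sub>L u.cr \<zeta>') =
    adj (u.cr (blinfun_apply (adj U) \<zeta>)) o\<^sub>L (Y o\<^sub>L u.cr (blinfun_apply V \<zeta>'))"
proof -
  have "adj (u.cr \<zeta>) o\<^sub>L ((U23 o\<^sub>L (Y o\<^sub>L V23)) o\<^sub>L u.cr \<zeta>') =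
      (adj (u.cr \<zeta>) o\<^sub>L U23) o\<^sub>L (Y o\<^sub>L (V23 o\<^sub>L u.cr \<zeta>'))"
    by (simp add: blinfun_compose_assoc)
  also have "\<dots> = adj (u.cr (blinfun_apply (adj U) \<zeta>)) o\<^sub>L (Y o\<^sub>L u.cr (blinfun_apply V \<zeta>'))"
    by (simp add: leg23_adj_cr[OF assms(1)] leg23_cr[OF assms(2)])
  finally show ?thesis .
qed

lemma leg23_in: "is_leg23 X Y \<Longrightarrow> blinfun_apply X v \<in> T2"
  by (auto simp: is_leg23_def bop_def)

text \<open>The invertible factors \<open>U\<close> and \<open>V\<close> act on the two sliced legs only, so they merely
  change the functional by which one slices.\<close>

lemma slice_amp_in_slices:
  assumes A: "is_leg12 A A12" and B: "is_leg12 B B12" and G: "is_leg23 G G23"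
    and R: "is_leg12 R R12" and U: "is_leg23 U U23" and V: "is_leg23 V V23"
    and eq: "A12 o\<^sub>L (G23 o\<^sub>L B12) = U23 o\<^sub>L (R12 o\<^sub>L V23)"
    and k: "k \<in> t.slices G"
  shows "\<exists>k'. amp k k' \<and> (\<forall>\<eta> \<xi>. adj (t.cr \<eta>) o\<^sub>L (A o\<^sub>L (k' o\<^sub>L (B o\<^sub>L t.cr \<xi>))) \<in> t.slices R)"
proof -
  define Q where "Q = t.slices R"
  have Q: "closed_subsp Q" unfolding Q_def by (rule t.closed_subsp_slices)
  \<comment> \<open>\<open>N\<close> holds the \<open>k'\<close> for which all vector slices of
    \<open>A k' B\<close> lie in \<open>Q\<close>; writing it as an intersection over pairs of
    vectors exhibits it as a closed subspace.\<close>
  define N where "N = {k'. \<forall>p\<in>UNIV. k' \<in> {k'. (adj (t.cr (fst p)) o\<^sub>L A) o\<^sub>L (k' o\<^sub>L (B o\<^sub>L t.cr (snd p))) \<in> Q}}"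
  have N: "closed_subsp N" unfolding N_def
    by (intro closed_subsp_Inter closed_subsp_compose Q) (simp add: legs_clin(1)[OF A])
  have mem: "k' \<in> N \<longleftrightarrow> (\<forall>\<eta> \<xi>. adj (t.cr \<eta>) o\<^sub>L (A o\<^sub>L (k' o\<^sub>L (B o\<^sub>L t.cr \<xi>))) \<in> Q)" for k'
    by (simp add: N_def blinfun_compose_assoc)
  have S: "adj (u.cr \<zeta>) o\<^sub>L (R12 o\<^sub>L u.cr \<zeta>') \<in> Q" if "\<zeta> \<in> T2" "\<zeta>' \<in> T2" for \<zeta> \<zeta>'
    by (rule mem_if_elementary_mem[OF Q legs_clin(2)[OF R] _ that])
       (simp add: slice_leg12[OF R] closed_subspD(3)[OF Q] Q_def t.vslice_in_slices t.closed_subsp_slices closed_subspD(3))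
  have "t3.vslice G23 \<eta>' \<xi>' \<in> N" for \<eta>' \<xi>'
    unfolding mem slice_leg_product[OF A B, symmetric] eq slice_conjugate_leg23[OF U V]
    by (intro allI S leg23_in[OF is_leg23_adj[OF U]] leg23_in[OF V])
  then have "t.slices G \<subseteq> {k. \<exists>k'\<in>N. amp k k'}"
    by (intro t.slices_subset closed_subsp_amp N) (use amp_vslice[OF G] in blast)
  with k show ?thesis unfolding Q_def[symmetric] using mem by blast
qed

text \<open>The converse direction: with the identity solved for \<open>R12\<close>, every vector
  slice of \<open>R\<close> is reached from slices of operators \<open>A k' B\<close>, where
  \<open>k'\<close> amplifies an element of \<open>t.slices G\<close>.\<close>

lemma slices_in_slice_amp:
  assumes A: "is_leg12 A A12" and B: "is_leg12 B B12" and G: "is_leg23 G G23"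
    and R: "is_leg12 R R12" and U: "is_leg23 U U23" and V: "is_leg23 V V23"
    and eq: "R12 = U23 o\<^sub>L ((A12 o\<^sub>L (G23 o\<^sub>L B12)) o\<^sub>L V23)"
    and Q: "closed_subsp Q"
    and mem: "\<And>k k' \<eta> \<xi>. k \<in> t.slices G \<Longrightarrow> amp k k' \<Longrightarrow>
      adj (t.cr \<eta>) o\<^sub>L (A o\<^sub>L (k' o\<^sub>L (B o\<^sub>L t.cr \<xi>))) \<in> Q"
  shows "t.slices R \<subseteq> Q"
proof (rule t.slices_subset[OF Q])
  fix \<eta> \<xi>
  have S: "adj (u.cr \<zeta>) o\<^sub>L ((A12 o\<^sub>L (G23 o\<^sub>L B12)) o\<^sub>L u.cr \<zeta>') \<in> Q" if "\<zeta> \<in> T2" "\<zeta>' \<in> T2" for \<zeta> \<zeta>'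
  proof (rule mem_if_elementary_mem[OF Q _ _ that])
    show "clin (A12 o\<^sub>L (G23 o\<^sub>L B12))" using legs_clin A B G by auto
    show "adj (u.cr (t \<eta> \<eta>')) o\<^sub>L ((A12 o\<^sub>L (G23 o\<^sub>L B12)) o\<^sub>L u.cr (t \<xi> \<xi>')) \<in> Q" for \<eta> \<eta>' \<xi> \<xi>'
      unfolding slice_leg_product[OF A B] by (rule mem[OF t.vslice_in_slices amp_vslice[OF G]])
  qed
  \<comment> \<open>Slicing \<open>R12\<close> over two legs leaves a scalar from the third one.
    Using \<open>e\<close> on both sides makes it \<open>(norm (proj H e))^2\<close>, which is
    divided out below.\<close>
  have e: "op_scaleC (cinner (proj H e) e) (t.vslice R \<eta> \<xi>) \<in> Q" for e
    unfolding slice_leg12[OF R, symmetric] eq slice_conjugate_leg23[OF U V]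
    by (intro S leg23_in[OF is_leg23_adj[OF U]] leg23_in[OF V])
  show "t.vslice R \<eta> \<xi> \<in> Q"
  proof (cases "\<exists>e. cinner (proj H e) e \<noteq> 0")
    case True
    then obtain e where "cinner (proj H e) e \<noteq> 0" by blast
    with closed_subspD(3)[OF Q e[of e], of "inverse (cinner (proj H e) e)"] show ?thesis by simp
  next
    \<comment> \<open>Here \<open>H\<close> is the zero space and all slices vanish.\<close>
    case False
    have "proj H e = 0" for e
    proof -
      have "cinner (proj H e) (proj H e) = cinner (proj H e) e"
        by (rule proj_cinner_right[OF t.H proj_in[OF t.H]])
      with False show ?thesis by (simp add: cinner_self)
    qed
    then have "t.cr \<xi> = 0" by (intro blinfun_eqI) (metis t.cr_apply t.proj_right t_zero_right blinfun.zero_left)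
    then show ?thesis by (simp add: t.vslice_def blinfun_compose_lin closed_subspD(1)[OF Q])
  qed
qed

text \<open>For vector slices, taking \<open>k\<close> of rank one in
  \<open>slice_amp_in_slices\<close> gives exactly the product of the two slices; the closed spans
  follow by bilinearity.\<close>

lemma slices_compose:
  assumes A: "is_leg12 A A12" and B: "is_leg12 B B12" and G: "is_leg23 G G23"
    and R: "is_leg12 R R12" and U: "is_leg23 U U23" and V: "is_leg23 V V23"
    and eq: "A12 o\<^sub>L (G23 o\<^sub>L B12) = U23 o\<^sub>L (R12 o\<^sub>L V23)"
    and compact: "\<And>\<xi> \<eta>. rank_one \<xi> \<eta> \<in> t.slices G"
    and S: "S \<in> t.slices A" and T: "T \<in> t.slices B"
  shows "S o\<^sub>L T \<in> t.slices R"
proof (rule closed_span_compose[OF _ t.closed_subsp_slices S[unfolded t.slices_def] T[unfolded t.slices_def]])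
  fix S T assume "S \<in> {t.vslice A \<eta> \<xi> | \<eta> \<xi>. True}" "T \<in> {t.vslice B \<eta> \<xi> | \<eta> \<xi>. True}"
  then obtain \<eta> \<xi> \<eta>' \<xi>' where ST: "S = t.vslice A \<eta> \<xi>" "T = t.vslice B \<eta>' \<xi>'" by blast
  obtain k' where k': "amp (rank_one \<xi> \<eta>') k'"
    "adj (t.cr \<eta>) o\<^sub>L (A o\<^sub>L (k' o\<^sub>L (B o\<^sub>L t.cr \<xi>'))) \<in> t.slices R"
    using slice_amp_in_slices[OF A B G R U V eq compact] by blast
  have "k' = t.cr \<xi> o\<^sub>L adj (t.cr \<eta>')" by (rule amp_unique[OF k'(1) amp_rank_one])
  with k'(2) show "S o\<^sub>L T \<in> t.slices R" by (simp add: ST t.vslice_def blinfun_compose_assoc)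
next
  fix S assume "S \<in> {t.vslice A \<eta> \<xi> | \<eta> \<xi>. True}"
  then show "clin S" using t.clin_vslice legs_clin(1)[OF A] by blast
qed

text \<open>By \<open>eq\<close>, used with \<open>adj k\<close>, the slices of
  \<open>F l' (adj F)\<close> lie in the slices of \<open>adj F\<close>, where \<open>l'\<close>
  amplifies \<open>adj k\<close>. Taking adjoints puts the slices for \<open>k\<close> itself into
  \<open>t.slices F\<close>. By \<open>eq'\<close> these generate the slices of
  \<open>adj F\<close>.\<close>

lemma slices_adj_subset:
  assumes F: "is_leg12 F F12" "is_leg23 F F23" and c: "is_leg23 c c23" and G: "is_leg23 G G23"
    and eq: "F12 o\<^sub>L (G23 o\<^sub>L adj F12) = adj c23 o\<^sub>L (adj F12 o\<^sub>L F23)"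
    and eq': "adj F12 = c23 o\<^sub>L ((F12 o\<^sub>L (G23 o\<^sub>L adj F12)) o\<^sub>L adj F23)"
    and G_adj: "\<And>k. k \<in> t.slices G \<Longrightarrow> adj k \<in> t.slices G"
    and T: "T \<in> t.slices F"
  shows "adj T \<in> t.slices F"
proof -
  have "adj (t.cr \<eta>) o\<^sub>L (F o\<^sub>L (k' o\<^sub>L (adj F o\<^sub>L t.cr \<xi>))) \<in> t.slices F"
    if k: "k \<in> t.slices G" "amp k k'" for k k' \<eta> \<xi>
  proof -
    note cl = legs_clin(1,2)[OF F(1)] amp_clin[OF k(2)]
    obtain l' where l': "amp (adj k) l'"
      "adj (t.cr \<xi>) o\<^sub>L (F o\<^sub>L (l' o\<^sub>L (adj F o\<^sub>L t.cr \<eta>))) \<in> t.slices (adj F)"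
      using slice_amp_in_slices[OF F(1) is_leg12_adj[OF F(1)] G is_leg12_adj[OF F(1)]
          is_leg23_adj[OF c] F(2) eq G_adj[OF k(1)]] by blast
    have "l' = adj k'" by (rule amp_unique[OF l'(1) amp_adj[OF k(2)]])
    with t.slices_adj[OF clin_adj l'(2)] cl show ?thesis
      by (simp add: adj_compose blinfun_compose_assoc)
  qed
  then have "t.slices (adj F) \<subseteq> t.slices F"
    by (rule slices_in_slice_amp[OF F(1) is_leg12_adj[OF F(1)] G is_leg12_adj[OF F(1)] c
        is_leg23_adj[OF F(2)] eq' t.closed_subsp_slices])
  then show ?thesis using t.slices_adj[OF legs_clin(1)[OF F(1)] T] by blast
qed

text \<open>Through \<open>slices_compose\<close>, \<open>eq1\<close> controls the products
  \<open>adj S o R\<close>, and \<open>eq2\<close> controls \<open>S o adj R\<close> after an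
  adjoint. This suffices to apply \<open>mem_of_compose_adj_power_mem\<close> to
  \<open>x = adj T\<close>.\<close>

lemma slices_adj_of_compact:
  assumes G: "is_leg12 G G12" "is_leg23 G G23" and c: "is_leg23 c c23"
    and eq1: "adj G12 o\<^sub>L (G23 o\<^sub>L G12) = adj c23 o\<^sub>L (G12 o\<^sub>L adj G23)"
    and eq2: "G12 o\<^sub>L (adj G23 o\<^sub>L adj G12) = c23 o\<^sub>L (adj G12 o\<^sub>L G23)"
    and compact: "\<And>\<xi> \<eta>. rank_one \<xi> \<eta> \<in> t.slices G"
    and T: "T \<in> t.slices G"
  shows "adj T \<in> t.slices G"
proof -
  note cG = legs_clin(1)[OF G(1)]
  have clin_slices: "clin S" if "S \<in> t.slices G" for S
    using t.slices_bop[OF cG] that bop_clin by blast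
  note GG = is_leg12_adj[OF G(1)] is_leg23_adj[OF G(2)]
  have 1: "adj S o\<^sub>L R \<in> t.slices G" if "S \<in> t.slices G" "R \<in> t.slices G" for S R
    by (rule slices_compose[OF GG(1) G(1) G(2) G(1) is_leg23_adj[OF c] GG(2) eq1 compact
        t.slices_adj[OF cG that(1)] that(2)])
  have compact': "rank_one \<xi> \<eta> \<in> t.slices (adj G)" for \<xi> \<eta>
    using t.slices_adj[OF cG compact[of \<eta> \<xi>]] by (simp add: adj_rank_one)
  have 2: "S o\<^sub>L adj R \<in> t.slices G" if "S \<in> t.slices G" "R \<in> t.slices G" for S R
  proof -
    have "R o\<^sub>L adj S \<in> t.slices (adj G)"
      by (rule slices_compose[OF G(1) GG(1) GG(2) GG(1) c G(2) eq2 compact' that(2) t.slices_adj[OF cG that(1)]])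
    from t.slices_adj[OF _ this] show ?thesis
      using that by (simp add: adj_compose clin_slices cG)
  qed
  note cT = clin_slices[OF T]
  have TT: "adj T o\<^sub>L T \<in> t.slices G" by (rule 1[OF T T])
  have pow: "adj T o\<^sub>L (((o\<^sub>L) (adj (adj T) o\<^sub>L adj T)) ^^ (Suc n)) id_blinfun \<in> t.slices G" for n
  proof (induction n)
    case 0
    have "adj T o\<^sub>L (T o\<^sub>L adj T) \<in> t.slices G" by (rule 1[OF T 2[OF T T]])
    moreover have "((adj (adj T) o\<^sub>L adj T) o\<^sub>L id_blinfun) = T o\<^sub>L adj T"
      by (rule blinfun_eqI) (simp add: cT)
    ultimately show ?case by simp
  next
    case (Suc n)
    \<comment> \<open>\<open>adj T o T\<close> is selfadjoint and already known to be in
      \<open>t.slices G\<close>, so left multiplication by it is again a product covered by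
      \<open>1\<close>.\<close>
    have eq: "adj T o\<^sub>L ((adj (adj T) o\<^sub>L adj T) o\<^sub>L X) = adj (adj T o\<^sub>L T) o\<^sub>L (adj T o\<^sub>L X)" for X
      by (simp add: cT adj_compose blinfun_compose_assoc)
    show ?case
      unfolding funpow.simps(2)[of "Suc n"] o_apply by (subst eq) (rule 1[OF TT Suc])
  qed
  show ?thesis
    by (rule mem_of_compose_adj_power_mem[OF t.closed_subsp_slices clin_adj[OF cT] pow])
qed

end

section \<open>Slices by normal functionals\<close>

lemma form_op_eqI:
  assumes "hilbert_subspace H" "T \<in> bop H K"
    and B: "\<And>x y. x \<in> H \<Longrightarrow> y \<in> K \<Longrightarrow> cinner y (blinfun_apply T x) = B x y"
  shows "form_op H K B = T"
  unfolding form_op_def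
proof (rule the_equality)
  show "T \<in> bop H K \<and> (\<forall>x\<in>H. \<forall>y\<in>K. cinner y (blinfun_apply T x) = B x y)"
    using assms by blast
  fix S assume S: "S \<in> bop H K \<and> (\<forall>x\<in>H. \<forall>y\<in>K. cinner y (blinfun_apply S x) = B x y)"
  show "S = T"
  proof (rule blinfun_eqI)
    fix x
    define p where "p = proj H x"
    define d where "d = blinfun_apply S p - blinfun_apply T p"
    have p: "p \<in> H" unfolding p_def by (rule proj_in[OF assms(1)])
    have in_K: "blinfun_apply S p \<in> K" "blinfun_apply T p \<in> K"
      using S assms(2) by (auto simp: bop_def)
    have "cinner y d = 0" if "y \<in> K" for y
      using S B[OF p that] p that by (simp add: d_def cinner_diff_right)
    then have "cinner (blinfun_apply S p) d = 0" "cinner (blinfun_apply T p) d = 0"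
      using in_K by auto
    then have "cinner d d = 0" using cinner_diff_left[of "blinfun_apply S p" "blinfun_apply T p" d]
      by (simp add: d_def[symmetric])
    then have "d = 0" by (simp add: cinner_self)
    then show "blinfun_apply S x = blinfun_apply T x"
      using S assms(2) unfolding d_def p_def by (simp add: bop_iff[OF assms(1)])
  qed
qed

context tensor_map
begin

text \<open>A sum of squares replaces the product of norms, so that two square-summable families
  dominate the series of slices term by term.\<close>

lemma norm_vslice_le: "norm (vslice X \<eta> \<xi>) \<le> norm X * ((norm \<xi>)\<^sup>2 + (norm \<eta>)\<^sup>2)"
proof -
  have "norm (vslice X \<eta> \<xi>) \<le> norm (adj (cr \<eta>)) * (norm X * norm (cr \<xi>))"
    unfolding vslice_def
    by (intro order_trans[OF norm_blinfun_compose] mult_left_mono norm_blinfun_compose) simp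
  also have "\<dots> \<le> norm \<eta> * (norm X * norm \<xi>)"
    by (intro mult_mono norm_cr_le) (simp_all add: norm_adj norm_cr_le)
  also have "\<dots> = norm X * (norm \<eta> * norm \<xi>)" by (simp add: mult_ac)
  also have "\<dots> \<le> norm X * ((norm \<xi>)\<^sup>2 + (norm \<eta>)\<^sup>2)"
  proof (rule mult_left_mono)
    have "0 \<le> (norm \<xi> - norm \<eta>)\<^sup>2 + (norm \<xi>)\<^sup>2 + (norm \<eta>)\<^sup>2" by simp
    then show "norm \<eta> * norm \<xi> \<le> (norm \<xi>)\<^sup>2 + (norm \<eta>)\<^sup>2"
      by (simp add: power2_eq_square algebra_simps)
  qed simp
  finally show ?thesis .
qed

text \<open>With the legs exchanged, the inner \<open>form_op\<close> in \<open>slice\<close>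
  becomes a vector slice over the first leg.\<close>

lemma flip: "tensor_map K H (\<lambda>y x. t x y)"
  by unfold_locales
     (simp_all add: H K add_left add_right scale_left scale_right cinner_t mult.commute)

text \<open>The vector slices are absolutely summable, so their sum commutes with matrix
  coefficients. Here \<open>t0\<close> stands for the raw tensor map, which is controlled only on
  \<open>H\<close> and \<open>K\<close>.\<close>

lemma slice_normal_functional:
  assumes X: "clin X" and t0: "\<And>x y. x \<in> H \<Longrightarrow> y \<in> K \<Longrightarrow> t0 x y = t x y"
    and \<omega>: "\<omega> = (\<lambda>T\<in>bop K K. \<Sum>n. cinner (\<eta> n) (blinfun_apply T (\<xi> n)))"
    and mem: "\<And>n. \<xi> n \<in> K" "\<And>n. \<eta> n \<in> K"
    and sum: "summable (\<lambda>n. (norm (\<xi> n))\<^sup>2)" "summable (\<lambda>n. (norm (\<eta> n))\<^sup>2)"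
  shows "summable (\<lambda>n. vslice X (\<eta> n) (\<xi> n))"
    and "slice H K t0 H K t0 \<omega> X = (\<Sum>n. vslice X (\<eta> n) (\<xi> n))"
proof -
  interpret fl: tensor_map K H "\<lambda>y x. t x y" by (rule flip)
  show summable: "summable (\<lambda>n. vslice X (\<eta> n) (\<xi> n))"
  proof (rule summable_comparison_test')
    show "summable (\<lambda>n. norm X * ((norm (\<xi> n))\<^sup>2 + (norm (\<eta> n))\<^sup>2))"
      by (intro summable_mult summable_add sum)
  qed (rule norm_vslice_le)
  define T where "T = (\<Sum>n. vslice X (\<eta> n) (\<xi> n))"
  have inner_form: "form_op K K (\<lambda>x y. cinner (t0 \<eta>0 y) (blinfun_apply X (t0 \<xi>0 x))) = fl.vslice X \<eta>0 \<xi>0"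
    if "\<xi>0 \<in> H" "\<eta>0 \<in> H" for \<xi>0 \<eta>0
    by (rule form_op_eqI[OF K fl.vslice_bop[OF X]]) (simp add: fl.cinner_vslice t0 that)
  have T_bop: "T \<in> bop H H"
  proof (rule closed_subspD(4)[OF closed_subsp_bop[OF H]])
    show "(\<lambda>n. \<Sum>i<n. vslice X (\<eta> i) (\<xi> i)) \<longlonglongrightarrow> T"
      unfolding T_def by (rule summable_LIMSEQ[OF summable])
    show "(\<Sum>i<n. vslice X (\<eta> i) (\<xi> i)) \<in> bop H H" for n
      using closed_subsp_bop[OF H, of H] by (auto simp: closed_subsp_def intro: ops.subspace_sum vslice_bop[OF X])
  qed
  have "slice H K t0 H K t0 \<omega> X = T"
    unfolding slice_def
  proof (rule form_op_eqI[OF H T_bop])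
    fix x y assume xy: "x \<in> H" "y \<in> H"
    have bl: "bounded_linear (\<lambda>S. cinner y (blinfun_apply S x))"
      by (intro bounded_linear_compose[OF bounded_bilinear.bounded_linear_right[OF bounded_bilinear_cinner]]
          blinfun.bounded_linear_left)
    have "cinner y (blinfun_apply T x) = (\<Sum>n. cinner y (blinfun_apply (vslice X (\<eta> n) (\<xi> n)) x))"
      unfolding T_def by (rule bounded_linear.suminf[OF bl summable])
    also have "\<dots> = \<omega> (fl.vslice X y x)"
      by (simp add: \<omega> fl.vslice_bop[OF X] cinner_vslice fl.cinner_vslice)
    finally show "cinner y (blinfun_apply T x) =
        \<omega> (form_op K K (\<lambda>x' y'. cinner (t0 y y') (blinfun_apply X (t0 x x'))))"
      by (simp add: inner_form xy)
  qed
  then show "slice H K t0 H K t0 \<omega> X = (\<Sum>n. vslice X (\<eta> n) (\<xi> n))" by (simp add: T_def)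
qed

lemma vslice_proj: "vslice X (proj K \<eta>) (proj K \<xi>) = vslice X \<eta> \<xi>"
proof -
  have "cr (proj K \<xi>) = cr \<xi>" for \<xi> by (rule blinfun_eqI) simp
  then show ?thesis by (simp add: vslice_def)
qed

text \<open>A slice by a normal functional is a norm limit of finite sums of vector slices;
  conversely a vector functional is a normal functional whose families have one possibly nonzero
  term.\<close>

lemma closed_span_slice:
  assumes X: "clin X" and t0: "\<And>x y. x \<in> H \<Longrightarrow> y \<in> K \<Longrightarrow> t0 x y = t x y"
  shows "closed_span {slice H K t0 H K t0 \<omega> X | \<omega>. \<omega> \<in> normal_functionals K K} = slices X"
proof
  show "closed_span {slice H K t0 H K t0 \<omega> X | \<omega>. \<omega> \<in> normal_functionals K K} \<subseteq> slices X"
  proof -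
    have "slice H K t0 H K t0 \<omega> X \<in> slices X" if "\<omega> \<in> normal_functionals K K" for \<omega>
    proof -
      from that obtain \<xi> \<eta> where \<omega>: "\<omega> = (\<lambda>T\<in>bop K K. \<Sum>n. cinner (\<eta> n) (blinfun_apply T (\<xi> n)))"
        "\<And>n. \<xi> n \<in> K" "\<And>n. \<eta> n \<in> K" "summable (\<lambda>n. (norm (\<xi> n))\<^sup>2)" "summable (\<lambda>n. (norm (\<eta> n))\<^sup>2)"
        unfolding normal_functionals_def by blast
      note sl = slice_normal_functional[OF X t0 \<omega>]
      have "(\<Sum>i<n. vslice X (\<eta> i) (\<xi> i)) \<in> slices X" for n
        using closed_subsp_slices by (auto simp: closed_subsp_def intro: ops.subspace_sum vslice_in_slices)
      from closed_subspD(4)[OF closed_subsp_slices this summable_LIMSEQ[OF sl(1)]]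
      show ?thesis by (simp add: sl(2))
    qed
    then show ?thesis by (intro closed_span_minimal closed_subsp_slices) blast
  qed
next
  note K0 = cvs.subspace_0[OF hilbert_subspace_module(1)[OF K]]
  show "slices X \<subseteq> closed_span {slice H K t0 H K t0 \<omega> X | \<omega>. \<omega> \<in> normal_functionals K K}"
  proof (rule slices_subset[OF closed_subsp_closed_span])
    fix \<eta> \<xi>
    define \<xi>' where "\<xi>' n = (if n = 0 then proj K \<xi> else 0)" for n :: nat
    define \<eta>' where "\<eta>' n = (if n = 0 then proj K \<eta> else 0)" for n :: nat
    define \<omega> where "\<omega> = (\<lambda>T\<in>bop K K. \<Sum>n. cinner (\<eta>' n) (blinfun_apply T (\<xi>' n)))"
    have mem: "\<xi>' n \<in> K" "\<eta>' n \<in> K" for n by (simp_all add: \<xi>'_def \<eta>'_def proj_in[OF K] K0)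
    have "(\<lambda>n. (norm (\<xi>' n))\<^sup>2) = (\<lambda>n. if n = 0 then (norm (proj K \<xi>))\<^sup>2 else 0)"
      "(\<lambda>n. (norm (\<eta>' n))\<^sup>2) = (\<lambda>n. if n = 0 then (norm (proj K \<eta>))\<^sup>2 else 0)"
      by (auto simp: \<xi>'_def \<eta>'_def)
    then have sum: "summable (\<lambda>n. (norm (\<xi>' n))\<^sup>2)" "summable (\<lambda>n. (norm (\<eta>' n))\<^sup>2)"
      using summable_single[of 0 "\<lambda>_. (norm (proj K \<xi>))\<^sup>2"] summable_single[of 0 "\<lambda>_. (norm (proj K \<eta>))\<^sup>2"] by simp_all
    have "vslice X (\<eta>' n) (\<xi>' n) = (if n = 0 then vslice X \<eta> \<xi> else 0)" for n
      by (simp add: \<xi>'_def \<eta>'_def vslice_proj) (simp add: vslice_def cr_zero blinfun_compose_lin)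
    then have "(\<lambda>n. vslice X (\<eta>' n) (\<xi>' n)) sums vslice X \<eta> \<xi>"
      using sums_single[of 0 "\<lambda>_. vslice X \<eta> \<xi>"] by simp
    then have "slice H K t0 H K t0 \<omega> X = vslice X \<eta> \<xi>"
      using slice_normal_functional(2)[OF X t0 \<omega>_def mem sum] by (simp add: sums_iff)
    moreover have "\<omega> \<in> normal_functionals K K"
      unfolding normal_functionals_def \<omega>_def using mem sum by blast
    ultimately show "vslice X \<eta> \<xi> \<in> closed_span {slice H K t0 H K t0 \<omega> X | \<omega>. \<omega> \<in> normal_functionals K K}"
      by (intro subsetD[OF closed_span_superset]) (metis (mono_tags, lifting) mem_Collect_eq)
  qed
qed

end

section \<open>Braided pentagon identities\<close>

text \<open>Operators are extended by zero, so a unitary on a subspace has the projection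
  \<open>P\<close> as its unit instead of the ambient identity.\<close>

definition unitaries :: "('v::complex_hilbert_space \<Rightarrow>\<^sub>L 'v) \<Rightarrow> ('v \<Rightarrow>\<^sub>L 'v) set" where
  "unitaries P = {X. clin X \<and> X o\<^sub>L adj X = P \<and> adj X o\<^sub>L X = P \<and> P o\<^sub>L X = X \<and> X o\<^sub>L P = X}"

lemma unitaries_adj:
  assumes "X \<in> unitaries P"
  shows "adj X \<in> unitaries P"
proof -
  have X: "clin X" "X o\<^sub>L adj X = P" "adj X o\<^sub>L X = P" "P o\<^sub>L X = X" "X o\<^sub>L P = X"
    using assms by (auto simp: unitaries_def)
  have "clin P" unfolding X(2)[symmetric] using X(1) by simp
  have "adj P = P" unfolding X(2)[symmetric] using X(1) by (simp add: adj_compose)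
  then have "adj X o\<^sub>L P = adj X" "P o\<^sub>L adj X = adj X"
    using X(1,4,5) \<open>clin P\<close> adj_compose[of P X] adj_compose[of X P] by simp_all
  with X show ?thesis by (simp add: unitaries_def)
qed

lemma unitaries_compose:
  assumes "X \<in> unitaries P" "Y \<in> unitaries P"
  shows "X o\<^sub>L Y \<in> unitaries P"
proof -
  have X: "clin X" "X o\<^sub>L adj X = P" "adj X o\<^sub>L X = P" "P o\<^sub>L X = X" "X o\<^sub>L P = X"
    using assms by (auto simp: unitaries_def)
  have Y: "clin Y" "Y o\<^sub>L adj Y = P" "adj Y o\<^sub>L Y = P" "P o\<^sub>L Y = Y" "Y o\<^sub>L P = Y"
    using assms by (auto simp: unitaries_def)
  have aX: "P o\<^sub>L adj X = adj X" using unitaries_adj[OF assms(1)] by (simp add: unitaries_def)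
  have "(X o\<^sub>L Y) o\<^sub>L adj (X o\<^sub>L Y) = X o\<^sub>L ((Y o\<^sub>L adj Y) o\<^sub>L adj X)"
    "adj (X o\<^sub>L Y) o\<^sub>L (X o\<^sub>L Y) = adj Y o\<^sub>L ((adj X o\<^sub>L X) o\<^sub>L Y)"
    "P o\<^sub>L (X o\<^sub>L Y) = (P o\<^sub>L X) o\<^sub>L Y"
    using X(1) Y(1) by (simp_all add: adj_compose blinfun_compose_assoc)
  with X Y aX show ?thesis by (simp add: unitaries_def blinfun_compose_assoc)
qed

lemma unitaries_cancel:
  assumes "X \<in> unitaries P" "Y \<in> unitaries P"
  shows "X o\<^sub>L (adj X o\<^sub>L Y) = Y" "adj X o\<^sub>L (X o\<^sub>L Y) = Y"
  using assms unfolding blinfun_compose_assoc[symmetric] by (auto simp: unitaries_def)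

text \<open>\<open>f\<close> and \<open>g\<close> stand for \<open>F\<close> in legs 12 and 23,
  \<open>p\<close> and \<open>q\<close> for \<open>c\<close> in the same legs. In order, the
  conclusions serve products of slices of \<open>F\<close>, adjoints of slices of \<open>F\<close>,
  and adjoints of slices of \<open>G\<close>.\<close>

lemma braided_pentagon:
  fixes f g p q P :: "'v::complex_hilbert_space \<Rightarrow>\<^sub>L 'v"
  assumes U: "f \<in> unitaries P" "g \<in> unitaries P" "p \<in> unitaries P" "q \<in> unitaries P"
    and nat1: "p o\<^sub>L (q o\<^sub>L f) = g o\<^sub>L (p o\<^sub>L q)"
    and nat2: "q o\<^sub>L (p o\<^sub>L g) = f o\<^sub>L (q o\<^sub>L p)"
    and braid: "p o\<^sub>L (q o\<^sub>L p) = q o\<^sub>L (p o\<^sub>L q)"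
    and pent: "g o\<^sub>L f = f o\<^sub>L (adj p o\<^sub>L (g o\<^sub>L (p o\<^sub>L g)))"
  shows "f o\<^sub>L (q o\<^sub>L f) = g o\<^sub>L (f o\<^sub>L (adj g o\<^sub>L q))"
    and "f o\<^sub>L ((adj q o\<^sub>L g) o\<^sub>L adj f) = adj q o\<^sub>L (adj f o\<^sub>L g)"
    and "(adj p o\<^sub>L f) o\<^sub>L (adj q o\<^sub>L (adj p o\<^sub>L f)) =
      (adj q o\<^sub>L g) o\<^sub>L ((adj p o\<^sub>L f) o\<^sub>L (adj q o\<^sub>L g))"
proof -
  note U' = U U[THEN unitaries_adj] unitaries_compose
  note cancel = unitaries_cancel[where P = P] blinfun_compose_assoc U'
  have clin: "clin f" "clin g" "clin p" "clin q" using U by (auto simp: unitaries_def)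
  have c1: "adj q o\<^sub>L q = P" "g o\<^sub>L adj g = P" "f o\<^sub>L adj f = P" "adj f o\<^sub>L f = P"
    "adj q o\<^sub>L P = adj q" "f o\<^sub>L P = f" "g o\<^sub>L P = g"
    using U unitaries_adj[OF U(4)] by (auto simp: unitaries_def)
  have qf: "q o\<^sub>L f = adj p o\<^sub>L (g o\<^sub>L (p o\<^sub>L q))"
    by (metis nat1 unitaries_cancel(2) U'(3) unitaries_compose U)
  \<comment> \<open>By \<open>nat1\<close>, \<open>adj p o g o p\<close> equals
    \<open>q o f o adj q\<close>, which removes \<open>p\<close> from the pentagon equation.\<close>
  have pent': "g o\<^sub>L f = f o\<^sub>L (q o\<^sub>L (f o\<^sub>L (adj q o\<^sub>L g)))"
  proof -
    have "q o\<^sub>L (f o\<^sub>L (adj q o\<^sub>L g)) = (q o\<^sub>L f) o\<^sub>L (adj q o\<^sub>L g)" by (simp add: blinfun_compose_assoc)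
    also have "\<dots> = adj p o\<^sub>L (g o\<^sub>L (p o\<^sub>L g))" unfolding qf by (simp add: cancel)
    finally show ?thesis by (simp add: pent)
  qed
  show 1: "f o\<^sub>L (q o\<^sub>L f) = g o\<^sub>L (f o\<^sub>L (adj g o\<^sub>L q))"
  proof -
    have "g o\<^sub>L (f o\<^sub>L (adj g o\<^sub>L q)) = (g o\<^sub>L f) o\<^sub>L (adj g o\<^sub>L q)" by (simp add: blinfun_compose_assoc)
    also have "\<dots> = f o\<^sub>L (q o\<^sub>L f)" unfolding pent' by (simp add: cancel c1)
    finally show ?thesis ..
  qed
  have fqg: "f o\<^sub>L (adj q o\<^sub>L g) = adj q o\<^sub>L (adj f o\<^sub>L (g o\<^sub>L f))"
    unfolding pent' by (simp add: cancel)
  show 2: "f o\<^sub>L ((adj q o\<^sub>L g) o\<^sub>L adj f) = adj q o\<^sub>L (adj f o\<^sub>L g)"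
  proof -
    have "f o\<^sub>L ((adj q o\<^sub>L g) o\<^sub>L adj f) = (f o\<^sub>L (adj q o\<^sub>L g)) o\<^sub>L adj f" by (simp add: blinfun_compose_assoc)
    also have "\<dots> = adj q o\<^sub>L (adj f o\<^sub>L g)" unfolding fqg by (simp add: blinfun_compose_assoc c1)
    finally show ?thesis .
  qed
  \<comment> \<open>The inverted form of \<open>nat2\<close>, and likewise \<open>fqp\<close>
    inverts \<open>nat1\<close>. Restricting \<open>X\<close> to \<open>unitaries P\<close> lets the
    unit \<open>P\<close> produced by cancellation disappear.\<close>
  have gpq: "g o\<^sub>L (adj p o\<^sub>L (adj q o\<^sub>L X)) = adj p o\<^sub>L (adj q o\<^sub>L (f o\<^sub>L X))" if X: "X \<in> unitaries P" for X
  proof -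
    define Y where "Y = adj p o\<^sub>L (adj q o\<^sub>L X)"
    have Y: "Y \<in> unitaries P" unfolding Y_def by (intro U' X)
    have "q o\<^sub>L (p o\<^sub>L (g o\<^sub>L Y)) = f o\<^sub>L (q o\<^sub>L (p o\<^sub>L Y))"
      using arg_cong[OF nat2, of "\<lambda>Z. Z o\<^sub>L Y"] by (simp add: blinfun_compose_assoc)
    also have "\<dots> = f o\<^sub>L X" unfolding Y_def by (simp add: cancel X)
    finally have "adj p o\<^sub>L (adj q o\<^sub>L (q o\<^sub>L (p o\<^sub>L (g o\<^sub>L Y)))) = adj p o\<^sub>L (adj q o\<^sub>L (f o\<^sub>L X))" by simp
    then show ?thesis by (simp add: cancel Y flip: Y_def)
  qed
  have fqp: "f o\<^sub>L (adj q o\<^sub>L (adj p o\<^sub>L X)) = adj q o\<^sub>L (adj p o\<^sub>L (g o\<^sub>L X))" if X: "X \<in> unitaries P" for X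
  proof -
    define Y where "Y = adj q o\<^sub>L (adj p o\<^sub>L X)"
    have Y: "Y \<in> unitaries P" unfolding Y_def by (intro U' X)
    have "p o\<^sub>L (q o\<^sub>L (f o\<^sub>L Y)) = g o\<^sub>L (p o\<^sub>L (q o\<^sub>L Y))"
      using arg_cong[OF nat1, of "\<lambda>Z. Z o\<^sub>L Y"] by (simp add: blinfun_compose_assoc)
    also have "\<dots> = g o\<^sub>L X" unfolding Y_def by (simp add: cancel X)
    finally have "adj q o\<^sub>L (adj p o\<^sub>L (p o\<^sub>L (q o\<^sub>L (f o\<^sub>L Y)))) = adj q o\<^sub>L (adj p o\<^sub>L (g o\<^sub>L X))" by simp
    then show ?thesis by (simp add: cancel Y flip: Y_def)
  qed
  have braid': "adj p o\<^sub>L (adj q o\<^sub>L (adj p o\<^sub>L X)) = adj q o\<^sub>L (adj p o\<^sub>L (adj q o\<^sub>L X))" for X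
    using arg_cong[OF braid, of "\<lambda>Z. adj Z o\<^sub>L X"] clin by (simp add: adj_compose blinfun_compose_assoc)
  have "(adj p o\<^sub>L f) o\<^sub>L (adj q o\<^sub>L (adj p o\<^sub>L f)) = adj p o\<^sub>L (adj q o\<^sub>L (adj p o\<^sub>L (g o\<^sub>L f)))"
    using fqp[OF U(1)] by (simp add: blinfun_compose_assoc)
  also have "\<dots> = adj q o\<^sub>L (adj p o\<^sub>L (adj q o\<^sub>L (g o\<^sub>L f)))" by (rule braid')
  also have "\<dots> = adj q o\<^sub>L (adj p o\<^sub>L (adj q o\<^sub>L (f o\<^sub>L (adj f o\<^sub>L (g o\<^sub>L f)))))" by (simp add: cancel)
  also have "\<dots> = adj q o\<^sub>L (g o\<^sub>L (adj p o\<^sub>L (adj q o\<^sub>L (adj f o\<^sub>L (g o\<^sub>L f)))))"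
    by (subst gpq) (simp_all add: U')
  also have "\<dots> = (adj q o\<^sub>L g) o\<^sub>L ((adj p o\<^sub>L f) o\<^sub>L (adj q o\<^sub>L g))"
    by (simp add: fqg blinfun_compose_assoc)
  finally show "(adj p o\<^sub>L f) o\<^sub>L (adj q o\<^sub>L (adj p o\<^sub>L f)) =
      (adj q o\<^sub>L g) o\<^sub>L ((adj p o\<^sub>L f) o\<^sub>L (adj q o\<^sub>L g))" .
qed

section \<open>Slices in a concrete monoidal W*-category\<close>

lemma inverse_mor_unitary:
  assumes "cstar_category C" "f \<in> unitary_mor C X Y"
  shows "inverse_mor C X Y f = f\<dagger>\<^bsub>C\<^esub>"
proof -
  interpret cstar_category C by fact
  have f: "f \<in> Mor C X Y" "f\<dagger>\<^bsub>C\<^esub> \<cdot>\<^bsub>C\<^esub> f = Idt C X" "f \<cdot>\<^bsub>C\<^esub> f\<dagger>\<^bsub>C\<^esub> = Idt C Y"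
    using assms(2) by (auto simp: unitary_mor_def)
  show ?thesis
    unfolding inverse_mor_def
  proof (rule the_equality)
    show "f\<dagger>\<^bsub>C\<^esub> \<in> Mor C Y X \<and> f\<dagger>\<^bsub>C\<^esub> \<cdot>\<^bsub>C\<^esub> f = Idt C X \<and> f \<cdot>\<^bsub>C\<^esub> f\<dagger>\<^bsub>C\<^esub> = Idt C Y"
      using f star_in by blast
    fix g assume g: "g \<in> Mor C Y X \<and> g \<cdot>\<^bsub>C\<^esub> f = Idt C X \<and> f \<cdot>\<^bsub>C\<^esub> g = Idt C Y"
    have "g = (f\<dagger>\<^bsub>C\<^esub> \<cdot>\<^bsub>C\<^esub> f) \<cdot>\<^bsub>C\<^esub> g" using g f(2) idt_comp by metis
    also have "\<dots> = f\<dagger>\<^bsub>C\<^esub> \<cdot>\<^bsub>C\<^esub> (f \<cdot>\<^bsub>C\<^esub> g)" using g f(1) by (intro comp_assoc star_in) auto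
    also have "\<dots> = f\<dagger>\<^bsub>C\<^esub>" using g comp_idt[OF star_in[OF f(1)]] by metis
    finally show "g = f\<dagger>\<^bsub>C\<^esub>" .
  qed
qed

context concrete_monoidal_wstar_category
begin

lemma star_idt: "(Idt C X)\<dagger> = Idt C X"
proof -
  note I = idt_in[of X]
  have "(Idt C X \<cdot> (Idt C X)\<dagger>)\<dagger> = ((Idt C X)\<dagger>)\<dagger> \<cdot> (Idt C X)\<dagger>"
    by (rule star_comp[OF star_in[OF I] I])
  then have "((Idt C X)\<dagger>)\<dagger> = Idt C X \<cdot> (Idt C X)\<dagger>"
    using idt_comp[OF star_in[OF I]] star_star[OF I] by metis
  then show ?thesis using idt_comp[OF star_in[OF I]] star_star[OF I] by metis
qed

lemma unitary_op:
  assumes "f \<in> unitary_mor C X Y"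
  shows "f \<in> Mor C X Y" "Op C f o\<^sub>L adj (Op C f) = Op C (Idt C Y)" "adj (Op C f) o\<^sub>L Op C f = Op C (Idt C X)"
proof -
  show f: "f \<in> Mor C X Y" using assms by (simp add: unitary_mor_def)
  show "Op C f o\<^sub>L adj (Op C f) = Op C (Idt C Y)"
    using assms by (simp add: unitary_mor_def op_star[OF f, symmetric] op_comp[OF star_in[OF f] f, symmetric])
  show "adj (Op C f) o\<^sub>L Op C f = Op C (Idt C X)"
    using assms by (simp add: unitary_mor_def op_star[OF f, symmetric] op_comp[OF f star_in[OF f], symmetric])
qed

lemma op_idt_compose:
  assumes "f \<in> Mor C X Y"
  shows "Op C (Idt C Y) o\<^sub>L Op C f = Op C f" "Op C f o\<^sub>L Op C (Idt C X) = Op C f"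
  using op_comp[OF assms idt_in] op_comp[OF idt_in assms] idt_comp[OF assms] comp_idt[OF assms] by simp_all

lemma op_clin: "f \<in> Mor C X Y \<Longrightarrow> clin (Op C f)"
  by (rule bop_clin[OF op_in])

lemma op_mem: "f \<in> Mor C X Y \<Longrightarrow> blinfun_apply (Op C f) x \<in> Spc C Y"
  using op_in by (auto simp: bop_def)

lemma op_proj: "f \<in> Mor C X Y \<Longrightarrow> blinfun_apply (Op C f) (proj (Spc C X) x) = blinfun_apply (Op C f) x"
  using op_in[of f X Y] by (simp add: bop_iff[OF spc_hilbert])

lemma unitary_op_unitaries: "f \<in> unitary_mor C X X \<Longrightarrow> Op C f \<in> unitaries (Op C (Idt C X))"
  using unitary_op[of f X X] op_idt_compose[of f X X] op_clin by (auto simp: unitaries_def)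

text \<open>\<open>Tv\<close> is controlled only on the spaces of \<open>X\<close> and
  \<open>Y\<close>; projecting first gives the everywhere bilinear map that
  \<open>tensor_map\<close> asks for.\<close>

definition tp :: "'o \<Rightarrow> 'o \<Rightarrow> 'v \<Rightarrow> 'v \<Rightarrow> 'v" where
  "tp X Y x y = Tv C X Y (proj (Spc C X) x) (proj (Spc C Y) y)"

lemma tp_eq: "x \<in> Spc C X \<Longrightarrow> y \<in> Spc C Y \<Longrightarrow> tp X Y x y = Tv C X Y x y"
  by (simp add: tp_def proj_of_mem[OF spc_hilbert])

lemma tv_mem: "x \<in> Spc C X \<Longrightarrow> y \<in> Spc C Y \<Longrightarrow> Tv C X Y x y \<in> Spc C (X \<odot> Y)"
  using tv_tensor[of X Y] unfolding is_hilbert_tensor_def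
  by (auto intro!: subsetD[OF closure_subset] cvs.span_base)

lemma tp_mem: "tp X Y x y \<in> Spc C (X \<odot> Y)"
  unfolding tp_def by (intro tv_mem proj_in spc_hilbert)

lemma tp_tensor_map: "tensor_map (Spc C X) (Spc C Y) (tp X Y)"
proof -
  note tv = tv_tensor[of X Y, unfolded is_hilbert_tensor_def]
  note pr = proj_in[OF spc_hilbert]
  show ?thesis
    using tv pr
    by unfold_locales
       (simp_all add: tp_def spc_hilbert proj_add[OF spc_hilbert] proj_scaleC[OF spc_hilbert]
         proj_cinner_right[OF spc_hilbert])
qed

lemma tp_dense: "Spc C (X \<odot> Y) = closure (cvs.span {tp X Y x y | x y. True})"
proof -
  have "{tp X Y x y | x y. True} = {Tv C X Y x y | x y. x \<in> Spc C X \<and> y \<in> Spc C Y}"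
  proof (intro subset_antisym subsetI)
    fix z assume "z \<in> {tp X Y x y | x y. True}"
    then show "z \<in> {Tv C X Y x y | x y. x \<in> Spc C X \<and> y \<in> Spc C Y}"
      unfolding tp_def using proj_in[OF spc_hilbert] by blast
  next
    fix z assume "z \<in> {Tv C X Y x y | x y. x \<in> Spc C X \<and> y \<in> Spc C Y}"
    then obtain x y where "x \<in> Spc C X" "y \<in> Spc C Y" "z = Tv C X Y x y" by blast
    then have "z = tp X Y x y" by (simp add: tp_eq)
    then show "z \<in> {tp X Y x y | x y. True}" by blast
  qed
  then show ?thesis using tv_tensor[of X Y] by (simp add: is_hilbert_tensor_def)
qed

lemma op_tens:
  assumes "f \<in> Mor C X X'" "g \<in> Mor C Y Y'"
  shows "blinfun_apply (Op C (f \<otimes> g)) (tp X Y x y) = tp X' Y' (blinfun_apply (Op C f) x) (blinfun_apply (Op C g) y)"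
  by (simp add: tp_def tv_natural[OF assms] proj_in[OF spc_hilbert] op_proj[OF assms(1)] op_proj[OF assms(2)]
      proj_of_mem[OF spc_hilbert] op_mem[OF assms(1)] op_mem[OF assms(2)])

lemma op_idt_proj: "blinfun_apply (Op C (Idt C X)) x = proj (Spc C X) x"
  using op_idt[OF proj_in[OF spc_hilbert], of X x] op_proj[OF idt_in, of X x] by simp

lemma slice_space_eq:
  assumes "f \<in> Mor C (X \<odot> Y) (X \<odot> Y)"
  shows "slice_space C X Y X Y f = tensor_map.slices (tp X Y) (Op C f)"
  unfolding slice_space_def
  by (rule tensor_map.closed_span_slice[OF tp_tensor_map op_clin[OF assms]]) (simp add: tp_eq)

section \<open>Legs on the triple tensor power of an object\<close>

context
  fixes L :: 'o
begin

text \<open>The adjoint associator transports the right-bracketed tensor into the left-bracketed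
  product, so both bracketings take values in one space.\<close>

definition tp23 :: "'v \<Rightarrow> 'v \<Rightarrow> 'v" where
  "tp23 x \<zeta> = blinfun_apply (adj (Op C (Assoc C L L L))) (tp L (L \<odot> L) x \<zeta>)"

lemma assoc_adj_tp:
  "blinfun_apply (Op C (Assoc C L L L)) (tp23 x \<zeta>) = tp L (L \<odot> L) x \<zeta>"
proof -
  have "blinfun_apply (Op C (Assoc C L L L)) (tp23 x \<zeta>) =
      blinfun_apply (Op C (Assoc C L L L) o\<^sub>L adj (Op C (Assoc C L L L))) (tp L (L \<odot> L) x \<zeta>)"
    by (simp add: tp23_def)
  also have "\<dots> = tp L (L \<odot> L) x \<zeta>"
    unfolding unitary_op(2)[OF assoc_unitary] by (simp add: op_idt_proj proj_of_mem[OF spc_hilbert tp_mem])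
  finally show ?thesis .
qed

lemma tp23_assoc: "tp23 x (tp L L y z) = tp (L \<odot> L) L (tp L L x y) z"
proof -
  note pr = proj_in[OF spc_hilbert]
  have "tp L (L \<odot> L) x (tp L L y z) = blinfun_apply (Op C (Assoc C L L L)) (tp (L \<odot> L) L (tp L L x y) z)"
    by (simp add: tp_def proj_of_mem[OF spc_hilbert] tv_mem pr tv_assoc)
  then have "tp23 x (tp L L y z) =
      blinfun_apply (adj (Op C (Assoc C L L L)) o\<^sub>L Op C (Assoc C L L L)) (tp (L \<odot> L) L (tp L L x y) z)"
    by (simp add: tp23_def)
  also have "\<dots> = tp (L \<odot> L) L (tp L L x y) z"
    unfolding unitary_op(3)[OF assoc_unitary] by (simp add: op_idt_proj proj_of_mem[OF spc_hilbert tp_mem])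
  finally show ?thesis .
qed

lemma tp23_tensor_map: "tensor_map (Spc C L) (Spc C (L \<odot> L)) tp23"
proof -
  interpret m: tensor_map "Spc C L" "Spc C (L \<odot> L)" "tp L (L \<odot> L)" by (rule tp_tensor_map)
  have A: "clin (Op C (Assoc C L L L))" by (rule op_clin[OF unitary_op(1)[OF assoc_unitary]])
  have "cinner (tp23 x y) (tp23 x' y') = cinner (tp L (L \<odot> L) x y) (tp L (L \<odot> L) x' y')" for x y x' y'
    unfolding tp23_def[of x y] cinner_adj_left[OF A] assoc_adj_tp ..
  then show ?thesis
    by unfold_locales
       (simp_all add: spc_hilbert m.cinner_t,
         simp_all add: tp23_def m.add_left m.add_right m.scale_left m.scale_right blinfun.add_right clinD[OF clin_adj[OF A]])
qed

lemma triple: "tensor_triple (Spc C L) (Spc C (L \<odot> L)) (tp L L) (tp (L \<odot> L) L) tp23"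
  by (intro tensor_triple.intro tp_tensor_map tp23_tensor_map tensor_triple_axioms.intro tp23_assoc tp_dense)

interpretation T: tensor_triple "Spc C L" "Spc C (L \<odot> L)" "tp L L" "tp (L \<odot> L) L" tp23
  by (rule triple)

abbreviation "LL \<equiv> L \<odot> L"
abbreviation "LLL \<equiv> (L \<odot> L) \<odot> L"

lemma leg12_mor: "f \<in> Mor C LL LL \<Longrightarrow> leg12 C L f \<in> Mor C LLL LLL"
  unfolding leg12_def by (intro tens_in idt_in)

lemma leg12_star: "f \<in> Mor C LL LL \<Longrightarrow> leg12 C L (f\<dagger>) = (leg12 C L f)\<dagger>"
  unfolding leg12_def by (simp add: tens_star[OF _ idt_in] star_idt)

lemma leg23_mor: "f \<in> Mor C LL LL \<Longrightarrow> leg23 C L f \<in> Mor C LLL LLL"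
  unfolding leg23_def
  by (rule comp_in[OF unitary_op(1)[OF assoc_unitary]
      comp_in[OF tens_in[OF idt_in] star_in[OF unitary_op(1)[OF assoc_unitary]]]])

lemma op_leg23:
  assumes "f \<in> Mor C LL LL"
  shows "Op C (leg23 C L f) = adj (Op C (Assoc C L L L)) o\<^sub>L (Op C (Idt C L \<otimes> f) o\<^sub>L Op C (Assoc C L L L))"
proof -
  note A = unitary_op(1)[OF assoc_unitary, of L L L]
  note t = tens_in[OF idt_in assms, of L]
  show ?thesis
    unfolding leg23_def
    by (simp add: op_comp[OF A comp_in[OF t star_in[OF A]]] op_comp[OF t star_in[OF A]] op_star[OF A]
        blinfun_compose_assoc)
qed

lemma is_leg12_op:
  assumes "f \<in> Mor C LL LL"
  shows "T.is_leg12 (Op C f) (Op C (leg12 C L f))"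
proof -
  have adj: "adj (Op C (leg12 C L f)) = Op C (leg12 C L (f\<dagger>))"
    by (simp add: leg12_star[OF assms] op_star[OF leg12_mor[OF assms]])
  have id: "tp LL L q (blinfun_apply (Op C (Idt C L)) z) = tp LL L q z" for q z
    by (simp add: op_idt_proj T.t3.proj_right)
  show ?thesis
    unfolding T.is_leg12_def adj op_star[OF assms, symmetric]
    by (auto simp: op_in[OF assms] op_clin[OF leg12_mor[OF assms], unfolded leg12_def] leg12_def
        op_tens[OF assms idt_in] op_tens[OF star_in[OF assms] idt_in] id)
qed

lemma is_leg23_op:
  assumes "f \<in> Mor C LL LL"
  shows "T.is_leg23 (Op C f) (Op C (leg23 C L f))"
proof -
  have A: "clin (Op C (Assoc C L L L))" by (rule op_clin[OF unitary_op(1)[OF assoc_unitary]])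
  have id: "tp L LL (blinfun_apply (Op C (Idt C L)) x) q = tp L LL x q" for x q
    using tensor_map.proj_left[OF tp_tensor_map] by (simp add: op_idt_proj)
  have half: "blinfun_apply (Op C (leg23 C L g)) (tp23 x \<zeta>) = tp23 x (blinfun_apply (Op C g) \<zeta>)"
    if "g \<in> Mor C LL LL" for g x \<zeta>
    by (simp add: op_leg23[OF that] assoc_adj_tp op_tens[OF idt_in that] id) (simp add: tp23_def)
  have "adj (Op C (leg23 C L f)) = Op C (leg23 C L (f\<dagger>))"
    using op_clin[OF tens_in[OF idt_in assms, of L]] op_star[OF tens_in[OF idt_in assms, of L]]
      tens_star[OF idt_in assms, of L]
    by (simp add: op_leg23[OF assms] op_leg23[OF star_in[OF assms]] adj_compose A star_idt blinfun_compose_assoc)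
  then show ?thesis
    unfolding T.is_leg23_def op_star[OF assms, symmetric]
    by (auto simp: op_in[OF assms] op_clin[OF leg23_mor[OF assms]] half[OF assms] half[OF star_in[OF assms]])
qed

lemma leg12_unitary:
  assumes "f \<in> unitary_mor C LL LL"
  shows "Op C (leg12 C L f) \<in> unitaries (Op C (Idt C LLL))"
proof -
  have f: "f \<in> Mor C LL LL" "f\<dagger> \<cdot> f = Idt C LL" "f \<cdot> f\<dagger> = Idt C LL"
    using assms by (auto simp: unitary_mor_def)
  have "leg12 C L f \<in> unitary_mor C LLL LLL"
    unfolding unitary_mor_def
    using f tens_comp[OF f(1) star_in[OF f(1)] idt_in idt_in, of L] tens_comp[OF star_in[OF f(1)] f(1) idt_in idt_in, of L]
      comp_idt[OF idt_in, of L]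
    by (simp add: leg12_mor flip: leg12_star) (simp add: leg12_def tens_idt)
  then show ?thesis by (rule unitary_op_unitaries)
qed

lemma leg23_unitary:
  assumes "f \<in> unitary_mor C LL LL"
  shows "Op C (leg23 C L f) \<in> unitaries (Op C (Idt C LLL))"
proof -
  let ?A = "Op C (Assoc C L L L)" and ?I = "Op C (Idt C L \<otimes> f)"
  have f: "f \<in> Mor C LL LL" "f\<dagger> \<cdot> f = Idt C LL" "f \<cdot> f\<dagger> = Idt C LL"
    using assms by (auto simp: unitary_mor_def)
  note A = unitary_op[OF assoc_unitary, of L L L]
  have "Idt C L \<otimes> f \<in> unitary_mor C (L \<odot> LL) (L \<odot> LL)"
    unfolding unitary_mor_def
    using f tens_comp[OF idt_in idt_in f(1) star_in[OF f(1)], of L] tens_comp[OF idt_in idt_in star_in[OF f(1)] f(1), of L]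
      comp_idt[OF idt_in, of L]
    by (simp add: tens_in[OF idt_in] tens_star[OF idt_in] star_idt tens_idt)
  note I = unitary_op[OF this]
  note cl = op_clin[OF A(1)] op_clin[OF I(1)]
  note id = op_idt_compose[OF A(1)] op_idt_compose[OF I(1)] op_idt_compose[OF leg23_mor[OF f(1)]]
  have adjA: "adj ?A o\<^sub>L Op C (Idt C (L \<odot> LL)) = adj ?A"
    using op_idt_compose(2)[OF star_in[OF A(1)]] by (simp add: op_star[OF A(1)])
  have adj: "adj (Op C (leg23 C L f)) = adj ?A o\<^sub>L (adj ?I o\<^sub>L ?A)"
    by (simp add: op_leg23[OF f(1)] adj_compose cl blinfun_compose_assoc)
  have "Op C (leg23 C L f) o\<^sub>L adj (Op C (leg23 C L f)) =
      adj ?A o\<^sub>L (?I o\<^sub>L ((?A o\<^sub>L adj ?A) o\<^sub>L (adj ?I o\<^sub>L ?A)))"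
    unfolding adj unfolding op_leg23[OF f(1)] by (simp add: blinfun_compose_assoc)
  also have "\<dots> = adj ?A o\<^sub>L ((?I o\<^sub>L Op C (Idt C (L \<odot> LL))) o\<^sub>L (adj ?I o\<^sub>L ?A))"
    unfolding A(2) by (simp add: blinfun_compose_assoc)
  also have "\<dots> = (adj ?A o\<^sub>L (?I o\<^sub>L adj ?I)) o\<^sub>L ?A" unfolding id by (simp add: blinfun_compose_assoc)
  also have "\<dots> = Op C (Idt C LLL)" unfolding I(2) adjA A(3) ..
  finally have 1: "Op C (leg23 C L f) o\<^sub>L adj (Op C (leg23 C L f)) = Op C (Idt C LLL)" .
  have "adj (Op C (leg23 C L f)) o\<^sub>L Op C (leg23 C L f) =
      adj ?A o\<^sub>L (adj ?I o\<^sub>L ((?A o\<^sub>L adj ?A) o\<^sub>L (?I o\<^sub>L ?A)))"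
    unfolding adj unfolding op_leg23[OF f(1)] by (simp add: blinfun_compose_assoc)
  also have "\<dots> = adj ?A o\<^sub>L (adj ?I o\<^sub>L ((Op C (Idt C (L \<odot> LL)) o\<^sub>L ?I) o\<^sub>L ?A))"
    unfolding A(2) by (simp add: blinfun_compose_assoc)
  also have "\<dots> = (adj ?A o\<^sub>L (adj ?I o\<^sub>L ?I)) o\<^sub>L ?A" unfolding id by (simp add: blinfun_compose_assoc)
  also have "\<dots> = Op C (Idt C LLL)" unfolding I(3) adjA A(3) ..
  finally show ?thesis using 1 id op_clin[OF leg23_mor[OF f(1)]] by (simp add: unitaries_def)
qed

text \<open>The hexagons express the braiding of \<open>LL\<close> with \<open>L\<close>, and of
  \<open>L\<close> with \<open>LL\<close>, by \<open>p o q\<close> and \<open>q o p\<close> up to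
  the associator; naturality for \<open>f\<close> beside an identity gives the two relations. For
  \<open>f = c L L\<close> the first one is the braid relation.\<close>

lemma braiding_natural_legs:
  assumes br: "braiding C c" and cu: "c L L \<in> unitary_mor C LL LL" and f: "f \<in> Mor C LL LL"
  defines "p \<equiv> Op C (leg12 C L (c L L))" and "q \<equiv> Op C (leg23 C L (c L L))"
  shows "p o\<^sub>L (q o\<^sub>L Op C (leg12 C L f)) = Op C (leg23 C L f) o\<^sub>L (p o\<^sub>L q)"
    and "q o\<^sub>L (p o\<^sub>L Op C (leg23 C L f)) = Op C (leg12 C L f) o\<^sub>L (q o\<^sub>L p)"
proof -
  let ?A = "Op C (Assoc C L L L)" and ?P = "Op C (Idt C LLL)"
  have cm: "c X Y \<in> Mor C (X \<odot> Y) (Y \<odot> X)" for X Y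
    using br by (auto simp: braiding_def iso_mor_def)
  note A = unitary_op[OF assoc_unitary, of L L L]
  note A' = star_in[OF A(1)]
  note c0 = cm[of L L]
  note ci = tens_in[OF c0 idt_in, of L] and ic = tens_in[OF idt_in c0, of L]
    and fi = tens_in[OF f idt_in, of L] and if' = tens_in[OF idt_in f, of L]
  note q_eq = op_leg23[OF c0, folded q_def]
  note pq_id = op_idt_compose[OF leg12_mor[OF c0], folded p_def] op_idt_compose[OF leg23_mor[OF c0], folded q_def]
  have nat: "c X' Y' \<cdot> (g \<otimes> h) = (h \<otimes> g) \<cdot> c X Y" if "g \<in> Mor C X X'" "h \<in> Mor C Y Y'" for X X' Y Y' g h
    using br that unfolding braiding_def by blast
  have hex1: "c LL L = Assoc C L L L \<cdot> (c L L \<otimes> Idt C L) \<cdot> (Assoc C L L L)\<dagger> \<cdot>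
      (Idt C L \<otimes> c L L) \<cdot> Assoc C L L L"
    using br unfolding braiding_def by blast
  have hex2: "c L LL = (Assoc C L L L)\<dagger> \<cdot> (Idt C L \<otimes> c L L) \<cdot> Assoc C L L L \<cdot>
      (c L L \<otimes> Idt C L) \<cdot> (Assoc C L L L)\<dagger>"
    using br unfolding braiding_def by blast
  note m1 = comp_in[OF ci A(1)]
  note m2 = comp_in[OF A' m1]
  note m3 = comp_in[OF ic m2]
  have op1: "Op C (c LL L) = ?A o\<^sub>L (p o\<^sub>L q)"
    unfolding hex1 op_comp[OF A(1) m3] op_comp[OF ic m2] op_comp[OF A' m1] op_comp[OF ci A(1)] op_star[OF A(1)]
      q_eq p_def leg12_def by (simp add: blinfun_compose_assoc)
  note n1 = comp_in[OF ic A']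
  note n2 = comp_in[OF A(1) n1]
  note n3 = comp_in[OF ci n2]
  have op2: "Op C (c L LL) = q o\<^sub>L (p o\<^sub>L adj ?A)"
    unfolding hex2 op_comp[OF A' n3] op_comp[OF ci n2] op_comp[OF A(1) n1] op_comp[OF ic A'] op_star[OF A(1)]
      q_eq p_def leg12_def by (simp add: blinfun_compose_assoc)
  have e1: "?A o\<^sub>L (p o\<^sub>L (q o\<^sub>L Op C (leg12 C L f))) = Op C (Idt C L \<otimes> f) o\<^sub>L (?A o\<^sub>L (p o\<^sub>L q))"
    using arg_cong[OF nat[OF f idt_in, of L], of "Op C"]
    unfolding op_comp[OF fi cm] op_comp[OF cm if'] op1 leg12_def by (simp add: blinfun_compose_assoc)
  have "p o\<^sub>L (q o\<^sub>L Op C (leg12 C L f)) = (?P o\<^sub>L p) o\<^sub>L (q o\<^sub>L Op C (leg12 C L f))"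
    by (simp add: pq_id)
  also have "\<dots> = adj ?A o\<^sub>L (?A o\<^sub>L (p o\<^sub>L (q o\<^sub>L Op C (leg12 C L f))))"
    by (simp add: blinfun_compose_assoc flip: A(3))
  also have "\<dots> = Op C (leg23 C L f) o\<^sub>L (p o\<^sub>L q)"
    unfolding e1 op_leg23[OF f] by (simp add: blinfun_compose_assoc)
  finally show "p o\<^sub>L (q o\<^sub>L Op C (leg12 C L f)) = Op C (leg23 C L f) o\<^sub>L (p o\<^sub>L q)" .
  have e2: "q o\<^sub>L (p o\<^sub>L (adj ?A o\<^sub>L Op C (Idt C L \<otimes> f))) = Op C (leg12 C L f) o\<^sub>L (q o\<^sub>L (p o\<^sub>L adj ?A))"
    using arg_cong[OF nat[OF idt_in f, of L], of "Op C"]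
    unfolding op_comp[OF if' cm] op_comp[OF cm fi] op2 leg12_def by (simp add: blinfun_compose_assoc)
  have "q o\<^sub>L (p o\<^sub>L Op C (leg23 C L f)) = (q o\<^sub>L (p o\<^sub>L (adj ?A o\<^sub>L Op C (Idt C L \<otimes> f)))) o\<^sub>L ?A"
    unfolding op_leg23[OF f] by (simp add: blinfun_compose_assoc)
  also have "\<dots> = Op C (leg12 C L f) o\<^sub>L (q o\<^sub>L (p o\<^sub>L (adj ?A o\<^sub>L ?A)))"
    unfolding e2 by (simp add: blinfun_compose_assoc)
  also have "\<dots> = Op C (leg12 C L f) o\<^sub>L (q o\<^sub>L p)" unfolding A(3) pq_id ..
  finally show "q o\<^sub>L (p o\<^sub>L Op C (leg23 C L f)) = Op C (leg12 C L f) o\<^sub>L (q o\<^sub>L p)" .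
qed

section \<open>The slice algebra of a multiplicative unitary\<close>

lemma slices_of_multiplicative_unitary:
  assumes sr: "semi_regular_braiding C c" and mu: "multiplicative_unitary C c L F"
  shows "C_space C c L F = adj ` C_space C c L F \<Longrightarrow> cstar_subalgebra (Spc C L) (A_hat C L F)"
    and "semi_regular C c L F \<Longrightarrow> C_space C c L F = adj ` C_space C c L F"
proof -
  have br: "braiding C c" and cu: "c L L \<in> unitary_mor C LL LL"
    and compact_c: "compact_ops (Spc C L) (Spc C L) \<subseteq> slice_space C L L L L (c L L)"
    using sr by (auto simp: semi_regular_braiding_def)
  have Fu: "F \<in> unitary_mor C LL LL" using mu by (simp add: multiplicative_unitary_def)
  note c0 = unitary_op(1)[OF cu] and F0 = unitary_op(1)[OF Fu]
  have inv: "inverse_braid C c L = (c L L)\<dagger>"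
    unfolding inverse_braid_def by (rule inverse_mor_unitary[OF cstar_category_axioms cu])
  define f g p q where "f = Op C (leg12 C L F)" and "g = Op C (leg23 C L F)"
    and "p = Op C (leg12 C L (c L L))" and "q = Op C (leg23 C L (c L L))"
  note defs = f_def g_def p_def q_def
  define G where "G = adj (Op C (c L L)) o\<^sub>L Op C F"
  have U: "f \<in> unitaries (Op C (Idt C LLL))" "g \<in> unitaries (Op C (Idt C LLL))"
    "p \<in> unitaries (Op C (Idt C LLL))" "q \<in> unitaries (Op C (Idt C LLL))"
    unfolding defs by (intro leg12_unitary leg23_unitary cu Fu)+
  have pent: "g o\<^sub>L f = f o\<^sub>L (adj p o\<^sub>L (g o\<^sub>L (p o\<^sub>L g)))"
  proof -
    note m12 = leg12_mor[OF F0] and m23 = leg23_mor[OF F0] and mc = leg12_mor[OF c0]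
    note mc' = star_in[OF mc]
    note k1 = comp_in[OF mc' m12]
    note k2 = comp_in[OF m23 k1]
    note k3 = comp_in[OF mc k2]
    have "leg23 C L F \<cdot> leg12 C L F =
       leg12 C L F \<cdot> (leg12 C L (c L L))\<dagger> \<cdot> leg23 C L F \<cdot> leg12 C L (c L L) \<cdot> leg23 C L F"
      using mu by (simp add: multiplicative_unitary_def inv leg12_star[OF c0])
    from arg_cong[OF this, of "Op C"] show ?thesis
      unfolding op_comp[OF m12 m23] op_comp[OF m23 k3] op_comp[OF mc k2] op_comp[OF m23 k1]
        op_comp[OF mc' m12] op_star[OF mc] defs
      by (simp add: blinfun_compose_assoc)
  qed
  note nat = braiding_natural_legs[OF br cu, folded p_def q_def]
  note bp = braided_pentagon[OF U nat[OF F0, folded f_def g_def] nat(1)[OF c0, folded p_def q_def] pent]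
  note legF = is_leg12_op[OF F0, folded f_def] is_leg23_op[OF F0, folded g_def]
  note legc = is_leg12_op[OF c0, folded p_def] is_leg23_op[OF c0, folded q_def]
  have legG: "T.is_leg12 G (adj p o\<^sub>L f)" "T.is_leg23 G (adj q o\<^sub>L g)"
    unfolding G_def by (intro T.is_leg12_compose T.is_leg23_compose T.is_leg12_adj T.is_leg23_adj legF legc)+
  have C_eq: "C_space C c L F = T.t.slices G"
    unfolding C_space_def inv G_def
    by (simp add: slice_space_eq comp_in[OF F0 star_in[OF c0]] op_comp[OF F0 star_in[OF c0]] op_star[OF c0])
  have A_eq: "A_hat C L F = T.t.slices (Op C F)"
    unfolding A_hat_def by (rule slice_space_eq[OF F0])
  show "cstar_subalgebra (Spc C L) (A_hat C L F)" if selfadj: "C_space C c L F = adj ` C_space C c L F"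
    unfolding cstar_subalgebra_def A_eq
  proof (intro conjI ballI)
    show "T.t.slices (Op C F) \<subseteq> bop (Spc C L) (Spc C L)" by (rule T.t.slices_bop[OF op_clin[OF F0]])
    show "ops.subspace (T.t.slices (Op C F))" "closed (T.t.slices (Op C F))"
      using T.t.closed_subsp_slices[of "Op C F"] by (auto simp: closed_subsp_def)
    show "S o\<^sub>L R \<in> T.t.slices (Op C F)" if "S \<in> T.t.slices (Op C F)" "R \<in> T.t.slices (Op C F)" for S R
    \<comment> \<open>Here \<open>A = B = R = F\<close>, the middle operator is the braiding, and
      the outer factors are \<open>U = F\<close> and \<open>V = adj F o c\<close>.\<close>
    proof (rule T.slices_compose[OF legF(1) legF(1) legc(2) legF(1) legF(2) _ bp(1) _ that])
      show "T.is_leg23 (adj (Op C F) o\<^sub>L Op C (c L L)) (adj g o\<^sub>L q)"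
        by (intro T.is_leg23_compose T.is_leg23_adj legF legc)
      show "T.rank_one \<xi> \<eta> \<in> T.t.slices (Op C (c L L))" for \<xi> \<eta>
        using compact_c T.rank_one_compact[of \<xi> \<eta>] unfolding slice_space_eq[OF c0] by blast
    qed
    show "adj S \<in> T.t.slices (Op C F)" if "S \<in> T.t.slices (Op C F)" for S
    proof (rule T.slices_adj_subset[OF legF legc(2) legG(2) bp(2) _ _ that])
      \<comment> \<open>The second pentagon identity is solved for \<open>adj f\<close> by
        cancelling the unitaries \<open>q\<close> and \<open>g\<close>.\<close>
      show "adj f = q o\<^sub>L ((f o\<^sub>L ((adj q o\<^sub>L g) o\<^sub>L adj f)) o\<^sub>L adj g)"
      proof -
        have "q o\<^sub>L ((adj q o\<^sub>L (adj f o\<^sub>L g)) o\<^sub>L adj g) = q o\<^sub>L (adj q o\<^sub>L (adj f o\<^sub>L (g o\<^sub>L adj g)))"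
          by (simp add: blinfun_compose_assoc)
        also have "\<dots> = q o\<^sub>L (adj q o\<^sub>L adj f)"
          using U(2) unitaries_adj[OF U(1)] by (simp add: unitaries_def)
        also have "\<dots> = adj f" by (rule unitaries_cancel(1)[OF U(4) unitaries_adj[OF U(1)]])
        finally show ?thesis unfolding bp(2) ..
      qed
      show "adj k \<in> T.t.slices G" if "k \<in> T.t.slices G" for k
        using that selfadj unfolding C_eq by blast
    qed
  qed
  show "C_space C c L F = adj ` C_space C c L F" if reg: "semi_regular C c L F"
  proof -
    define a where "a = adj p o\<^sub>L f"
    define b where "b = adj q o\<^sub>L g"
    have aU: "a \<in> unitaries (Op C (Idt C LLL))" and bU: "b \<in> unitaries (Op C (Idt C LLL))"
      unfolding a_def b_def by (intro unitaries_compose unitaries_adj U)+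
    note U' = aU bU U(4) aU[THEN unitaries_adj] bU[THEN unitaries_adj] U(4)[THEN unitaries_adj] unitaries_compose
    have aqa: "a o\<^sub>L (adj q o\<^sub>L a) = b o\<^sub>L (a o\<^sub>L b)" unfolding a_def b_def by (rule bp(3))
    have P: "b o\<^sub>L adj b = Op C (Idt C LLL)" "a o\<^sub>L Op C (Idt C LLL) = a"
      using aU bU by (auto simp: unitaries_def)
    \<comment> \<open>The third pentagon identity is multiplied by \<open>adj a\<close> on the left
      and \<open>adj b\<close> on the right; \<open>eq2\<close> then results from multiplying
      \<open>eq1\<close> by \<open>q\<close> on the left and \<open>adj a\<close> on the
      right.\<close>
    have eq1: "adj a o\<^sub>L (b o\<^sub>L a) = adj q o\<^sub>L (a o\<^sub>L adj b)"
    proof -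
      have "adj q o\<^sub>L a = adj a o\<^sub>L (a o\<^sub>L (adj q o\<^sub>L a))" by (rule unitaries_cancel(2)[OF aU, symmetric]) (intro U')
      also have "\<dots> = adj a o\<^sub>L (b o\<^sub>L (a o\<^sub>L b))" unfolding aqa ..
      finally have "(adj q o\<^sub>L a) o\<^sub>L adj b = adj a o\<^sub>L (b o\<^sub>L (a o\<^sub>L (b o\<^sub>L adj b)))"
        by (simp add: blinfun_compose_assoc)
      then show ?thesis unfolding P by (simp add: blinfun_compose_assoc)
    qed
    have eq2: "a o\<^sub>L (adj b o\<^sub>L adj a) = q o\<^sub>L (adj a o\<^sub>L b)"
    proof -
      have "a o\<^sub>L adj b = q o\<^sub>L (adj q o\<^sub>L (a o\<^sub>L adj b))"
        by (rule unitaries_cancel(1)[OF U(4), symmetric]) (intro U')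
      also have "\<dots> = q o\<^sub>L (adj a o\<^sub>L (b o\<^sub>L a))" unfolding eq1 ..
      finally have "(a o\<^sub>L adj b) o\<^sub>L adj a = q o\<^sub>L (adj a o\<^sub>L (b o\<^sub>L (a o\<^sub>L adj a)))"
        by (simp add: blinfun_compose_assoc)
      moreover have "b o\<^sub>L (a o\<^sub>L adj a) = b" using aU bU by (simp add: unitaries_def)
      ultimately show ?thesis by (simp add: blinfun_compose_assoc)
    qed
    have compact_G: "T.rank_one \<xi> \<eta> \<in> T.t.slices G" for \<xi> \<eta>
      using reg T.rank_one_compact[of \<xi> \<eta>] unfolding semi_regular_def C_eq by blast
    have adj_mem: "adj S \<in> T.t.slices G" if "S \<in> T.t.slices G" for S
      by (rule T.slices_adj_of_compact[OF legG[folded a_def b_def] legc(2) eq1 eq2 compact_G that])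
    have clin_mem: "clin S" if "S \<in> T.t.slices G" for S
      using T.t.slices_bop[OF T.legs_clin(1)[OF legG(1)]] that bop_clin by blast
    show ?thesis unfolding C_eq
    proof
      show "adj ` T.t.slices G \<subseteq> T.t.slices G" using adj_mem by blast
      show "T.t.slices G \<subseteq> adj ` T.t.slices G"
        using adj_mem clin_mem by (metis adj_adj imageI subsetI)
    qed
  qed
qed

end

end

text \<open>The second conjunct is the parenthetical claim: semi-regularity of \<open>F\<close>
  implies the selfadjointness assumed in the first.\<close>

theorem proposition9:
  fixes C :: "('o, 'm, 'v::complex_hilbert_space) concrete_wstar_cat"
    and c :: "'o \<Rightarrow> 'o \<Rightarrow> 'm" and L :: 'o and F :: 'm
  assumes "concrete_monoidal_wstar_category C"
    and "semi_regular_braiding C c"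
    and "multiplicative_unitary C c L F"
  shows "(C_space C c L F = adj ` C_space C c L F \<longrightarrow> cstar_subalgebra (Spc C L) (A_hat C L F)) \<and>
         (semi_regular C c L F \<longrightarrow> C_space C c L F = adj ` C_space C c L F)"
  using concrete_monoidal_wstar_category.slices_of_multiplicative_unitary[OF assms] by blast

end
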